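(* Let $d_{\mathrm{Br}}(t)$ be the total variation distance to the uniform distribution at time $t>0$ of standard Brownian motion started from $(0,0)$ on $(\mathbb{R}/\mathbb{Z})^2$, and let $c_{\mathrm{puz}}=\frac{5}{2}(\pi-1)$. For each $n$ fix one labeled piece of the $n^2-1$ puzzle, and for $t>0$ let $\nu_{n,t}$ be the distribution on $(\mathbb{Z}/n\mathbb{Z})^2$ of the position of this piece after $\lfloor c_{\mathrm{puz}}n^4t\rfloor$ steps of the $n^2-1$ puzzle chain started from its initial configuration. Then, as $n\to\infty$, $\|\nu_{n,t}-\mathbf{U}_{(\mathbb{Z}/n\mathbb{Z})^2}\|_{\mathrm{TV}}$ converges to $d_{\mathrm{Br}}(t)$, uniformly for $t$ in compact subsets of $(0,\infty)$, where $\mathbf{U}_{(\mathbb{Z}/n\mathbb{Z})^2}$ is the uniform probability measure on $(\mathbb{Z}/n\mathbb{Z})^2$.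
   Context: The $n^2-1$ puzzle chain: the board is $(\mathbb{Z}/n\mathbb{Z})^2$ (an $n\times n$ board with periodic boundary conditions); $n^2-1$ labeled pieces occupy all squares but one, the remaining square being empty. In the initial configuration the pieces $1,\dots,n^2-1$ are placed left to right, then top down, with the empty square in the lower right corner. At each step, independently and with probability $\frac15$ each, either nothing happens or the empty square moves right, left, up or down, i.e. it exchanges positions with the piece occupying the corresponding (cyclically) adjacent square. Standard Brownian motion on $\mathbb{R}^2$ is normalized so that $B(1)$ is Gaussian with mean $0$ and covariance the identity $I_2$; Brownian motion on $(\mathbb{R}/\mathbb{Z})^2$ is its projection to the quotient. The total variation distance is $\|\mu-\nu\|_{\mathrm{TV}}=\sup_A|\mu(A)-\nu(A)|$. *)

theory Defs
  imports "HOL-Probability.Probability" "HOL-Combinatorics.Transposition"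
begin

text \<open>The supremum ranges over the measurable sets of \<^term>\<open>M\<close>;
  the notion is meant for probability measures with \<^prop>\<open>sets M = sets N\<close>.\<close>

definition tv_dist :: "'a measure \<Rightarrow> 'a measure \<Rightarrow> real" where
  "tv_dist M N = (SUP A\<in>sets M. \<bar>measure M A - measure N A\<bar>)"

text \<open>The group $(\mathbb{Z}/n\mathbb{Z})^2$ is represented by pairs (row, column) of
  least nonnegative residues; rows are numbered from top to bottom.\<close>

type_synonym square = "int \<times> int"

definition board :: "nat \<Rightarrow> square set" where
  "board n = {0..<int n} \<times> {0..<int n}"

definition shift :: "nat \<Rightarrow> int \<times> int \<Rightarrow> square \<Rightarrow> square" where
  "shift n v p = ((fst p + fst v) mod int n, (snd p + snd v) mod int n)"

text \<open>A configuration maps each label to the square it occupies. Label 0 stands for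
  the empty square, labels $1, \dots, n^2 - 1$ for the pieces; the values at
  larger labels are irrelevant.\<close>

type_synonym config = "nat \<Rightarrow> square"

definition initial_config :: "nat \<Rightarrow> config" where
  "initial_config n k =
     (if k = 0 then (int n - 1, int n - 1) else (int ((k - 1) div n), int ((k - 1) mod n)))"

definition move_empty :: "nat \<Rightarrow> int \<times> int \<Rightarrow> config \<Rightarrow> config" where
  "move_empty n v s = Transposition.transpose (s 0) (shift n v (s 0)) \<circ> s"

text \<open>The displacements (stay, right, left, up, down) are chosen in $\mathbb{Z}^2$, so that
  they are five distinct moves even if some of them agree modulo $n$.\<close>

definition puzzle_step :: "nat \<Rightarrow> config \<Rightarrow> config pmf" where
  "puzzle_step n s =
     map_pmf (\<lambda>v. move_empty n v s) (pmf_of_set {(0, 0), (0, 1), (0, -1), (-1, 0), (1, 0)})"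

primrec puzzle_chain :: "nat \<Rightarrow> nat \<Rightarrow> config pmf" where
  "puzzle_chain n 0 = return_pmf (initial_config n)"
| "puzzle_chain n (Suc m) = puzzle_chain n m \<bind> puzzle_step n"

definition piece_law :: "nat \<Rightarrow> nat \<Rightarrow> nat \<Rightarrow> square pmf" where
  "piece_law n k m = map_pmf (\<lambda>s. s k) (puzzle_chain n m)"

definition c_puz :: real where
  "c_puz = 5 / 2 * (pi - 1)"

text \<open>The density of the centred Gaussian law on the plane with covariance $v I_2$.\<close>

definition gauss2_density :: "real \<Rightarrow> real \<times> real \<Rightarrow> real" where
  "gauss2_density v z = normal_density 0 (sqrt v) (fst z) * normal_density 0 (sqrt v) (snd z)"

locale planar_brownian_motion = prob_space M for M :: "'a measure" +
  fixes B :: "real \<Rightarrow> 'a \<Rightarrow> real \<times> real"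
  assumes random_variable: "0 \<le> t \<Longrightarrow> random_variable borel (B t)"
    and start: "AE \<omega> in M. B 0 \<omega> = (0, 0)"
    and gaussian_increments:
      "0 \<le> s \<Longrightarrow> s < t \<Longrightarrow>
        distributed M lborel (\<lambda>\<omega>. B t \<omega> - B s \<omega>) (gauss2_density (t - s))"
    and independent_increments:
      "0 \<le> \<tau> 0 \<Longrightarrow> strict_mono_on {..m} \<tau> \<Longrightarrow>
        indep_vars (\<lambda>_. borel) (\<lambda>i \<omega>. B (\<tau> (Suc i)) \<omega> - B (\<tau> i) \<omega>) {..<m::nat}"
    and continuous_paths: "AE \<omega> in M. continuous_on {0..} (\<lambda>t. B t \<omega>)"

text \<open>The torus $(\mathbb{R}/\mathbb{Z})^2$ is represented by its fundamental domain
  $[0,1)^2$, and the quotient map by coordinatewise fractional parts.\<close>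

definition torus_proj :: "real \<times> real \<Rightarrow> real \<times> real" where
  "torus_proj z = (frac (fst z), frac (snd z))"

definition uniform_torus :: "(real \<times> real) measure" where
  "uniform_torus = uniform_measure lborel ({0..<1} \<times> {0..<1})"

definition d_Br :: "'a measure \<Rightarrow> (real \<Rightarrow> 'a \<Rightarrow> real \<times> real) \<Rightarrow> real \<Rightarrow> real" where
  "d_Br M B t = tv_dist (distr M borel (\<lambda>\<omega>. torus_proj (B t \<omega>))) uniform_torus"

end

theory Submission imports Defs begin

text \<open>
  Seen from the tagged piece, the empty square performs a random walk on the torus minus the
  origin: a step onto the origin is replaced by a jump across it, and this is when the piece moves.
  Hence the Fourier coefficient of the position of the piece at a frequency \<open>k\<close> is \<open>P\<^sub>k\<^sup>m 1\<close>,
  where \<open>P\<^sub>k\<close> is this walk twisted by a phase on the jumps, a self-adjoint operator. Its energy form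
  is a Dirichlet form plus the energy of two edges across the hole that carry a magnetic phase.
  Minimizing it is a resistor problem whose effective resistance between opposite neighbours of the
  hole tends to \<open>\<pi> - 2\<close>; this yields the leading eigenvalue
  \<open>1 - 4\<pi>\<^sup>2\<bar>k\<bar>\<^sup>2 / (5(\<pi> - 1) n\<^sup>4)\<close> up to lower order terms, with a nearly constant eigenfunction.
  A crude bound on oscillations by the energy controls high frequencies. By Parseval the law of the
  piece is close to a truncated theta function, which Poisson summation identifies with
  the density of Brownian motion on the torus.
\<close>

section \<open>Characters of the discrete torus\<close>

text \<open>The torus dipole with poles at two opposite neighbours of the hole is odd in one
  coordinate, hence zero at the hole. Deleting the hole therefore removes only two edges with known
  current: if \<open>h\<close> is the value at the positive pole, \<open>h\<close> of the unit
  current ran through the hole and \<open>1 - h\<close> still flows in the holed network, at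
  potential difference \<open>2 h\<close>. As \<open>h\<close> tends to \<open>1 - 2 / pi\<close>,
  this gives \<open>pi - 2\<close>; the edge across the hole adds one unit in series, whence
  \<open>pi - 1\<close>. The oscillation bound loses a factor n. This is affordable because
  functions of mean square 1 near the minimum have energy of order \<open>n^-2\<close> only, hence
  vary by order \<open>n^(-1/2)\<close>. The obstacle at high frequencies is that piece and hole
  start at given squares: passing from an \<open>l^2\<close> bound to the value at one square costs
  a factor n, while Parseval sums about \<open>n^2\<close> frequencies. All phases have modulus 1,
  so the walk is dominated by the one without phases; that one mixes in fewer steps than the
  available order \<open>n^4\<close>, which recovers the lost factor.\<close>

definition root1 :: "nat \<Rightarrow> int \<Rightarrow> complex" where
  "root1 n x = cis (2 * pi * of_int x / real n)"

lemma root1_0 [simp]: "root1 n 0 = 1"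
  by (simp add: root1_def)

lemma root1_add: "root1 n (x + y) = root1 n x * root1 n y"
  by (simp add: root1_def cis_mult distrib_left add_divide_distrib)

lemma cnj_root1: "cnj (root1 n x) = root1 n (- x)"
  by (simp add: root1_def cis_cnj)

lemma norm_root1 [simp]: "norm (root1 n x) = 1"
  by (simp add: root1_def)

lemma root1_power: "root1 n x ^ j = root1 n (int j * x)"
  by (induction j) (simp_all add: distrib_right root1_add)

lemma root1_eq_1_iff:
  assumes "n > 0"
  shows "root1 n x = 1 \<longleftrightarrow> int n dvd x"
proof
  assume "root1 n x = 1"
  then have "cos (2 * pi * of_int x / real n) = 1"
    unfolding root1_def by (metis cis.sel(1) one_complex.sel(1))
  then obtain m :: int where "2 * pi * of_int x / real n = of_int m * 2 * pi"
    by (auto simp: cos_one_2pi_int)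
  then have "real_of_int x = of_int m * real n"
    using assms by (simp add: field_simps)
  then have "x = m * int n"
    by (metis of_int_eq_iff of_int_mult of_int_of_nat_eq)
  then show "int n dvd x" by simp
next
  assume "int n dvd x"
  then obtain m where x: "x = int n * m" by blast
  have "2 * pi * of_int x / real n = 2 * pi * of_int m"
    using assms by (simp add: x)
  then show "root1 n x = 1"
    unfolding root1_def by (metis cis_multiple_2pi Ints_of_int)
qed

lemma root1_cong:
  assumes "n > 0" "x mod int n = y mod int n"
  shows "root1 n x = root1 n y"
proof -
  have "int n dvd (x - y)" using assms(2) by (simp add: mod_eq_dvd_iff)
  then have "root1 n (x - y) = 1" using root1_eq_1_iff[OF assms(1)] by simp
  moreover have "root1 n x = root1 n (x - y) * root1 n y"
    by (simp flip: root1_add)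
  ultimately show ?thesis by simp
qed

text \<open>The window of frequencies starts at an arbitrary \<open>a\<close> because it is later
  centred at 0, where the size of a frequency governs its decay.\<close>

lemma sum_root1:
  assumes "n > 0"
  shows "(\<Sum>k\<in>{a..<a + int n}. root1 n (k * x)) = (if int n dvd x then of_nat n else 0)"
proof -
  have "(\<Sum>k\<in>{a..<a + int n}. root1 n (k * x)) = (\<Sum>j<n. root1 n ((a + int j) * x))"
    by (rule sum.reindex_bij_witness[where j = "\<lambda>k. nat (k - a)" and i = "\<lambda>j. a + int j"]) auto
  also have "\<dots> = root1 n (a * x) * (\<Sum>j<n. root1 n x ^ j)"
    by (simp add: distrib_right root1_add root1_power sum_distrib_left)
  also have "\<dots> = (if int n dvd x then of_nat n else 0)"
  proof (cases "int n dvd x")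
    case True
    then have "root1 n (a * x) = 1" "root1 n x = 1"
      using root1_eq_1_iff[OF assms] by auto
    then show ?thesis using True by simp
  next
    case False
    then have "root1 n x \<noteq> 1" using root1_eq_1_iff[OF assms] by auto
    moreover have "root1 n x ^ n = 1"
      using root1_eq_1_iff[OF assms] by (simp add: root1_power)
    ultimately have "(\<Sum>j<n. root1 n x ^ j) = 0"
      by (simp add: geometric_sum)
    then show ?thesis using False by simp
  qed
  finally show ?thesis .
qed

definition chr :: "nat \<Rightarrow> int \<times> int \<Rightarrow> square \<Rightarrow> complex" where
  "chr n k x = root1 n (fst k * fst x + snd k * snd x)"

lemma norm_chr [simp]: "norm (chr n k x) = 1"
  by (simp add: chr_def)

lemma finite_board [simp]: "finite (board n)"
  by (simp add: board_def)

lemma card_board [simp]: "card (board n) = n ^ 2"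
  by (simp add: board_def card_cartesian_product power2_eq_square)

lemma sum_chr:
  assumes "n > 0"
  shows "(\<Sum>k\<in>{a..<a + int n} \<times> {b..<b + int n}. chr n k x)
           = (if int n dvd fst x \<and> int n dvd snd x then of_nat n ^ 2 else 0)"
proof -
  have "(\<Sum>k\<in>{a..<a + int n} \<times> {b..<b + int n}. chr n k x)
      = (\<Sum>k\<in>{a..<a + int n}. root1 n (k * fst x)) * (\<Sum>k\<in>{b..<b + int n}. root1 n (k * snd x))"
    by (simp add: chr_def root1_add sum_product sum.cartesian_product case_prod_beta)
  then show ?thesis using assms by (simp add: sum_root1 power2_eq_square)
qed

lemma parseval:
  fixes f :: "square \<Rightarrow> complex"
  assumes "n > 0"
  shows "(\<Sum>k\<in>{a..<a + int n} \<times> {a..<a + int n}. (norm (\<Sum>x\<in>board n. f x * chr n k x))\<^sup>2)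
           = real n ^ 2 * (\<Sum>x\<in>board n. (norm (f x))\<^sup>2)"
proof -
  let ?F = "{a..<a + int n} \<times> {a..<a + int n}"
  have cc: "chr n k x * cnj (chr n k y) = chr n k (x - y)" for k x y
    by (simp add: chr_def cnj_root1 flip: root1_add) (simp add: algebra_simps)
  have orth: "(\<Sum>k\<in>?F. chr n k (x - y)) = (if x = y then of_nat n ^ 2 else 0)"
    if "x \<in> board n" "y \<in> board n" for x y
  proof -
    have "int n dvd fst x - fst y \<and> int n dvd snd x - snd y \<longleftrightarrow> x = y"
      using that unfolding board_def
      by (auto simp flip: mod_eq_dvd_iff)
    then show ?thesis using sum_chr[OF assms, where a = a and b = a and x = "x - y"] by simp
  qed
  have "complex_of_real (\<Sum>k\<in>?F. (norm (\<Sum>x\<in>board n. f x * chr n k x))\<^sup>2)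
     = (\<Sum>k\<in>?F. \<Sum>x\<in>board n. \<Sum>y\<in>board n. f x * cnj (f y) * chr n k (x - y))"
    by (simp add: complex_norm_square sum_product cc[symmetric] mult_ac del: of_real_power)
  also have "\<dots> = (\<Sum>x\<in>board n. \<Sum>y\<in>board n. \<Sum>k\<in>?F. f x * cnj (f y) * chr n k (x - y))"
    by (subst sum.swap, rule sum.cong[OF refl], subst sum.swap, rule refl)
  also have "\<dots> = (\<Sum>x\<in>board n. \<Sum>y\<in>board n. f x * cnj (f y) * (if x = y then of_nat n ^ 2 else 0))"
    by (intro sum.cong refl) (simp add: orth flip: sum_distrib_left)
  also have "\<dots> = (\<Sum>x\<in>board n. f x * cnj (f x) * of_nat n ^ 2)"
    by (intro sum.cong refl) (simp add: if_distrib[of "\<lambda>z. _ * z"] sum.delta cong: if_cong)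
  also have "\<dots> = complex_of_real (real n ^ 2 * (\<Sum>x\<in>board n. (norm (f x))\<^sup>2))"
    by (simp add: complex_norm_square sum_distrib_left mult_ac del: of_real_power)
       (simp add: mult_ac)
  finally show ?thesis by (simp only: of_real_eq_iff)
qed

section \<open>A dipole potential on the torus\<close>

text \<open>The primitive stands in for the integral: by the mean value theorem each summand differs
  from an increment of \<open>\<Phi>\<close> by at most \<open>e / 2\<close> times the mesh, by
  uniform continuity of \<open>F\<close>, and the increments telescope.\<close>

lemma riemann_sum_tendsto:
  fixes F \<Phi> :: "real \<Rightarrow> real"
  assumes deriv: "\<And>x. x \<in> {0..1} \<Longrightarrow> (\<Phi> has_real_derivative F x) (at x)"
    and cont: "continuous_on {0..1} F"
  shows "(\<lambda>n. (\<Sum>k<n. F (real k / real n)) / real n) \<longlonglongrightarrow> \<Phi> 1 - \<Phi> 0"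
proof (rule LIMSEQ_I)
  fix e :: real assume e: "e > 0"
  have "uniformly_continuous_on {0..1} F"
    using cont by (intro compact_uniformly_continuous) auto
  then obtain d where d: "d > 0"
    "\<And>x y. x \<in> {0..1} \<Longrightarrow> y \<in> {0..1} \<Longrightarrow> dist y x < d \<Longrightarrow> dist (F y) (F x) < e / 2"
    using e unfolding uniformly_continuous_on_def by (metis half_gt_zero)
  obtain N :: nat where N: "inverse (real (Suc N)) < d"
    using reals_Archimedean[OF d(1)] by blast
  show "\<exists>no. \<forall>n\<ge>no. norm ((\<Sum>k<n. F (real k / real n)) / real n - (\<Phi> 1 - \<Phi> 0)) < e"
  proof (intro exI allI impI)
    fix n assume n: "n \<ge> Suc N"
    then have n0: "real n > 0" by simp
    have "1 / real n \<le> inverse (real (Suc N))"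
      using n by (simp add: divide_simps)
    then have nd: "1 / real n < d" using N by linarith
    have step: "\<bar>F (real k / real n) / real n - (\<Phi> (real (Suc k) / real n) - \<Phi> (real k / real n))\<bar> \<le> e / 2 / real n"
      if k: "k < n" for k
    proof -
      have lt: "real k / real n < real (Suc k) / real n" using n0 by (simp add: divide_simps)
      have le1: "real (Suc k) / real n \<le> 1" using k n0 by (simp add: divide_simps)
      have dr: "(\<Phi> has_real_derivative F x) (at x)" if "real k / real n \<le> x" "x \<le> real (Suc k) / real n" for x
        using that le1 by (intro deriv) (auto intro: order_trans[of 0 "real k / real n"])
      obtain z where z: "z > real k / real n" "z < real (Suc k) / real n"
        "\<Phi> (real (Suc k) / real n) - \<Phi> (real k / real n) = (real (Suc k) / real n - real k / real n) * F z"
        using MVT2[OF lt dr] by blast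
      have diff: "real (Suc k) / real n - real k / real n = 1 / real n"
        using n0 by (simp add: field_simps)
      have z01: "z \<in> {0..1}" using z le1 by (auto intro: order_trans[of 0 "real k / real n"])
      have k01: "real k / real n \<in> {0..1}" using k n0 by (simp add: divide_simps)
      have "dist (real k / real n) z < d" using z diff nd by (simp add: dist_real_def)
      then have "\<bar>F (real k / real n) - F z\<bar> < e / 2" using d(2)[OF z01 k01] by (simp add: dist_real_def)
      moreover have "F (real k / real n) / real n - (\<Phi> (real (Suc k) / real n) - \<Phi> (real k / real n))
          = (F (real k / real n) - F z) / real n"
        unfolding z(3) diff by (simp add: diff_divide_distrib)
      ultimately show ?thesis using n0 by (simp add: divide_simps abs_divide)
    qed
    have "(\<Sum>k<n. \<Phi> (real (Suc k) / real n) - \<Phi> (real k / real n)) = \<Phi> 1 - \<Phi> 0"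
      using n0 by (subst sum_lessThan_telescope[of "\<lambda>k. \<Phi> (real k / real n)"]) simp
    then have "\<bar>(\<Sum>k<n. F (real k / real n)) / real n - (\<Phi> 1 - \<Phi> 0)\<bar>
        = \<bar>\<Sum>k<n. F (real k / real n) / real n - (\<Phi> (real (Suc k) / real n) - \<Phi> (real k / real n))\<bar>"
      by (simp add: sum_divide_distrib sum_subtractf)
    also have "\<dots> \<le> (\<Sum>k<n. e / 2 / real n)"
      by (rule order_trans[OF sum_abs sum_mono]) (use step in auto)
    also have "\<dots> < e" using n0 e by simp
    finally show "norm ((\<Sum>k<n. F (real k / real n)) / real n - (\<Phi> 1 - \<Phi> 0)) < e" by simp
  qed
qed

text \<open>The rate \<open>\<tau>\<close> at which a harmonic function
  \<open>sin (2 pi k x / n) * exp (\<tau> y)\<close> grows in the second coordinate: harmonicity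
  means \<open>2 cosh \<tau> = 4 - 2 cos (2 pi k / n)\<close>.\<close>

definition dispersion :: "nat \<Rightarrow> nat \<Rightarrow> real" where
  "dispersion n k = arcosh (2 - cos (2 * pi * real k / real n))"

lemma cosh_dispersion: "cosh (dispersion n k) = 2 - cos (2 * pi * real k / real n)"
proof -
  have "2 - cos (2 * pi * real k / real n) \<ge> 1"
    using cos_le_one[of "2 * pi * real k / real n"] by linarith
  then show ?thesis unfolding dispersion_def by (rule cosh_arcosh_real)
qed

lemma sin_half_angle_pos:
  assumes "0 < k" "k < n"
  shows "sin (pi * (real k / real n)) > 0"
proof (rule sin_gt_zero)
  have "real k / real n < 1" using assms by simp
  then show "pi * (real k / real n) < pi" by (metis mult.right_neutral mult_strict_left_mono pi_gt_zero)
  show "0 < pi * (real k / real n)" using assms by simp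
qed

lemma cosh_dispersion_half:
  "cosh (dispersion n k) = 1 + 2 * (sin (pi * (real k / real n)))\<^sup>2"
proof -
  have "2 * pi * real k / real n = 2 * (pi * (real k / real n))" by simp
  then show ?thesis by (simp only: cosh_dispersion cos_double_sin)
qed

lemma dispersion_pos:
  assumes "0 < k" "k < n"
  shows "dispersion n k > 0"
proof -
  let ?c = "2 - cos (2 * pi * real k / real n)"
  have "?c = 1 + 2 * (sin (pi * (real k / real n)))\<^sup>2"
    using cosh_dispersion cosh_dispersion_half by metis
  then have "?c > 1" using sin_half_angle_pos[OF assms] by simp
  then show ?thesis unfolding dispersion_def by simp
qed

lemma sinh_dispersion:
  assumes "0 < k" "k < n"
  shows "sinh (dispersion n k) = 2 * sin (pi * (real k / real n)) * sqrt (2 - (cos (pi * (real k / real n)))\<^sup>2)"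
proof -
  let ?u = "pi * (real k / real n)"
  have s: "sin ?u > 0" by (rule sin_half_angle_pos[OF assms])
  have c: "2 - (cos ?u)\<^sup>2 = 1 + (sin ?u)\<^sup>2" by (simp add: cos_squared_eq)
  have "(sinh (dispersion n k))\<^sup>2 = (cosh (dispersion n k))\<^sup>2 - 1"
    by (simp add: cosh_square_eq)
  also have "\<dots> = (2 * sin ?u * sqrt (2 - (cos ?u)\<^sup>2))\<^sup>2"
    unfolding c by (simp add: cosh_dispersion_half power_mult_distrib) (simp add: algebra_simps power2_eq_square)
  finally have "(sinh (dispersion n k))\<^sup>2 = (2 * sin ?u * sqrt (2 - (cos ?u)\<^sup>2))\<^sup>2" .
  moreover have "sinh (dispersion n k) \<ge> 0" using dispersion_pos[OF assms] by simp
  moreover have "2 * sin ?u * sqrt (2 - (cos ?u)\<^sup>2) \<ge> 0" using s unfolding c by (intro mult_nonneg_nonneg) auto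
  ultimately show ?thesis by (rule power2_eq_imp_eq)
qed

text \<open>Fundamental solution of \<open>2 cosh \<tau> u(j) - u(j + 1) - u(j - 1)\<close> on a
  cycle of length n. The argument is real so that the recurrence holds without wrap-around; the
  symmetry about \<open>n / 2\<close> then settles the two ends of the cycle.\<close>

definition green1 :: "nat \<Rightarrow> real \<Rightarrow> real \<Rightarrow> real" where
  "green1 n \<tau> j = cosh ((real n / 2 - j) * \<tau>) / (2 * sinh \<tau> * sinh (real n * \<tau> / 2))"

lemma green1_reflect: "green1 n \<tau> (real n - j) = green1 n \<tau> j"
proof -
  have "(real n / 2 - (real n - j)) * \<tau> = - ((real n / 2 - j) * \<tau>)"
    by (simp add: algebra_simps)
  then show ?thesis unfolding green1_def by (simp only: cosh_minus)
qed

lemma green1_step: "green1 n \<tau> (j + 1) + green1 n \<tau> (j - 1) = 2 * cosh \<tau> * green1 n \<tau> j"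
proof -
  have e: "(real n / 2 - (j + 1)) * \<tau> = (real n / 2 - j) * \<tau> - \<tau>"
    "(real n / 2 - (j - 1)) * \<tau> = (real n / 2 - j) * \<tau> + \<tau>"
    by (simp_all add: algebra_simps)
  show ?thesis
    unfolding green1_def e cosh_add cosh_diff by (simp add: add_divide_distrib[symmetric])
qed

lemma green1_source:
  assumes "\<tau> > 0" "n > 0"
  shows "2 * cosh \<tau> * green1 n \<tau> 0 - 2 * green1 n \<tau> 1 = 1"
proof -
  have e: "(real n / 2 - 1) * \<tau> = real n * \<tau> / 2 - \<tau>" "(real n / 2 - 0) * \<tau> = real n * \<tau> / 2"
    by (simp_all add: algebra_simps)
  have "sinh \<tau> > 0" "sinh (real n * \<tau> / 2) > 0"
    using assms by (simp_all add: zero_less_mult_iff)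
  then show ?thesis
    using assms unfolding green1_def e cosh_diff by (simp add: divide_simps algebra_simps)
qed

lemma green1_equation:
  fixes j :: int
  assumes "\<tau> > 0" "n \<ge> 2" "0 \<le> j" "j < int n"
  shows "2 * cosh \<tau> * green1 n \<tau> j - green1 n \<tau> ((j + 1) mod int n) - green1 n \<tau> ((j - 1) mod int n)
           = (if j = 0 then 1 else 0)"
proof -
  have up: "green1 n \<tau> ((j + 1) mod int n) = green1 n \<tau> (of_int j + 1)"
  proof (cases "j = int n - 1")
    case True
    then show ?thesis using green1_reflect[of n \<tau> 0] assms by simp
  next
    case False
    then show ?thesis using assms by simp
  qed
  show ?thesis
  proof (cases "j = 0")
    case True
    have "(j - 1) mod int n = int n - 1"
      using True assms by (simp add: zmod_minus1)
    then have "green1 n \<tau> ((j - 1) mod int n) = green1 n \<tau> 1"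
      using green1_reflect[of n \<tau> 1] by simp
    then show ?thesis using True up green1_source[of \<tau> n] assms by simp
  next
    case False
    then have "green1 n \<tau> ((j - 1) mod int n) = green1 n \<tau> (of_int j - 1)"
      using assms by simp
    then show ?thesis using False up green1_step[of n \<tau> "of_int j"] by simp
  qed
qed

text \<open>A Fourier series in the first coordinate, with the periodic Green function of a one-dimensional
  difference operator in the second. The mode \<open>k = 0\<close> is absent because its sine factor vanishes.\<close>

definition dipole :: "nat \<Rightarrow> square \<Rightarrow> real" where
  "dipole n x = (\<Sum>k\<in>{1..<n}. 2 * sin (2 * pi * real k / real n) * sin (2 * pi * real k / real n * fst x)
       * green1 n (dispersion n k) (snd x)) / real n"

lemma sin_periodic_mod:
  assumes "n > 0"
  shows "sin (2 * pi * real k / real n * of_int (x mod int n)) = sin (2 * pi * real k / real n * of_int x)"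
proof -
  have "root1 n (int k * (x mod int n)) = root1 n (int k * x)"
    by (rule root1_cong[OF assms]) (simp add: mod_mult_right_eq)
  then have "Im (root1 n (int k * (x mod int n))) = Im (root1 n (int k * x))" by simp
  then show ?thesis by (simp add: root1_def mult_ac)
qed

lemma dipole_mod:
  assumes "n > 0"
  shows "dipole n (x mod int n, y) = dipole n (x, y)"
  unfolding dipole_def by (simp only: fst_conv snd_conv sin_periodic_mod[OF assms])

lemma sum_cos:
  assumes "n > 0"
  shows "(\<Sum>k<n. cos (2 * pi * real k / real n * of_int x)) = (if int n dvd x then real n else 0)"
proof -
  have e: "(\<Sum>k\<in>{0..<0 + int n}. root1 n (k * x)) = (\<Sum>k<n. root1 n (int k * x))"
    by (rule sum.reindex_bij_witness[where j = nat and i = int]) auto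
  then have "Re (\<Sum>k<n. root1 n (int k * x)) = (if int n dvd x then real n else 0)"
    unfolding e[symmetric] sum_root1[OF assms] by simp
  then show ?thesis by (simp add: root1_def mult_ac)
qed

text \<open>In each mode the Green function leaves
  \<open>2 sin a sin (a x) = cos (a (x - 1)) - cos (a (x + 1))\<close>, which are the Fourier terms
  of a positive unit mass at 1 and a negative one at -1.\<close>

lemma dipole_laplacian:
  assumes "n \<ge> 2" "0 \<le> y" "y < int n"
  shows "4 * dipole n (x, y) - dipole n ((x + 1) mod int n, y) - dipole n ((x - 1) mod int n, y)
      - dipole n (x, (y + 1) mod int n) - dipole n (x, (y - 1) mod int n)
    = (if y = 0 then of_bool (int n dvd x - 1) - of_bool (int n dvd x + 1) else 0)"
proof -
  let ?a = "\<lambda>k. 2 * pi * real k / real n"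
  let ?g = "\<lambda>k. green1 n (dispersion n k)"
  have n0: "n > 0" using assms by simp
  have summand: "4 * (2 * sin (?a k) * sin (?a k * x) * ?g k y)
      - 2 * sin (?a k) * sin (?a k * of_int (x + 1)) * ?g k y
      - 2 * sin (?a k) * sin (?a k * of_int (x - 1)) * ?g k y
      - 2 * sin (?a k) * sin (?a k * x) * ?g k ((y + 1) mod int n)
      - 2 * sin (?a k) * sin (?a k * x) * ?g k ((y - 1) mod int n)
      = (if y = 0 then cos (?a k * of_int (x - 1)) - cos (?a k * of_int (x + 1)) else 0)"
    (is "?lhs = ?rhs") if k: "k \<in> {1..<n}" for k
  proof -
    have e: "?a k * of_int (x + 1) = ?a k * x + ?a k" "?a k * of_int (x - 1) = ?a k * x - ?a k"
      by (simp_all only: of_int_add of_int_diff of_int_1 distrib_left right_diff_distrib mult_1_right)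
    have s: "sin (?a k * of_int (x + 1)) + sin (?a k * of_int (x - 1)) = 2 * cos (?a k) * sin (?a k * x)"
      unfolding e sin_add sin_diff by simp
    have c: "cos (?a k * of_int (x - 1)) - cos (?a k * of_int (x + 1)) = 2 * sin (?a k) * sin (?a k * x)"
      unfolding e cos_add cos_diff by simp
    have g: "(4 - 2 * cos (?a k)) * ?g k y - ?g k ((y + 1) mod int n) - ?g k ((y - 1) mod int n)
        = (if y = 0 then 1 else 0)"
      using green1_equation[of "dispersion n k" n y] dispersion_pos[of k n] k assms
      by (simp add: cosh_dispersion)
    have "?lhs = 2 * sin (?a k) * (4 * sin (?a k * x) * ?g k y
        - (sin (?a k * of_int (x + 1)) + sin (?a k * of_int (x - 1))) * ?g k y
        - sin (?a k * x) * ?g k ((y + 1) mod int n) - sin (?a k * x) * ?g k ((y - 1) mod int n))"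
      by (simp only: algebra_simps)
    also have "\<dots> = 2 * sin (?a k) * sin (?a k * x)
        * ((4 - 2 * cos (?a k)) * ?g k y - ?g k ((y + 1) mod int n) - ?g k ((y - 1) mod int n))"
      unfolding s by (simp only: algebra_simps)
    also have "\<dots> = ?rhs" unfolding g c by simp
    finally show ?thesis .
  qed
  have "4 * dipole n (x, y) - dipole n (x + 1, y) - dipole n (x - 1, y)
      - dipole n (x, (y + 1) mod int n) - dipole n (x, (y - 1) mod int n)
    = (\<Sum>k\<in>{1..<n}. if y = 0 then cos (?a k * of_int (x - 1)) - cos (?a k * of_int (x + 1)) else 0) / real n"
    by (subst sum.cong[OF refl summand[symmetric]], assumption)
       (simp add: dipole_def sum_subtractf sum_distrib_left diff_divide_distrib)
  \<comment> \<open>The mode 0 contributes \<open>1 - 1\<close>; including it completes the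
    orthogonality sum.\<close>
  also have "\<dots> = (\<Sum>k<n. if y = 0 then cos (?a k * of_int (x - 1)) - cos (?a k * of_int (x + 1)) else 0) / real n"
  proof -
    have "{..<n} = insert 0 {1..<n}" using n0 by auto
    then show ?thesis by simp
  qed
  also have "\<dots> = (if y = 0 then of_bool (int n dvd x - 1) - of_bool (int n dvd x + 1) else 0)"
    using sum_cos[OF n0, of "x - 1"] sum_cos[OF n0, of "x + 1"] n0
    by (auto simp: sum_subtractf diff_divide_distrib)
  finally show ?thesis by (simp add: dipole_mod[OF n0])
qed

section \<open>Limit of the dipole at its pole\<close>

definition dipole_height :: "nat \<Rightarrow> real" where
  "dipole_height n = dipole n (1, 0)"

lemma sinh_le_cosh_times:
  fixes x :: real assumes "x \<ge> 0"
  shows "sinh x \<le> cosh x * x"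
proof (cases "x = 0")
  case False
  then have x: "0 < x" using assms by simp
  have d: "(sinh has_real_derivative cosh t) (at t)" for t :: real
    by (auto intro!: derivative_eq_intros)
  obtain z where z: "0 < z" "z < x" "sinh x - sinh 0 = (x - 0) * cosh z"
    using MVT2[OF x d] by blast
  have "cosh z \<le> cosh x" using z by (simp add: cosh_real_nonneg_le_iff)
  then show ?thesis using z x by (simp add: mult.commute)
qed auto

lemma le_sinh:
  fixes x :: real assumes "x \<ge> 0"
  shows "x \<le> sinh x"
proof (cases "x = 0")
  case False
  then have x: "0 < x" using assms by simp
  have d: "(sinh has_real_derivative cosh t) (at t)" for t :: real
    by (auto intro!: derivative_eq_intros)
  obtain z where z: "0 < z" "z < x" "sinh x - sinh 0 = (x - 0) * cosh z"
    using MVT2[OF x d] by blast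
  have "1 \<le> cosh z" by (rule cosh_real_ge_1)
  then show ?thesis using z x by (simp add: mult_le_cancel_left1)
qed auto

text \<open>With \<open>u = pi x\<close> this is \<open>2 sin (2 u)^2 / (2 sinh \<tau>)\<close>, the
  summand of \<open>dipole_height\<close> once the factor \<open>coth (n \<tau> / 2)\<close> is
  replaced by its limit 1.\<close>

definition dipole_density :: "real \<Rightarrow> real" where
  "dipole_density x = 2 * (cos (pi * x))\<^sup>2 * sin (pi * x) / sqrt (2 - (cos (pi * x))\<^sup>2)"

lemma cos_squared_le_1: "(cos (x::real))\<^sup>2 \<le> 1"
  by (simp add: abs_square_le_1)

text \<open>The error factor is \<open>coth y - 1 = exp (- y) / sinh y\<close>, at most
  \<open>1 / y\<close> with \<open>y = n \<tau> / 2\<close>. It is large for small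
  \<open>\<tau>\<close>, but the density is at most \<open>3 \<tau>\<close>, so the product is at
  most \<open>6 / n\<close> uniformly in the mode.\<close>

lemma dipole_height_term:
  assumes "k \<in> {1..<n}"
  shows "2 * sin (2 * pi * real k / real n) * sin (2 * pi * real k / real n * of_int 1)
           * green1 n (dispersion n k) (of_int 0) - dipole_density (real k / real n) \<in> {0..6 / real n}"
proof -
  let ?u = "pi * (real k / real n)" and ?t = "dispersion n k"
  let ?y = "real n * ?t / 2"
  have kn: "0 < k" "k < n" using assms by auto
  have s: "sin ?u > 0" and t: "?t > 0" using sin_half_angle_pos dispersion_pos kn by auto
  have y: "?y > 0" using kn t by simp
  have shy: "sinh ?y > 0" using y by simp
  define q where "q = sqrt (2 - (cos ?u)\<^sup>2)"
  have q1: "q \<ge> 1" unfolding q_def using cos_squared_le_1[of ?u] by simp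
  have sh: "sinh ?t = 2 * sin ?u * q" unfolding q_def by (rule sinh_dispersion[OF kn])
  have a: "2 * pi * real k / real n = 2 * ?u" by simp
  have F: "dipole_density (real k / real n) = 2 * (cos ?u)\<^sup>2 * sin ?u / q"
    by (simp add: dipole_density_def q_def)
  have "2 * sin (2 * ?u) * sin (2 * ?u) * green1 n ?t 0 = (2 * (cos ?u)\<^sup>2 * sin ?u / q) * (cosh ?y / sinh ?y)"
    unfolding green1_def sin_double sh using s q1 shy by (simp add: divide_simps power2_eq_square)
  also have "cosh ?y / sinh ?y = 1 + exp (- ?y) / sinh ?y"
  proof -
    have "cosh ?y = sinh ?y + exp (- ?y)" by (simp add: cosh_field_def sinh_field_def field_simps)
    moreover have "sinh ?y \<noteq> 0" using shy by (metis less_irrefl)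
    ultimately show ?thesis by (simp only: add_divide_distrib divide_self_if if_False)
  qed
  finally have diff: "2 * sin (2 * ?u) * sin (2 * ?u) * green1 n ?t 0 - dipole_density (real k / real n)
      = (2 * (cos ?u)\<^sup>2 * sin ?u / q) * (exp (- ?y) / sinh ?y)"
    unfolding F by (simp add: distrib_left)
  have b1: "exp (- ?y) / sinh ?y \<le> 1 / ?y"
    using y shy le_sinh[of ?y] by (intro frac_le) auto
  have b2: "2 * (cos ?u)\<^sup>2 * sin ?u / q \<le> 3 * ?t"
  proof -
    have "2 * (cos ?u)\<^sup>2 * sin ?u / q \<le> 2 * (cos ?u)\<^sup>2 * sin ?u"
      using q1 s divide_left_mono[of 1 q "2 * (cos ?u)\<^sup>2 * sin ?u"] by simp
    also have "\<dots> \<le> 2 * sin ?u" using s cos_squared_le_1[of ?u] by simp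
    also have "\<dots> \<le> sinh ?t" unfolding sh using q1 s by simp
    also have "\<dots> \<le> cosh ?t * ?t" using t by (intro sinh_le_cosh_times) simp
    also have "\<dots> \<le> 3 * ?t" using t cos_ge_minus_one[of "2 * pi * real k / real n"]
      by (intro mult_right_mono) (simp_all add: cosh_dispersion)
    finally show ?thesis .
  qed
  have "(2 * (cos ?u)\<^sup>2 * sin ?u / q) * (exp (- ?y) / sinh ?y) \<le> 3 * ?t * (1 / ?y)"
    using b1 b2 s q1 shy t by (intro mult_mono) auto
  also have "\<dots> = 6 / real n" using t kn by simp
  finally have ub: "(2 * (cos ?u)\<^sup>2 * sin ?u / q) * (exp (- ?y) / sinh ?y) \<le> 6 / real n" .
  have "0 \<le> (2 * (cos ?u)\<^sup>2 * sin ?u / q) * (exp (- ?y) / sinh ?y)" using s q1 shy by simp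
  then show ?thesis using ub unfolding a diff[symmetric] by simp
qed

lemma dipole_density_riemann:
  "(\<lambda>n. (\<Sum>k<n. dipole_density (real k / real n)) / real n) \<longlonglongrightarrow> 1 - 2 / pi"
proof -
  \<comment> \<open>Substituting \<open>w = cos (pi x)\<close> turns the integrand into
    \<open>- (2 / pi) * w^2 / sqrt (2 - w^2) dw\<close>, which has an elementary primitive.\<close>
  define \<Phi> where "\<Phi> x = - 2 / pi * (arcsin (cos (pi * x) / sqrt 2) - cos (pi * x) / 2 * sqrt (2 - (cos (pi * x))\<^sup>2))" for x
  have pos: "2 - (cos (pi * x))\<^sup>2 > 0" for x using cos_squared_le_1[of "pi * x"] by linarith
  have d: "(\<Phi> has_real_derivative dipole_density x) (at x)" for x
  proof -
    let ?w = "cos (pi * x)"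
    define q where "q = sqrt (2 - ?w\<^sup>2)"
    have q: "q > 0" "q\<^sup>2 = 2 - ?w\<^sup>2" using pos[of x] by (simp_all add: q_def)
    have w1: "?w \<le> 1" "- 1 \<le> ?w" by simp_all
    have "1 < sqrt 2" by simp
    then have "?w < sqrt 2" "- sqrt 2 < ?w" using w1 by linarith+
    then have b: "- 1 < ?w / sqrt 2" "?w / sqrt 2 < 1"
      by (simp_all add: divide_simps)
    have q2: "sqrt (1 - (?w / sqrt 2)\<^sup>2) = q / sqrt 2"
      unfolding q_def by (simp add: power_divide real_sqrt_divide[symmetric] diff_divide_distrib)
    have "(\<Phi> has_real_derivative - 2 / pi * (inverse (sqrt (1 - (?w / sqrt 2)\<^sup>2)) * (- (sin (pi * x) * pi) / sqrt 2)
        - (- (sin (pi * x) * pi) / 2 * q + (- (2 * ?w * - (sin (pi * x) * pi))) * (inverse q / 2) * (?w / 2)))) (at x)"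
      unfolding \<Phi>_def q_def using b pos[of x]
      by (auto intro!: derivative_eq_intros simp: power2_eq_square) (simp add: field_simps)
    also have "- 2 / pi * (inverse (sqrt (1 - (?w / sqrt 2)\<^sup>2)) * (- (sin (pi * x) * pi) / sqrt 2)
        - (- (sin (pi * x) * pi) / 2 * q + (- (2 * ?w * - (sin (pi * x) * pi))) * (inverse q / 2) * (?w / 2)))
      = sin (pi * x) * (2 - q\<^sup>2 + ?w\<^sup>2) / q"
      unfolding q2 using q(1) by (simp add: divide_simps) (simp add: algebra_simps power2_eq_square)
    also have "\<dots> = dipole_density x"
      unfolding dipole_density_def q_def using pos[of x] by (simp add: real_sqrt_pow2[OF less_imp_le])
    finally show ?thesis .
  qed
  have c: "continuous_on {0..1} dipole_density"
    unfolding dipole_density_def using pos by (intro continuous_intros) (metis less_irrefl real_sqrt_eq_zero_cancel_iff)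
  have "arcsin (1 / sqrt 2) = pi / 4"
  proof -
    have "1 / sqrt 2 = sin (pi / 4)" by (simp add: sin_45 real_div_sqrt divide_simps)
    then show ?thesis by (simp add: arcsin_sin)
  qed
  moreover have "arcsin (- (1 / sqrt 2)) = - (pi / 4)"
  proof -
    have "- (1 / sqrt 2) = sin (- (pi / 4))" by (simp add: sin_45 real_div_sqrt divide_simps)
    then show ?thesis using arcsin_sin[of "- (pi / 4)"] pi_gt_zero by (auto simp del: sin_minus pi_gt_zero)
  qed
  ultimately have "\<Phi> 1 - \<Phi> 0 = 1 - 2 / pi"
    unfolding \<Phi>_def by (simp add: divide_simps)
  then show ?thesis using riemann_sum_tendsto[of \<Phi> dipole_density, OF d c] by simp
qed

lemma dipole_height_tendsto: "dipole_height \<longlonglongrightarrow> 1 - 2 / pi"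
proof -
  define R where "R n = (\<Sum>k<n. dipole_density (real k / real n)) / real n" for n
  have bd: "dipole_height n - R n \<in> {0..6 / real n}" if n: "n \<ge> 2" for n
  proof -
    let ?T = "\<lambda>k. 2 * sin (2 * pi * real k / real n) * sin (2 * pi * real k / real n * of_int 1)
           * green1 n (dispersion n k) (of_int 0) - dipole_density (real k / real n)"
    have "{..<n} = insert 0 {1..<n}" using n by auto
    then have R: "R n = (\<Sum>k\<in>{1..<n}. dipole_density (real k / real n)) / real n"
      by (simp add: R_def dipole_density_def)
    have e: "dipole_height n - R n = (\<Sum>k\<in>{1..<n}. ?T k) / real n"
      unfolding R dipole_height_def dipole_def by (simp add: sum_subtractf diff_divide_distrib)
    have "(\<Sum>k\<in>{1..<n}. ?T k) \<ge> 0" using dipole_height_term by (intro sum_nonneg) auto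
    moreover have "(\<Sum>k\<in>{1..<n}. ?T k) \<le> (\<Sum>k\<in>{1..<n}. 6 / real n)"
      using dipole_height_term by (intro sum_mono) auto
    moreover have "(\<Sum>k\<in>{1..<n}. 6 / real n) \<le> 6" using n by (simp add: divide_simps)
    ultimately show ?thesis unfolding e using n by (simp add: divide_right_mono)
  qed
  have "(\<lambda>n. dipole_height n - R n) \<longlonglongrightarrow> 0"
  proof (rule tendsto_sandwich[of "\<lambda>_. 0" _ _ "\<lambda>n. 6 / real n"])
    show "(\<lambda>n. 6 / real n) \<longlonglongrightarrow> 0" by (rule lim_const_over_n)
    show "\<forall>\<^sub>F n in sequentially. 0 \<le> dipole_height n - R n"
      using bd by (intro eventually_sequentiallyI[of 2]) auto
    show "\<forall>\<^sub>F n in sequentially. dipole_height n - R n \<le> 6 / real n"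
      using bd by (intro eventually_sequentiallyI[of 2]) auto
  qed auto
  then have "(\<lambda>n. (dipole_height n - R n) + R n) \<longlonglongrightarrow> 0 + (1 - 2 / pi)"
    by (rule tendsto_add) (use dipole_density_riemann in \<open>simp add: R_def\<close>)
  then show ?thesis by simp
qed

section \<open>The walk of the empty square relative to the tagged piece\<close>

definition holed :: "nat \<Rightarrow> square set" where
  "holed n = board n - {(0, 0)}"

lemma finite_holed [simp]: "finite (holed n)"
  by (simp add: holed_def)

lemma origin_in_board: "n > 0 \<Longrightarrow> (0, 0) \<in> board n"
  by (simp add: board_def)

lemma card_holed: "n > 0 \<Longrightarrow> card (holed n) = n ^ 2 - 1"
  by (simp add: holed_def card_Diff_singleton origin_in_board)

lemma shift_in_board [simp]: "n > 0 \<Longrightarrow> shift n v x \<in> board n"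
  by (simp add: shift_def board_def)

lemma shift_shift: "shift n u (shift n v x) = shift n (u + v) x"
  by (simp add: shift_def mod_simps add_ac)

lemma shift_0 [simp]: "x \<in> board n \<Longrightarrow> shift n 0 x = x"
  by (auto simp: shift_def board_def)

lemma shift_uminus [simp]:
  "x \<in> board n \<Longrightarrow> shift n v (shift n (- v) x) = x"
  "x \<in> board n \<Longrightarrow> shift n (- v) (shift n v x) = x"
  by (simp_all add: shift_shift)

lemma bij_betw_shift: "n > 0 \<Longrightarrow> bij_betw (shift n v) (board n) (board n)"
  by (rule bij_betw_byWitness[where f' = "shift n (- v)"]) auto

lemma sum_shift:
  "n > 0 \<Longrightarrow> (\<Sum>x\<in>board n. f (shift n v x)) = (\<Sum>x\<in>board n. f x)"
  by (rule sum.reindex_bij_betw[OF bij_betw_shift])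

lemma chr_shift:
  assumes "n > 0"
  shows "chr n k (shift n v x) = chr n k v * chr n k x"
proof -
  have "root1 n (fst k * ((fst x + fst v) mod int n) + snd k * ((snd x + snd v) mod int n))
      = root1 n (fst k * (fst x + fst v) + snd k * (snd x + snd v))"
    by (rule root1_cong[OF assms], intro mod_add_cong mod_mult_cong) simp_all
  also have "fst k * (fst x + fst v) + snd k * (snd x + snd v)
      = (fst k * fst v + snd k * snd v) + (fst k * fst x + snd k * snd x)"
    by (simp add: algebra_simps)
  finally show ?thesis by (simp add: chr_def shift_def root1_add)
qed

lemma chr_origin [simp]: "chr n k (0, 0) = 1"
  by (simp add: chr_def)

definition jump :: "nat \<Rightarrow> int \<times> int \<Rightarrow> square \<Rightarrow> square" where
  "jump n v r = (if shift n v r = (0, 0) then shift n v (0, 0) else shift n v r)"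

text \<open>The empty square moves by \<open>v\<close>; \<open>r\<close> is its position relative to the tagged piece.
  If it runs into the piece, the piece moves by \<open>r = - v\<close>, which is recorded by the phase.\<close>

definition hop :: "nat \<Rightarrow> int \<times> int \<Rightarrow> int \<times> int \<Rightarrow> (square \<Rightarrow> complex) \<Rightarrow> square \<Rightarrow> complex" where
  "hop n k v f r = (if shift n v r = (0, 0) then chr n k r else 1) * f (jump n v r)"

definition tagged :: "nat \<Rightarrow> int \<times> int \<Rightarrow> (square \<Rightarrow> complex) \<Rightarrow> square \<Rightarrow> complex" where
  "tagged n k f r = (f r + hop n k (0, 1) f r + hop n k (0, -1) f r
      + hop n k (-1, 0) f r + hop n k (1, 0) f r) / 5"

text \<open>The real inner product of complex functions: polarization and the numerical range
  arguments below use real scalars only.\<close>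

definition ip :: "nat \<Rightarrow> (square \<Rightarrow> complex) \<Rightarrow> (square \<Rightarrow> complex) \<Rightarrow> real" where
  "ip n f g = (\<Sum>r\<in>holed n. f r \<bullet> g r)"

definition nsq :: "nat \<Rightarrow> (square \<Rightarrow> complex) \<Rightarrow> real" where
  "nsq n f = (\<Sum>r\<in>holed n. (norm (f r))\<^sup>2)"

lemma nsq_eq_ip: "nsq n f = ip n f f"
  by (simp add: nsq_def ip_def dot_square_norm)

lemma nsq_nonneg [simp]: "nsq n f \<ge> 0"
  by (simp add: nsq_def sum_nonneg)

lemma ip_commute: "ip n f g = ip n g f"
  by (simp add: ip_def inner_commute)

lemma ip_simps:
  "ip n (\<lambda>r. f r + g r) h = ip n f h + ip n g h"
  "ip n (\<lambda>r. f r - g r) h = ip n f h - ip n g h"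
  "ip n h (\<lambda>r. f r + g r) = ip n h f + ip n h g"
  "ip n h (\<lambda>r. f r - g r) = ip n h f - ip n h g"
  "ip n (\<lambda>r. of_real c * f r) h = c * ip n f h"
  "ip n h (\<lambda>r. of_real c * f r) = c * ip n h f"
  by (simp_all add: ip_def inner_simps sum.distrib sum_subtractf sum_distrib_left
      scaleR_conv_of_real[symmetric])

context
  fixes n :: nat and v :: "int \<times> int"
  assumes n: "n > 0" and v: "shift n v (0, 0) \<noteq> (0, 0)"
begin

lemma shift_neg_nonzero: "shift n (- v) (0, 0) \<noteq> (0, 0)"
  using v shift_uminus(1)[OF origin_in_board[OF n], of v] by metis

lemma jump_in_holed: "r \<in> holed n \<Longrightarrow> jump n v r \<in> holed n"
  using v n by (auto simp: jump_def holed_def)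

lemma shift_eq_origin: "r \<in> board n \<Longrightarrow> shift n v r = (0, 0) \<Longrightarrow> r = shift n (- v) (0, 0)"
  by (metis shift_uminus(2))

lemma jump_jump: "r \<in> holed n \<Longrightarrow> jump n (- v) (jump n v r) = r"
  using shift_eq_origin[of r] shift_uminus(2)[OF origin_in_board[OF n], of v]
  by (auto simp: jump_def holed_def)

end

lemma bij_betw_jump:
  assumes "n > 0" "shift n v (0, 0) \<noteq> (0, 0)"
  shows "bij_betw (jump n v) (holed n) (holed n)"
proof -
  note neg = shift_neg_nonzero[OF assms]
  show ?thesis
    using jump_in_holed[OF assms] jump_in_holed[OF assms(1) neg]
      jump_jump[OF assms] jump_jump[OF assms(1) neg]
    by (intro bij_betw_byWitness[where f' = "jump n (- v)"]) auto
qed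

lemma inner_mult_cnj: "(c * a) \<bullet> b = a \<bullet> (cnj c * (b::complex))"
  by (simp add: inner_complex_def algebra_simps)

text \<open>The jump by \<open>- v\<close> inverts the jump by \<open>v\<close>, and crossing the
  hole backwards carries the conjugate phase: the crossing starts at \<open>- v\<close> one way and
  at \<open>v\<close> the other way.\<close>

lemma hop_adjoint:
  assumes "n > 0" "shift n v (0, 0) \<noteq> (0, 0)"
  shows "ip n (hop n k v f) g = ip n f (hop n k (- v) g)"
proof -
  have "ip n f (hop n k (- v) g) = (\<Sum>r\<in>holed n. f (jump n v r) \<bullet> hop n k (- v) g (jump n v r))"
    unfolding ip_def by (rule sum.reindex_bij_betw[OF bij_betw_jump[OF assms], symmetric])
  also have "\<dots> = (\<Sum>r\<in>holed n. hop n k v f r \<bullet> g r)"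
  proof (rule sum.cong[OF refl])
    fix r assume r: "r \<in> holed n"
    then have rb: "r \<in> board n" by (simp add: holed_def)
    show "f (jump n v r) \<bullet> hop n k (- v) g (jump n v r) = hop n k v f r \<bullet> g r"
    proof (cases "shift n v r = (0, 0)")
      case True
      have "chr n k v * chr n k r = 1"
        using chr_shift[OF assms(1), of k v r] True by simp
      then have "cnj (chr n k r) = chr n k v"
        by (metis complex_norm_square mult.commute mult.left_neutral mult_cancel_right norm_chr
            of_real_1 power_one mult_zero_left zero_neq_one)
      moreover have "chr n k (jump n v r) = chr n k v"
        using True chr_shift[OF assms(1), of k v "(0, 0)"] by (simp add: jump_def)
      moreover have "shift n (- v) (jump n v r) = (0, 0)"
        using True shift_uminus(2)[OF origin_in_board[OF assms(1)]] by (simp add: jump_def)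
      ultimately show ?thesis
        using True jump_jump[OF assms r] by (simp add: hop_def inner_mult_cnj)
    next
      case False
      then have "shift n (- v) (jump n v r) = r"
        using shift_uminus(2)[OF rb] by (simp add: jump_def)
      moreover have "r \<noteq> (0, 0)" using r by (simp add: holed_def)
      ultimately show ?thesis
        using False jump_jump[OF assms r] by (simp add: hop_def)
    qed
  qed
  finally show ?thesis by (simp add: ip_def)
qed

lemma norm_hop: "norm (hop n k v f r) = norm (f (jump n v r))"
  by (simp add: hop_def norm_mult)

lemma nsq_hop:
  assumes "n > 0" "shift n v (0, 0) \<noteq> (0, 0)"
  shows "nsq n (hop n k v f) = nsq n f"
  unfolding nsq_def norm_hop by (rule sum.reindex_bij_betw[OF bij_betw_jump[OF assms]])

lemma nsq_diff: "nsq n (\<lambda>r. f r - g r) = nsq n f + nsq n g - 2 * ip n f g"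
  by (simp add: nsq_eq_ip ip_simps ip_commute[of n g f])

lemma nsq_add: "nsq n (\<lambda>r. f r + g r) = nsq n f + nsq n g + 2 * ip n f g"
  by (simp add: nsq_eq_ip ip_simps ip_commute[of n g f])

lemma nsq_scale: "nsq n (\<lambda>r. c * f r) = (norm c)\<^sup>2 * nsq n f"
  by (simp add: nsq_def norm_mult power_mult_distrib sum_distrib_left)

lemma unit_shift_nonzero:
  assumes "n \<ge> 2" "v \<in> {(0, 1), (0, -1), (-1, 0), (1, 0)}"
  shows "shift n v (0, 0) \<noteq> (0, 0)"
  using assms by (auto simp: shift_def zmod_minus1)

text \<open>Only the steps down and right enter: the reverse hops are their adjoints and contribute
  equally. The factor 1/5 is the probability of a move.\<close>

definition energy :: "nat \<Rightarrow> int \<times> int \<Rightarrow> (square \<Rightarrow> complex) \<Rightarrow> real" where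
  "energy n k f = (nsq n (\<lambda>r. f r - hop n k (1, 0) f r) + nsq n (\<lambda>r. f r - hop n k (0, 1) f r)) / 5"

lemma energy_nonneg: "energy n k f \<ge> 0"
  by (simp add: energy_def)

lemma ip_tagged:
  "ip n g (tagged n k f) = (ip n g f + ip n g (hop n k (0, 1) f) + ip n g (hop n k (0, -1) f)
      + ip n g (hop n k (-1, 0) f) + ip n g (hop n k (1, 0) f)) / 5"
proof -
  have "tagged n k f = (\<lambda>r. of_real (1 / 5) * (f r + hop n k (0, 1) f r + hop n k (0, -1) f r
      + hop n k (-1, 0) f r + hop n k (1, 0) f r))"
    by (rule ext) (simp add: tagged_def)
  then show ?thesis by (simp only: ip_simps)
qed

context
  fixes n :: nat assumes n: "n \<ge> 2"
begin

lemma hop_adjoints: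
  "ip n (hop n k (0, 1) f) g = ip n f (hop n k (0, -1) g)"
  "ip n (hop n k (0, -1) f) g = ip n f (hop n k (0, 1) g)"
  "ip n (hop n k (-1, 0) f) g = ip n f (hop n k (1, 0) g)"
  "ip n (hop n k (1, 0) f) g = ip n f (hop n k (-1, 0) g)"
  using hop_adjoint[of n "(0, 1)" k f g] hop_adjoint[of n "(0, -1)" k f g]
    hop_adjoint[of n "(-1, 0)" k f g] hop_adjoint[of n "(1, 0)" k f g]
    unit_shift_nonzero[OF n] n by auto

lemma tagged_symmetric: "ip n (tagged n k f) g = ip n f (tagged n k g)"
proof -
  have "ip n (tagged n k f) g = ip n g (tagged n k f)" by (rule ip_commute)
  then show ?thesis
    using hop_adjoints[of k f g] ip_commute[of n g] by (simp add: ip_tagged)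
qed

lemma ip_tagged_energy: "ip n f (tagged n k f) = nsq n f - energy n k f"
proof -
  have "nsq n (hop n k v f) = nsq n f" if "v \<in> {(0, 1), (1, 0)}" for v
    using nsq_hop[of n v k f] unit_shift_nonzero[OF n] n that by auto
  then have e: "5 * energy n k f = 4 * nsq n f - 2 * ip n f (hop n k (1, 0) f) - 2 * ip n f (hop n k (0, 1) f)"
    by (simp add: energy_def nsq_diff)
  have "ip n f (hop n k (0, -1) f) = ip n f (hop n k (0, 1) f)"
    "ip n f (hop n k (-1, 0) f) = ip n f (hop n k (1, 0) f)"
    using hop_adjoints[of k f f] ip_commute[of n f] by auto
  then show ?thesis using e by (simp add: ip_tagged nsq_eq_ip)
qed

text \<open>From \<open>nsq n (f + hop f) \<ge> 0\<close> each direction contributes at most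
  \<open>4 nsq n f\<close>. Thus the holding probability keeps the quadratic form of
  \<open>tagged\<close> above \<open>- 3 / 5\<close>, and a factor of at least \<open>3 / 5\<close>
  that bounds it from above bounds it in absolute value.\<close>

lemma energy_le: "energy n k f \<le> 8 / 5 * nsq n f"
proof -
  have "nsq n (hop n k v f) = nsq n f" if "v \<in> {(0, 1), (1, 0)}" for v
    using nsq_hop[of n v k f] unit_shift_nonzero[OF n] n that by auto
  moreover have "nsq n (\<lambda>r. f r + hop n k v f r) \<ge> 0" for v by simp
  ultimately show ?thesis
    using nsq_nonneg[of n "\<lambda>r. f r + hop n k (1, 0) f r"] nsq_nonneg[of n "\<lambda>r. f r + hop n k (0, 1) f r"]
    by (simp add: energy_def nsq_diff nsq_add del: nsq_nonneg)
qed

end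

section \<open>Dirichlet form of the holed torus and the two edges across the hole\<close>

definition edges :: "nat \<Rightarrow> int \<times> int \<Rightarrow> square set" where
  "edges n v = {r \<in> holed n. shift n v r \<noteq> (0, 0)}"

lemma finite_edges [simp]: "finite (edges n v)"
  by (simp add: edges_def)

definition dirichlet :: "nat \<Rightarrow> (square \<Rightarrow> complex) \<Rightarrow> real" where
  "dirichlet n f = (\<Sum>r\<in>edges n (1, 0). (norm (f r - f (shift n (1, 0) r)))\<^sup>2)
                 + (\<Sum>r\<in>edges n (0, 1). (norm (f r - f (shift n (0, 1) r)))\<^sup>2)"

lemma dirichlet_nonneg: "dirichlet n f \<ge> 0"
  by (simp add: dirichlet_def sum_nonneg)

text \<open>For each of the two directions exactly one square is sent across the hole, the one just
  before it; all other hops are ordinary edges without phase.\<close>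

lemma energy_split:
  assumes n: "n \<ge> 2"
  shows "5 * energy n k f = dirichlet n f
     + (norm (f (int n - 1, 0) - root1 n (- fst k) * f (1, 0)))\<^sup>2
     + (norm (f (0, int n - 1) - root1 n (- snd k) * f (0, 1)))\<^sup>2"
proof -
  have split: "nsq n (\<lambda>r. f r - hop n k v f r) = (\<Sum>r\<in>edges n v. (norm (f r - f (shift n v r)))\<^sup>2)
      + (norm (f w - chr n k w * f (shift n v (0, 0))))\<^sup>2"
    if w: "w \<in> holed n" "shift n v w = (0, 0)" for v w
  proof -
    have u: "r = w" if "r \<in> holed n" "shift n v r = (0, 0)" for r
      using that w shift_uminus(2)[of r n v] shift_uminus(2)[of w n v] unfolding holed_def
      by (metis DiffD1)
    have h: "holed n = insert w (edges n v)" "w \<notin> edges n v"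
      unfolding edges_def using u w by blast+
    have 1: "hop n k v f r = f (shift n v r)" if "r \<in> edges n v" for r
      using that by (simp add: hop_def jump_def edges_def)
    have 2: "hop n k v f w = chr n k w * f (shift n v (0, 0))"
      using w by (simp add: hop_def jump_def)
    have "nsq n (\<lambda>r. f r - hop n k v f r) = (norm (f w - hop n k v f w))\<^sup>2
        + (\<Sum>r\<in>edges n v. (norm (f r - hop n k v f r))\<^sup>2)"
      unfolding nsq_def h(1) by (rule sum.insert) (use h(2) in auto)
    then show ?thesis unfolding 2 by (simp add: 1)
  qed
  have c: "root1 n (x * (int n - 1)) = root1 n (- x)" for x
  proof (rule root1_cong)
    show "n > 0" using n by simp
    have e: "x * (int n - 1) = - x + x * int n" by (simp add: algebra_simps)
    show "x * (int n - 1) mod int n = - x mod int n" unfolding e by (rule mod_mult_self1)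
  qed
  have "nsq n (\<lambda>r. f r - hop n k (1, 0) f r) = (\<Sum>r\<in>edges n (1, 0). (norm (f r - f (shift n (1, 0) r)))\<^sup>2)
      + (norm (f (int n - 1, 0) - root1 n (- fst k) * f (1, 0)))\<^sup>2"
    using split[of "(int n - 1, 0)" "(1, 0)"] n c[of "fst k"]
    by (simp add: holed_def board_def shift_def chr_def)
  moreover have "nsq n (\<lambda>r. f r - hop n k (0, 1) f r) = (\<Sum>r\<in>edges n (0, 1). (norm (f r - f (shift n (0, 1) r)))\<^sup>2)
      + (norm (f (0, int n - 1) - root1 n (- snd k) * f (0, 1)))\<^sup>2"
    using split[of "(0, int n - 1)" "(0, 1)"] n c[of "snd k"]
    by (simp add: holed_def board_def shift_def chr_def)
  ultimately show ?thesis by (simp add: energy_def dirichlet_def)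
qed

lemma dirichlet_le_energy: "n \<ge> 2 \<Longrightarrow> dirichlet n f \<le> 5 * energy n k f"
  by (simp add: energy_split)

section \<open>Energy estimates\<close>

text \<open>Kept free of conjugation so that it is symmetric and complex linear in both arguments;
  complex multiples of dipoles can then be pulled out, and the Dirichlet form is recovered by
  conjugating one argument.\<close>

definition bilin :: "nat \<Rightarrow> (square \<Rightarrow> complex) \<Rightarrow> (square \<Rightarrow> complex) \<Rightarrow> complex" where
  "bilin n a b = (\<Sum>r\<in>edges n (1, 0). (a r - a (shift n (1, 0) r)) * (b r - b (shift n (1, 0) r)))
               + (\<Sum>r\<in>edges n (0, 1). (a r - a (shift n (0, 1) r)) * (b r - b (shift n (0, 1) r)))"

lemma bilin_simps:
  "bilin n (\<lambda>r. a r + a' r) b = bilin n a b + bilin n a' b"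
  "bilin n (\<lambda>r. a r - a' r) b = bilin n a b - bilin n a' b"
  "bilin n (\<lambda>r. c * a r) b = c * bilin n a b"
  "bilin n b (\<lambda>r. a r + a' r) = bilin n b a + bilin n b a'"
  "bilin n b (\<lambda>r. a r - a' r) = bilin n b a - bilin n b a'"
  "bilin n b (\<lambda>r. c * a r) = c * bilin n b a"
  by (simp_all add: bilin_def algebra_simps sum.distrib sum_subtractf sum_distrib_left)

lemma bilin_commute: "bilin n a b = bilin n b a"
  by (simp add: bilin_def mult.commute)

lemma dirichlet_eq_bilin: "complex_of_real (dirichlet n f) = bilin n f (\<lambda>r. cnj (f r))"
  by (simp add: dirichlet_def bilin_def complex_norm_square del: of_real_power)

lemma swap_in_edges:
  "prod.swap r \<in> edges n (0, 1) \<longleftrightarrow> r \<in> edges n (1, 0)"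
  "prod.swap r \<in> edges n (1, 0) \<longleftrightarrow> r \<in> edges n (0, 1)"
  by (cases r; auto simp: edges_def holed_def board_def shift_def)+

lemma sum_edges_swap:
  fixes F :: "square \<Rightarrow> complex"
  shows "(\<Sum>r\<in>edges n (0, 1). F (prod.swap r)) = (\<Sum>r\<in>edges n (1, 0). F r)"
    and "(\<Sum>r\<in>edges n (1, 0). F (prod.swap r)) = (\<Sum>r\<in>edges n (0, 1). F r)"
  by (rule sum.reindex_bij_witness[where i = prod.swap and j = prod.swap];
      simp add: swap_in_edges)+

lemma bilin_swap: "bilin n (\<lambda>r. a (prod.swap r)) (\<lambda>r. b (prod.swap r)) = bilin n a b"
proof -
  have s: "prod.swap (shift n (0, 1) (prod.swap r)) = shift n (1, 0) r"
    "prod.swap (shift n (1, 0) (prod.swap r)) = shift n (0, 1) r" for r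
    by (simp_all add: shift_def)
  have t: "a (prod.swap (shift n (0, 1) r)) = a (shift n (1, 0) (prod.swap r))"
    "a (prod.swap (shift n (1, 0) r)) = a (shift n (0, 1) (prod.swap r))" for a :: "square \<Rightarrow> complex" and r
    using s[of "prod.swap r"] by simp_all
  show ?thesis
    unfolding bilin_def t
    by (simp only: sum_edges_swap(1)[where n = n and F = "\<lambda>r. (a r - a (shift n (1, 0) r)) * (b r - b (shift n (1, 0) r))"]
        sum_edges_swap(2)[where n = n and F = "\<lambda>r. (a r - a (shift n (0, 1) r)) * (b r - b (shift n (0, 1) r))"] add.commute)
qed

text \<open>Summation by parts is exact on the full torus by translation invariance. The edges at
  the hole are split off afterwards by \<open>sum_board_edges\<close>.\<close>

lemma sum_board_gradients:
  fixes a b :: "square \<Rightarrow> complex"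
  assumes "n > 0"
  shows "(\<Sum>r\<in>board n. (a r - a (shift n v r)) * (b r - b (shift n v r)))
       = (\<Sum>r\<in>board n. (2 * a r - a (shift n v r) - a (shift n (- v) r)) * b r)"
proof -
  have 1: "(\<Sum>r\<in>board n. a (shift n v r) * b (shift n v r)) = (\<Sum>r\<in>board n. a r * b r)"
    by (rule sum_shift[OF assms, of "\<lambda>r. a r * b r"])
  have "(\<Sum>r\<in>board n. a (shift n (- v) r) * b r)
      = (\<Sum>r\<in>board n. a (shift n (- v) (shift n v r)) * b (shift n v r))"
    by (rule sum_shift[OF assms, symmetric, of "\<lambda>r. a (shift n (- v) r) * b r"])
  also have "\<dots> = (\<Sum>r\<in>board n. a r * b (shift n v r))" by simp
  finally have 2: "(\<Sum>r\<in>board n. a r * b (shift n v r)) = (\<Sum>r\<in>board n. a (shift n (- v) r) * b r)" ..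
  show ?thesis
    by (simp add: left_diff_distrib right_diff_distrib sum_subtractf sum.distrib sum_distrib_left[symmetric] mult.assoc 1 2)
qed

lemma sum_board_edges:
  fixes F :: "square \<Rightarrow> complex"
  assumes n: "n > 0" and v: "shift n v (0, 0) \<noteq> (0, 0)"
  shows "(\<Sum>r\<in>board n. F r) = (\<Sum>r\<in>edges n v. F r) + F (0, 0) + F (shift n (- v) (0, 0))"
proof -
  let ?w = "shift n (- v) (0, 0)"
  have w: "?w \<noteq> (0, 0)" "?w \<in> board n" "shift n v ?w = (0, 0)"
    using shift_neg_nonzero[OF n v] n shift_uminus(1)[OF origin_in_board[OF n]] by auto
  have u: "r = ?w" if "r \<in> board n" "shift n v r = (0, 0)" for r
    using shift_eq_origin[OF n v that] .
  have h: "board n = insert (0, 0) (insert ?w (edges n v))"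
    unfolding edges_def holed_def using u w origin_in_board[OF n] by blast
  have "(0, 0) \<notin> insert ?w (edges n v)" "?w \<notin> edges n v"
    using w by (auto simp: edges_def holed_def)
  then show ?thesis unfolding h by (simp add: add_ac)
qed

lemma dipole_axis [simp]: "dipole n (0, y) = 0"
  by (simp add: dipole_def)

lemma dipole_neg:
  assumes "n > 0" shows "dipole n (int n - 1, 0) = - dipole_height n"
proof -
  have "dipole n (int n - 1, 0) = dipole n (-1, 0)"
    using dipole_mod[OF assms, of "-1" 0] assms by (simp add: zmod_minus1)
  also have "\<dots> = - dipole n (1, 0)"
    unfolding dipole_def by (simp add: sum_negf)
  finally show ?thesis by (simp add: dipole_height_def)
qed

text \<open>On the full torus the dipole pairs with any function to the difference of its values at
  the poles. The potential is 0 at the hole, so the two edges there account for exactly the fraction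
  \<open>dipole_height n\<close> of this, and deleting them leaves the rest with the same
  poles.\<close>

lemma bilin_dipole:
  assumes n: "n \<ge> 2"
  shows "bilin n (\<lambda>r. of_real (dipole n r)) b = of_real (1 - dipole_height n) * (b (1, 0) - b (int n - 1, 0))"
proof -
  let ?a = "\<lambda>r. complex_of_real (dipole n r)"
  \<comment> \<open>The edges of the holed torus do not see the value at the hole; with value 0
    there, each edge at the hole contributes only the value at its other end.\<close>
  define c where "c = b((0, 0) := 0)"
  have n0: "n > 0" using n by simp
  have bc: "bilin n ?a b = bilin n ?a c"
    unfolding bilin_def c_def by (intro arg_cong2[where f = "(+)"] sum.cong refl) (auto simp: edges_def holed_def)
  have m: "(- 1) mod int n = int n - 1" using n by (simp add: zmod_minus1)
  have o: "1 mod int n = 1" using n by simp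
  define G where "G v = (\<Sum>r\<in>board n. (?a r - ?a (shift n v r)) * (c r - c (shift n v r)))" for v
  have s: "shift n (- 1, 0) (0, 0) = (int n - 1, 0)" "shift n (0, - 1) (0, 0) = (0, int n - 1)"
    "shift n (1, 0) (0, 0) = (1, 0)" "shift n (0, 1) (0, 0) = (0, 1)"
    "shift n (1, 0) (int n - 1, 0) = (0, 0)" "shift n (0, 1) (0, int n - 1) = (0, 0)"
    using n by (simp_all add: shift_def m)
  have G1: "G (1, 0) = (\<Sum>r\<in>edges n (1, 0). (?a r - ?a (shift n (1, 0) r)) * (c r - c (shift n (1, 0) r)))
      + of_real (dipole_height n) * (c (1, 0) - c (int n - 1, 0))"
    unfolding G_def
    by (subst sum_board_edges[OF n0 unit_shift_nonzero[OF n, of "(1, 0)"]])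
       (simp_all add: s dipole_neg n0 c_def dipole_height_def[symmetric] add_ac, use n in \<open>simp add: algebra_simps\<close>)
  \<comment> \<open>No boundary term in this direction: the dipole vanishes at the hole and at both
    neighbours concerned.\<close>
  have G2: "G (0, 1) = (\<Sum>r\<in>edges n (0, 1). (?a r - ?a (shift n (0, 1) r)) * (c r - c (shift n (0, 1) r)))"
    unfolding G_def
    by (subst sum_board_edges[OF n0 unit_shift_nonzero[OF n, of "(0, 1)"]])
       (simp_all add: s c_def)
  have "G (1, 0) + G (0, 1) = (\<Sum>r\<in>board n. (4 * ?a r - ?a (shift n (1, 0) r) - ?a (shift n (-1, 0) r)
      - ?a (shift n (0, 1) r) - ?a (shift n (0, -1) r)) * c r)"
    unfolding G_def sum_board_gradients[OF n0, of ?a] sum.distrib[symmetric]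
    by (simp add: algebra_simps)
  also have "\<dots> = (\<Sum>r\<in>board n. (of_bool (r = (1, 0)) - of_bool (r = (int n - 1, 0))) * c r)"
  proof (rule sum.cong[OF refl])
    fix r assume r: "r \<in> board n"
    obtain x y where xy: "r = (x, y)" by (cases r)
    have rng: "0 \<le> x" "x < int n" "0 \<le> y" "y < int n" using r by (auto simp: xy board_def)
    have "int n dvd x - 1 \<longleftrightarrow> x = 1"
      using rng n by (auto simp flip: mod_eq_dvd_iff)
    moreover have "int n dvd x + 1 \<longleftrightarrow> x = int n - 1"
    proof
      assume "int n dvd x + 1"
      then have "int n \<le> x + 1" using rng by (intro zdvd_imp_le) auto
      then show "x = int n - 1" using rng by simp
    qed simp
    ultimately have "4 * dipole n (x, y) - dipole n ((x + 1) mod int n, y) - dipole n ((x - 1) mod int n, y)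
        - dipole n (x, (y + 1) mod int n) - dipole n (x, (y - 1) mod int n)
        = of_bool (r = (1, 0)) - of_bool (r = (int n - 1, 0))"
      using dipole_laplacian[OF n rng(3,4), of x] by (simp add: xy)
    moreover have "4 * ?a r - ?a (shift n (1, 0) r) - ?a (shift n (-1, 0) r)
      - ?a (shift n (0, 1) r) - ?a (shift n (0, -1) r)
      = of_real (4 * dipole n (x, y) - dipole n ((x + 1) mod int n, y) - dipole n ((x - 1) mod int n, y)
        - dipole n (x, (y + 1) mod int n) - dipole n (x, (y - 1) mod int n))"
      using rng by (simp add: xy shift_def)
    ultimately have "4 * ?a r - ?a (shift n (1, 0) r) - ?a (shift n (-1, 0) r)
      - ?a (shift n (0, 1) r) - ?a (shift n (0, -1) r) = of_real (of_bool (r = (1, 0)) - of_bool (r = (int n - 1, 0)))"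
      by (simp only:)
    then show "(4 * ?a r - ?a (shift n (1, 0) r) - ?a (shift n (-1, 0) r)
      - ?a (shift n (0, 1) r) - ?a (shift n (0, -1) r)) * c r
      = (of_bool (r = (1, 0)) - of_bool (r = (int n - 1, 0))) * c r"
      by simp
  qed
  also have "\<dots> = c (1, 0) - c (int n - 1, 0)"
  proof -
    have "(1, 0) \<in> board n" "(int n - 1, 0) \<in> board n" using n by (auto simp: board_def)
    then show ?thesis
      by (simp add: left_diff_distrib sum_subtractf of_bool_def if_distrib[of "\<lambda>z. z * _"] sum.delta' cong: if_cong)
  qed
  finally have "bilin n ?a c + of_real (dipole_height n) * (c (1, 0) - c (int n - 1, 0)) = c (1, 0) - c (int n - 1, 0)"
    unfolding G1 G2 bilin_def by (simp add: add_ac)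
  then have "bilin n ?a c = of_real (1 - dipole_height n) * (c (1, 0) - c (int n - 1, 0))"
    by (simp add: algebra_simps)
  moreover have "c (1, 0) = b (1, 0)" "c (int n - 1, 0) = b (int n - 1, 0)"
    using n by (simp_all add: c_def)
  ultimately show ?thesis using bc by simp
qed

definition dipoles :: "nat \<Rightarrow> complex \<Rightarrow> complex \<Rightarrow> square \<Rightarrow> complex" where
  "dipoles n a1 a2 r = a1 * of_real (dipole n r) + a2 * of_real (dipole n (prod.swap r))"

lemma bilin_dipoles:
  assumes "n \<ge> 2"
  shows "bilin n (dipoles n a1 a2) b = of_real (1 - dipole_height n) *
    (a1 * (b (1, 0) - b (int n - 1, 0)) + a2 * (b (0, 1) - b (0, int n - 1)))"
proof -
  have "bilin n (\<lambda>r. of_real (dipole n (prod.swap r))) b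
      = bilin n (\<lambda>r. of_real (dipole n r)) (\<lambda>r. b (prod.swap r))"
    by (subst bilin_swap[symmetric]) simp
  then have "bilin n (\<lambda>r. of_real (dipole n (prod.swap r))) b
      = of_real (1 - dipole_height n) * (b (0, 1) - b (0, int n - 1))"
    by (simp add: bilin_dipole[OF assms])
  then show ?thesis
    unfolding dipoles_def[abs_def] bilin_simps bilin_dipole[OF assms] by (simp only: distrib_left mult_ac)
qed

lemma dipoles_values:
  assumes "n \<ge> 2"
  shows "dipoles n a1 a2 (1, 0) = a1 * of_real (dipole_height n)"
    "dipoles n a1 a2 (int n - 1, 0) = - (a1 * of_real (dipole_height n))"
    "dipoles n a1 a2 (0, 1) = a2 * of_real (dipole_height n)"
    "dipoles n a1 a2 (0, int n - 1) = - (a2 * of_real (dipole_height n))"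
  using assms dipole_neg[of n] by (simp_all add: dipoles_def dipole_height_def)

text \<open>The mixed terms of the two dipoles drop out because each of them vanishes at the poles
  of the other.\<close>

lemma dirichlet_diff_dipoles:
  fixes f :: "square \<Rightarrow> complex"
  assumes n: "n \<ge> 2"
  defines "d1 \<equiv> f (1, 0) - f (int n - 1, 0)" and "d2 \<equiv> f (0, 1) - f (0, int n - 1)"
  defines "h \<equiv> dipole_height n"
  shows "dirichlet n (\<lambda>r. f r - dipoles n a1 a2 r) = dirichlet n f
     - 2 * (1 - h) * (a1 \<bullet> d1 + a2 \<bullet> d2) + 2 * h * (1 - h) * ((norm a1)\<^sup>2 + (norm a2)\<^sup>2)"
proof -
  let ?w = "dipoles n a1 a2" and ?w' = "dipoles n (cnj a1) (cnj a2)"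
  have cw: "cnj (?w r) = ?w' r" for r by (simp add: dipoles_def)
  have "complex_of_real (dirichlet n (\<lambda>r. f r - ?w r))
      = bilin n f (\<lambda>r. cnj (f r)) - bilin n ?w (\<lambda>r. cnj (f r)) - bilin n ?w' f + bilin n ?w ?w'"
    unfolding dirichlet_eq_bilin
    by (simp add: cw bilin_simps bilin_commute[of n f ?w'])
  also have "\<dots> = of_real (dirichlet n f) - of_real (1 - h) * (a1 * cnj d1 + a2 * cnj d2)
     - of_real (1 - h) * (cnj a1 * d1 + cnj a2 * d2) + of_real (2 * h * (1 - h)) * (a1 * cnj a1 + a2 * cnj a2)"
    unfolding bilin_dipoles[OF n] dipoles_values[OF n] dirichlet_eq_bilin h_def d1_def d2_def
    by (simp add: algebra_simps)
  finally have "Re (complex_of_real (dirichlet n (\<lambda>r. f r - ?w r))) = Re (of_real (dirichlet n f) - of_real (1 - h) * (a1 * cnj d1 + a2 * cnj d2)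
     - of_real (1 - h) * (cnj a1 * d1 + cnj a2 * d2) + of_real (2 * h * (1 - h)) * (a1 * cnj a1 + a2 * cnj a2))"
    by (rule arg_cong)
  then show ?thesis
    unfolding inner_complex_def cmod_power2 by (simp add: algebra_simps power2_eq_square)
qed

text \<open>Bessel's inequality for the gradients of the two dipoles, which are orthogonal.\<close>

lemma dirichlet_ge:
  assumes n: "n \<ge> 2" and h: "0 < dipole_height n" "dipole_height n < 1"
  shows "dirichlet n f \<ge> (1 - dipole_height n) / (2 * dipole_height n) *
    ((norm (f (1, 0) - f (int n - 1, 0)))\<^sup>2 + (norm (f (0, 1) - f (0, int n - 1)))\<^sup>2)"
proof -
  define \<eta> where "\<eta> = dipole_height n"
  let ?d1 = "f (1, 0) - f (int n - 1, 0)" and ?d2 = "f (0, 1) - f (0, int n - 1)"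
  have p: "\<eta> > 0" using h by (simp add: \<eta>_def)
  \<comment> \<open>These coefficients give the dipoles the same differences across the hole as
    \<open>f\<close>, since a dipole itself has difference \<open>2 \<eta>\<close>; they are the
    orthogonal projection.\<close>
  have "0 \<le> dirichlet n (\<lambda>r. f r - dipoles n (?d1 / of_real (2 * \<eta>)) (?d2 / of_real (2 * \<eta>)) r)"
    by (rule dirichlet_nonneg)
  also have "\<dots> = dirichlet n f - 2 * (1 - \<eta>) * ((norm ?d1)\<^sup>2 + (norm ?d2)\<^sup>2) / (2 * \<eta>)
     + 2 * \<eta> * (1 - \<eta>) * (((norm ?d1)\<^sup>2 + (norm ?d2)\<^sup>2) / (2 * \<eta>)\<^sup>2)"
  proof -
    have i: "(d / of_real (2 * \<eta>)) \<bullet> d = (norm d)\<^sup>2 / (2 * \<eta>)" for d :: complex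
    proof -
      have "d / of_real (2 * \<eta>) = (1 / (2 * \<eta>)) *\<^sub>R d" by (simp add: scaleR_conv_of_real)
      then show ?thesis by (simp only: inner_scaleR_left) (simp add: dot_square_norm)
    qed
    have j: "(norm (d / of_real (2 * \<eta>)))\<^sup>2 = (norm d)\<^sup>2 / (2 * \<eta>)\<^sup>2" for d :: complex
      using p by (simp add: norm_divide power_divide power_mult_distrib norm_mult)
    show ?thesis
      unfolding dirichlet_diff_dipoles[OF n] \<eta>_def[symmetric] i j by (simp only: add_divide_distrib[symmetric] times_divide_eq_right)
  qed
  also have "\<dots> = dirichlet n f - (1 - \<eta>) / (2 * \<eta>) * ((norm ?d1)\<^sup>2 + (norm ?d2)\<^sup>2)"
    using p by (simp add: field_simps power2_eq_square)
  finally show ?thesis by (simp add: \<eta>_def)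
qed

text \<open>With \<open>C = (1 - h) / (2 h)\<close>, the conductance between opposite neighbours of the hole, this is
  \<open>C / (1 + C)\<close>: the network in series with the unit resistor across the hole.\<close>

definition conductance :: "nat \<Rightarrow> real" where
  "conductance n = (1 - dipole_height n) / (1 + dipole_height n)"

lemma series_bound:
  fixes w d :: complex
  assumes h: "0 < h" "h < 1"
  shows "(1 - h) / (2 * h) * (norm d)\<^sup>2 + (norm (w - d))\<^sup>2 \<ge> (1 - h) / (1 + h) * (norm w)\<^sup>2"
proof -
  \<comment> \<open>The optimal division of \<open>w\<close> between a resistance
    \<open>2 h / (1 - h)\<close> and a unit resistance is \<open>d = 2 h / (1 + h) * w\<close>;
    completing the square at this point gives the bound.\<close>
  have "0 \<le> (norm ((1 + h) *\<^sub>R d - (2 * h) *\<^sub>R w))\<^sup>2" by simp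
  also have "\<dots> = (1 + h)\<^sup>2 * (norm d)\<^sup>2 - 4 * h * (1 + h) * (w \<bullet> d) + 4 * h\<^sup>2 * (norm w)\<^sup>2"
    unfolding power2_norm_eq_inner inner_simps by (simp add: inner_commute[of d w] power2_eq_square algebra_simps)
  also have "\<dots> = (1 - h) * (1 + h) * (norm d)\<^sup>2 + 2 * h * (1 + h) * (norm (w - d))\<^sup>2 - 2 * h * (1 - h) * (norm w)\<^sup>2"
    unfolding power2_norm_eq_inner inner_simps
    by (simp add: inner_commute[of d w] power2_eq_square algebra_simps)
  also have "\<dots> = 2 * h * (1 + h) * ((1 - h) / (2 * h) * (norm d)\<^sup>2 + (norm (w - d))\<^sup>2 - (1 - h) / (1 + h) * (norm w)\<^sup>2)"
  proof -
    have "2 * h * (1 + h) * ((1 - h) / (2 * h) * A) = (1 - h) * (1 + h) * A"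
      "2 * h * (1 + h) * ((1 - h) / (1 + h) * A) = 2 * h * (1 - h) * A" for A
      using h by (simp_all add: divide_simps)
    then show ?thesis by (simp only: distrib_left[of "2 * h * (1 + h)"] right_diff_distrib[of "2 * h * (1 + h)"])
  qed
  finally show ?thesis
    using h mult_left_le_imp_le[of "2 * h * (1 + h)" 0
      "(1 - h) / (2 * h) * (norm d)\<^sup>2 + (norm (w - d))\<^sup>2 - (1 - h) / (1 + h) * (norm w)\<^sup>2"] by simp
qed

text \<open>With phase \<open>z\<close>, \<open>x\<close> the value at a neighbour of the hole and
  \<open>y\<close> the value opposite, \<open>y - z x = (1 - z) x - (x - y)\<close>. So the mismatch
  \<open>w = (1 - z) x\<close> is shared between the drop \<open>x - y\<close> through the network
  and the edge across the hole, which is the situation of \<open>series_bound\<close>.\<close>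

lemma energy_ge:
  assumes n: "n \<ge> 2" and h: "0 < dipole_height n" "dipole_height n < 1"
  shows "5 * energy n k f \<ge> conductance n * ((norm (1 - root1 n (- fst k)))\<^sup>2 * (norm (f (1, 0)))\<^sup>2
      + (norm (1 - root1 n (- snd k)))\<^sup>2 * (norm (f (0, 1)))\<^sup>2)"
proof -
  have e: "(norm (y - z * x))\<^sup>2 = (norm ((1 - z) * x - (x - y)))\<^sup>2" for x y z :: complex
    by (rule arg_cong[where f = "\<lambda>u. u\<^sup>2"]) (simp add: algebra_simps)
  have "5 * energy n k f \<ge> (1 - dipole_height n) / (2 * dipole_height n) *
    ((norm (f (1, 0) - f (int n - 1, 0)))\<^sup>2 + (norm (f (0, 1) - f (0, int n - 1)))\<^sup>2)
     + (norm (f (int n - 1, 0) - root1 n (- fst k) * f (1, 0)))\<^sup>2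
     + (norm (f (0, int n - 1) - root1 n (- snd k) * f (0, 1)))\<^sup>2"
    unfolding energy_split[OF n] using dirichlet_ge[OF n h, of f] by simp
  moreover have "(1 - dipole_height n) / (2 * dipole_height n) * (norm (f (1, 0) - f (int n - 1, 0)))\<^sup>2
     + (norm (f (int n - 1, 0) - root1 n (- fst k) * f (1, 0)))\<^sup>2
     \<ge> conductance n * ((norm (1 - root1 n (- fst k)))\<^sup>2 * (norm (f (1, 0)))\<^sup>2)"
    using series_bound[OF h, of "(1 - root1 n (- fst k)) * f (1, 0)" "f (1, 0) - f (int n - 1, 0)"]
    unfolding e[of "f (int n - 1, 0)" "root1 n (- fst k)" "f (1, 0)"] conductance_def
    by (simp only: norm_mult power_mult_distrib)
  moreover have "(1 - dipole_height n) / (2 * dipole_height n) * (norm (f (0, 1) - f (0, int n - 1)))\<^sup>2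
     + (norm (f (0, int n - 1) - root1 n (- snd k) * f (0, 1)))\<^sup>2
     \<ge> conductance n * ((norm (1 - root1 n (- snd k)))\<^sup>2 * (norm (f (0, 1)))\<^sup>2)"
    using series_bound[OF h, of "(1 - root1 n (- snd k)) * f (0, 1)" "f (0, 1) - f (0, int n - 1)"]
    unfolding e[of "f (0, int n - 1)" "root1 n (- snd k)" "f (0, 1)"] conductance_def
    by (simp only: norm_mult power_mult_distrib)
  ultimately show ?thesis by (simp add: distrib_left)
qed

section \<open>Upper bounds by trial functions\<close>

lemma norm_phase_difference:
  "(norm (1 - \<i> * of_real x - cis (- t) * (1 + \<i> * of_real x)))\<^sup>2 = 4 * (sin (t / 2) - x * cos (t / 2))\<^sup>2"
proof -
  \<comment> \<open>Half angles, because factoring out \<open>cis (- u)\<close> leaves the purely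
    imaginary number \<open>2 \<i> (sin u - x cos u)\<close>.\<close>
  define u where "u = t / 2"
  have t: "t = 2 * u" by (simp add: u_def)
  have "(norm (1 - \<i> * of_real x - cis (- t) * (1 + \<i> * of_real x)))\<^sup>2
      = (1 - cos t - x * sin t)\<^sup>2 + (sin t - x - x * cos t)\<^sup>2"
    by (simp add: cmod_power2 algebra_simps)
  also have "1 - cos t - x * sin t = 2 * sin u * (sin u - x * cos u)"
    unfolding t cos_double_sin sin_double by (simp add: power2_eq_square algebra_simps)
  also have "sin t - x - x * cos t = 2 * cos u * (sin u - x * cos u)"
    unfolding t cos_double_cos sin_double by (simp add: power2_eq_square algebra_simps)
  also have "(2 * sin u * (sin u - x * cos u))\<^sup>2 + (2 * cos u * (sin u - x * cos u))\<^sup>2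
      = 4 * (sin u - x * cos u)\<^sup>2 * ((sin u)\<^sup>2 + (cos u)\<^sup>2)"
    by (simp only: power_mult_distrib distrib_left) (simp add: mult_ac)
  finally show ?thesis by (simp only: sin_cos_squared_add mult_1_right u_def)
qed

text \<open>Adding a small imaginary function to 1 acts to first order as a slowly varying phase,
  which takes up part of the mismatch at the hole. It can only increase the modulus, so the norm
  stays above that of the constant 1.\<close>

definition trial :: "nat \<Rightarrow> real \<Rightarrow> real \<Rightarrow> square \<Rightarrow> complex" where
  "trial n b1 b2 r = 1 - dipoles n (- \<i> * of_real b1) (- \<i> * of_real b2) r"

lemma energy_trial:
  assumes n: "n \<ge> 2"
  defines "h \<equiv> dipole_height n"
  shows "5 * energy n k (trial n b1 b2) = 2 * h * (1 - h) * (b1\<^sup>2 + b2\<^sup>2)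
    + 4 * (sin (pi * fst k / n) - b1 * h * cos (pi * fst k / n))\<^sup>2
    + 4 * (sin (pi * snd k / n) - b2 * h * cos (pi * snd k / n))\<^sup>2"
proof -
  have "dirichlet n (trial n b1 b2) = 2 * h * (1 - h) * (b1\<^sup>2 + b2\<^sup>2)"
    unfolding trial_def[abs_def] dirichlet_diff_dipoles[OF n, of "\<lambda>_. 1"]
    by (simp add: h_def dirichlet_def norm_mult)
  moreover have r: "root1 n (- j) = cis (- (2 * pi * of_int j / n))" for j
    by (simp add: root1_def)
  have "(norm (trial n b1 b2 (int n - 1, 0) - root1 n (- fst k) * trial n b1 b2 (1, 0)))\<^sup>2
      = 4 * (sin (pi * fst k / n) - b1 * h * cos (pi * fst k / n))\<^sup>2"
    using norm_phase_difference[of "b1 * h" "2 * pi * fst k / n"]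
    by (simp add: trial_def dipoles_values[OF n] r h_def[symmetric] mult_ac)
  moreover have "(norm (trial n b1 b2 (0, int n - 1) - root1 n (- snd k) * trial n b1 b2 (0, 1)))\<^sup>2
      = 4 * (sin (pi * snd k / n) - b2 * h * cos (pi * snd k / n))\<^sup>2"
    using norm_phase_difference[of "b2 * h" "2 * pi * snd k / n"]
    by (simp add: trial_def dipoles_values[OF n] r h_def[symmetric] mult_ac)
  ultimately show ?thesis unfolding energy_split[OF n] by simp
qed

lemma nsq_trial:
  assumes "n > 0" shows "nsq n (trial n b1 b2) \<ge> real (n\<^sup>2 - 1)"
proof -
  have "(norm (trial n b1 b2 r))\<^sup>2 \<ge> 1" for r
    by (simp add: trial_def dipoles_def cmod_power2)
  then have "nsq n (trial n b1 b2) \<ge> (\<Sum>r\<in>holed n. 1)" unfolding nsq_def by (intro sum_mono) auto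
  then show ?thesis using card_holed[OF assms] by simp
qed

section \<open>Oscillation bounded by the Dirichlet form\<close>

lemma path_bound:
  fixes a :: "nat \<Rightarrow> complex"
  shows "(norm (a (i + d) - a i))\<^sup>2 \<le> real d * (\<Sum>l<d. (norm (a (i + l) - a (i + Suc l)))\<^sup>2)"
proof -
  have "a i - a (i + d) = (\<Sum>l<d. a (i + l) - a (i + Suc l))"
    using sum_lessThan_telescope'[of "\<lambda>l. a (i + l)" d] by simp
  then have "norm (a (i + d) - a i) \<le> (\<Sum>l<d. norm (a (i + l) - a (i + Suc l)))"
    by (metis norm_minus_commute norm_sum)
  then have "(norm (a (i + d) - a i))\<^sup>2 \<le> (\<Sum>l<d. norm (a (i + l) - a (i + Suc l)))\<^sup>2"
    by (intro power_mono) auto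
  also have "\<dots> \<le> real d * (\<Sum>l<d. (norm (a (i + l) - a (i + Suc l)))\<^sup>2)"
    using sum_squared_le_sum_of_squares[of "\<lambda>l. norm (a (i + l) - a (i + Suc l))" "{..<d}"]
    by (simp add: mult.commute)
  finally show ?thesis .
qed

text \<open>Excluding the row 0 keeps the path away from the hole, so all its steps are edges; each
  edge is used once, and Cauchy-Schwarz costs the length of the path.\<close>

lemma row_oscillation_le:
  assumes x: "0 < x" "x < int n" and y: "i + d < n"
  shows "(norm (f (x, int (i + d)) - f (x, int i)))\<^sup>2 \<le> real n * dirichlet n f"
proof -
  let ?F = "\<lambda>r. (norm (f r - f (shift n (0, 1) r)))\<^sup>2"
  have "(norm (f (x, int (i + d)) - f (x, int i)))\<^sup>2
      \<le> real d * (\<Sum>l<d. (norm (f (x, int (i + l)) - f (x, int (i + Suc l))))\<^sup>2)"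
    by (rule path_bound[of "\<lambda>j. f (x, int j)"])
  also have "(\<Sum>l<d. (norm (f (x, int (i + l)) - f (x, int (i + Suc l))))\<^sup>2) = (\<Sum>l<d. ?F (x, int (i + l)))"
    using x y by (intro sum.cong) (auto simp: shift_def algebra_simps)
  also have "\<dots> = (\<Sum>r\<in>(\<lambda>l. (x, int (i + l))) ` {..<d}. ?F r)"
    by (subst sum.reindex) (auto simp: inj_on_def)
  also have "\<dots> \<le> (\<Sum>r\<in>edges n (0, 1). ?F r)"
  proof (rule sum_mono2)
    have "(x, int (i + l)) \<in> edges n (0, 1)" if "l < d" for l
      using x y that by (simp add: edges_def holed_def board_def shift_def)
    then show "(\<lambda>l. (x, int (i + l))) ` {..<d} \<subseteq> edges n (0, 1)" by auto
  qed auto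
  also have "\<dots> \<le> dirichlet n f" by (simp add: dirichlet_def sum_nonneg)
  finally have "(norm (f (x, int (i + d)) - f (x, int i)))\<^sup>2 \<le> real d * dirichlet n f"
    by (simp add: mult_left_mono)
  also have "\<dots> \<le> real n * dirichlet n f"
    using y dirichlet_nonneg by (intro mult_right_mono) auto
  finally show ?thesis .
qed

lemma row_oscillation:
  assumes x: "0 < x" "x < int n" and y: "0 \<le> y" "y < int n" "0 \<le> y'" "y' < int n"
  shows "(norm (f (x, y) - f (x, y')))\<^sup>2 \<le> real n * dirichlet n f"
proof -
  have *: "(norm (f (x, y) - f (x, y')))\<^sup>2 \<le> real n * dirichlet n f"
    if "0 \<le> y'" "y' \<le> y" "y < int n" for y y'
    using row_oscillation_le[OF x, of "nat y'" "nat (y - y')" f] that by simp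
  show ?thesis
    using *[of y' y] *[of y y'] y by (cases "y' \<le> y") (auto simp: norm_minus_commute)
qed

lemma dirichlet_swap: "dirichlet n (\<lambda>r. f (prod.swap r)) = dirichlet n f"
proof -
  have "complex_of_real (dirichlet n (\<lambda>r. f (prod.swap r))) = of_real (dirichlet n f)"
    unfolding dirichlet_eq_bilin by (rule bilin_swap[of n f "\<lambda>r. cnj (f r)"])
  then show ?thesis by (simp only: of_real_eq_iff)
qed

lemma column_oscillation:
  assumes "0 < y" "y < int n" and "0 \<le> x" "x < int n" "0 \<le> x'" "x' < int n"
  shows "(norm (f (x, y) - f (x', y)))\<^sup>2 \<le> real n * dirichlet n f"
  using row_oscillation[OF assms, of "\<lambda>r. f (prod.swap r)"] by (simp add: dirichlet_swap)

lemma norm_diff_triangle_square: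
  fixes a b c :: complex
  assumes "(norm (a - b))\<^sup>2 \<le> e" "(norm (b - c))\<^sup>2 \<le> e"
  shows "(norm (a - c))\<^sup>2 \<le> 4 * e"
proof -
  have "norm (a - c) \<le> norm (a - b) + norm (b - c)" by (rule norm_diff_triangle_le) auto
  also have "\<dots> \<le> sqrt e + sqrt e" using assms by (intro add_mono real_le_rsqrt)
  finally have "(norm (a - c))\<^sup>2 \<le> (2 * sqrt e)\<^sup>2" by (intro power_mono) auto
  moreover have "e \<ge> 0" using assms(1) zero_le_power2 order_trans by blast
  ultimately show ?thesis by (simp add: power_mult_distrib)
qed

text \<open>Every square is joined to \<open>(1, 1)\<close> by one row segment and one column
  segment that miss the hole; a square with first coordinate 0 must leave along its column first.
  Two triangle inequalities, each costing a factor 4, give 16.\<close>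

lemma oscillation:
  assumes n: "n \<ge> 2" and xy: "x \<in> holed n" "y \<in> holed n"
  shows "(norm (f x - f y))\<^sup>2 \<le> 16 * real n * dirichlet n f"
proof -
  have *: "(norm (f x - f (1, 1)))\<^sup>2 \<le> 4 * (real n * dirichlet n f)" if "x \<in> holed n" for x
  proof -
    obtain a b where x: "x = (a, b)" by (cases x)
    have r: "0 \<le> a" "a < int n" "0 \<le> b" "b < int n" "a \<noteq> 0 \<or> b \<noteq> 0"
      using that by (auto simp: x holed_def board_def)
    show ?thesis
    proof (cases "a = 0")
      case True
      have 1: "(norm (f (a, b) - f (1, b)))\<^sup>2 \<le> real n * dirichlet n f"
        using r n True by (intro column_oscillation) auto
      have 2: "(norm (f (1, b) - f (1, 1)))\<^sup>2 \<le> real n * dirichlet n f"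
        using r n True by (intro row_oscillation) auto
      show ?thesis unfolding x by (rule norm_diff_triangle_square[OF 1 2])
    next
      case False
      have 1: "(norm (f (a, b) - f (a, 1)))\<^sup>2 \<le> real n * dirichlet n f"
        using r n False by (intro row_oscillation) auto
      have 2: "(norm (f (a, 1) - f (1, 1)))\<^sup>2 \<le> real n * dirichlet n f"
        using r n False by (intro column_oscillation) auto
      show ?thesis unfolding x by (rule norm_diff_triangle_square[OF 1 2])
    qed
  qed
  show ?thesis
    using norm_diff_triangle_square[of "f x" "f (1, 1)" "4 * (real n * dirichlet n f)" "f y"]
      *[OF xy(1)] *[OF xy(2)] by (simp add: norm_minus_commute)
qed

section \<open>Spectral bounds and iteration\<close>

lemma hop_linear:
  "hop n k v (\<lambda>r. f r + g r) = (\<lambda>r. hop n k v f r + hop n k v g r)"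
  "hop n k v (\<lambda>r. f r - g r) = (\<lambda>r. hop n k v f r - hop n k v g r)"
  "hop n k v (\<lambda>r. c * f r) = (\<lambda>r. c * hop n k v f r)"
  by (simp_all add: hop_def fun_eq_iff algebra_simps)

lemma tagged_linear:
  "tagged n k (\<lambda>r. f r + g r) = (\<lambda>r. tagged n k f r + tagged n k g r)"
  "tagged n k (\<lambda>r. f r - g r) = (\<lambda>r. tagged n k f r - tagged n k g r)"
  "tagged n k (\<lambda>r. c * f r) = (\<lambda>r. c * tagged n k f r)"
  by (simp_all add: tagged_def hop_linear fun_eq_iff add_divide_distrib diff_divide_distrib algebra_simps)

lemma tagged_power_linear:
  "(tagged n k ^^ m) (\<lambda>r. f r + g r) = (\<lambda>r. (tagged n k ^^ m) f r + (tagged n k ^^ m) g r)"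
  "(tagged n k ^^ m) (\<lambda>r. f r - g r) = (\<lambda>r. (tagged n k ^^ m) f r - (tagged n k ^^ m) g r)"
  "(tagged n k ^^ m) (\<lambda>r. c * f r) = (\<lambda>r. c * (tagged n k ^^ m) f r)"
  by (induction m) (simp_all add: tagged_linear)

lemma energy_scale: "energy n k (\<lambda>r. c * f r) = (norm c)\<^sup>2 * energy n k f"
proof -
  have "nsq n (\<lambda>r. c * f r - c * hop n k v f r) = (norm c)\<^sup>2 * nsq n (\<lambda>r. f r - hop n k v f r)" for v
    unfolding right_diff_distrib[symmetric] by (rule nsq_scale)
  then show ?thesis by (simp add: energy_def hop_linear distrib_left)
qed

text \<open>The norm of a symmetric operator is its numerical radius, by polarization.\<close>

lemma nsq_tagged_le:
  assumes n: "n \<ge> 2" and \<rho>: "\<rho> > 0"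
    and W: "\<And>f g. f \<in> W \<Longrightarrow> g \<in> W \<Longrightarrow> (\<lambda>r. f r + g r) \<in> W"
      "\<And>f c. f \<in> W \<Longrightarrow> (\<lambda>r. of_real c * f r) \<in> W"
      "\<And>f. f \<in> W \<Longrightarrow> tagged n k f \<in> W"
    and bound: "\<And>f. f \<in> W \<Longrightarrow> \<bar>ip n f (tagged n k f)\<bar> \<le> \<rho> * nsq n f"
    and f: "f \<in> W"
  shows "nsq n (tagged n k f) \<le> \<rho>\<^sup>2 * nsq n f"
proof -
  let ?T = "tagged n k"
  \<comment> \<open>In this scaling the claim reads \<open>nsq n g \<le> nsq n f\<close>, and
    polarization of \<open>f + g\<close> and \<open>f - g\<close> bounds
    \<open>4 \<rho> nsq n g\<close> by \<open>2 \<rho> (nsq n f + nsq n g)\<close>.\<close>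
  define g where "g = (\<lambda>r. complex_of_real (1 / \<rho>) * ?T f r)"
  define s where "s = (\<lambda>r. f r + g r)"
  define d where "d = (\<lambda>r. f r + of_real (- 1) * g r)"
  have g: "g \<in> W" unfolding g_def using W f by blast
  have sW: "s \<in> W" "d \<in> W" unfolding s_def d_def using W f g by blast+
  have Ts: "?T s = (\<lambda>r. ?T f r + ?T g r)" "?T d = (\<lambda>r. ?T f r + of_real (- 1) * ?T g r)"
    unfolding s_def d_def tagged_linear by simp_all
  have sym: "ip n f (?T g) = ip n (?T f) g" by (rule tagged_symmetric[OF n, symmetric])
  have "ip n s (?T s) - ip n d (?T d) = 4 * ip n g (?T f)"
    unfolding Ts unfolding s_def d_def ip_simps using sym ip_commute[of n "?T f" g] by simp
  also have "\<dots> = 4 / \<rho> * nsq n (?T f)"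
    unfolding g_def ip_simps nsq_eq_ip by simp
  finally have 1: "4 / \<rho> * nsq n (?T f) = ip n s (?T s) - ip n d (?T d)" ..
  also have "\<dots> \<le> \<rho> * nsq n s + \<rho> * nsq n d"
    using bound[OF sW(1)] bound[OF sW(2)] by linarith
  also have "\<dots> = 2 * \<rho> * (nsq n f + nsq n g)"
    unfolding s_def d_def nsq_eq_ip ip_simps by (simp add: algebra_simps)
  also have "nsq n g = nsq n (?T f) / \<rho>\<^sup>2"
    unfolding g_def nsq_scale using \<rho> by (simp add: power_divide norm_divide)
  finally have "4 / \<rho> * nsq n (?T f) \<le> 2 * \<rho> * (nsq n f + nsq n (?T f) / \<rho>\<^sup>2)" .
  then have "\<rho> * (4 / \<rho> * nsq n (?T f)) \<le> \<rho> * (2 * \<rho> * (nsq n f + nsq n (?T f) / \<rho>\<^sup>2))"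
    using \<rho> by (intro mult_left_mono) auto
  then show ?thesis using \<rho> by (simp add: power2_eq_square distrib_left)
qed

lemma nsq_tagged_energy:
  assumes n: "n \<ge> 2" and \<Lambda>: "\<Lambda> \<ge> 3 / 5" "\<And>f. energy n k f \<ge> (1 - \<Lambda>) * nsq n f"
  shows "nsq n ((tagged n k ^^ m) f) \<le> (\<Lambda> ^ m)\<^sup>2 * nsq n f"
proof (induction m)
  case (Suc m)
  let ?g = "(tagged n k ^^ m) f"
  have "nsq n (tagged n k ?g) \<le> \<Lambda>\<^sup>2 * nsq n ?g"
  proof (rule nsq_tagged_le[OF n, where W = UNIV])
    fix f
    have "energy n k f \<le> 8 / 5 * nsq n f" by (rule energy_le[OF n])
    moreover have "3 / 5 * nsq n f \<le> \<Lambda> * nsq n f" using \<Lambda>(1) by (rule mult_right_mono) simp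
    ultimately show "\<bar>ip n f (tagged n k f)\<bar> \<le> \<Lambda> * nsq n f"
      unfolding ip_tagged_energy[OF n] using \<Lambda>(2)[of f] by (simp add: algebra_simps)
  qed (use \<Lambda> in auto)
  also have "\<dots> \<le> \<Lambda>\<^sup>2 * ((\<Lambda> ^ m)\<^sup>2 * nsq n f)" using Suc by (intro mult_left_mono) auto
  finally show ?case by (simp add: power_mult_distrib)
qed simp

lemma norm_le_nsq:
  assumes "r \<in> holed n" shows "(norm (f r))\<^sup>2 \<le> nsq n f"
  unfolding nsq_def using assms by (intro member_le_sum) auto

text \<open>A diamagnetic inequality: the triangle inequality removes the unimodular phases, and the
  walk at frequency 0 preserves the pointwise order.\<close>

lemma tagged_domination:
  assumes n: "n \<ge> 2" and fg: "\<And>r. r \<in> holed n \<Longrightarrow> norm (f r) \<le> Re (g r)" and r: "r \<in> holed n"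
  shows "norm ((tagged n k ^^ m) f r) \<le> Re ((tagged n (0, 0) ^^ m) g r)"
  using r
proof (induction m arbitrary: r)
  case 0
  then show ?case using fg by simp
next
  case (Suc m)
  let ?f = "(tagged n k ^^ m) f" and ?g = "(tagged n (0, 0) ^^ m) g"
  have z: "chr n (0, 0) r = 1" for r by (simp add: chr_def)
  have "norm (hop n k v ?f r) \<le> Re (hop n (0, 0) v ?g r)" if "v \<in> {(0, 1), (0, -1), (-1, 0), (1, 0)}" for v
  proof -
    have "jump n v r \<in> holed n"
      using jump_in_holed[OF _ unit_shift_nonzero[OF n that] Suc.prems] n by simp
    then show ?thesis using Suc.IH by (simp add: norm_hop) (simp add: hop_def z)
  qed
  then have "norm (hop n k (0, 1) ?f r) \<le> Re (hop n (0, 0) (0, 1) ?g r)"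
    "norm (hop n k (0, -1) ?f r) \<le> Re (hop n (0, 0) (0, -1) ?g r)"
    "norm (hop n k (-1, 0) ?f r) \<le> Re (hop n (0, 0) (-1, 0) ?g r)"
    "norm (hop n k (1, 0) ?f r) \<le> Re (hop n (0, 0) (1, 0) ?g r)" by simp_all
  moreover have "norm (?f r) \<le> Re (?g r)" by (rule Suc.IH[OF Suc.prems])
  moreover have b1: "norm (tagged n k ?f r) \<le> (norm (?f r) + norm (hop n k (0, 1) ?f r)
      + norm (hop n k (0, -1) ?f r) + norm (hop n k (-1, 0) ?f r) + norm (hop n k (1, 0) ?f r)) / 5"
    unfolding tagged_def norm_divide
    by (simp add: divide_right_mono norm_triangle_le add_mono norm_triangle_mono)
  ultimately have b2: "(norm (?f r) + norm (hop n k (0, 1) ?f r)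
      + norm (hop n k (0, -1) ?f r) + norm (hop n k (-1, 0) ?f r) + norm (hop n k (1, 0) ?f r)) / 5
      \<le> (Re (?g r) + Re (hop n (0, 0) (0, 1) ?g r)
      + Re (hop n (0, 0) (0, -1) ?g r) + Re (hop n (0, 0) (-1, 0) ?g r) + Re (hop n (0, 0) (1, 0) ?g r)) / 5"
    by (intro divide_right_mono add_mono) simp_all
  also have "\<dots> = Re (tagged n (0, 0) ?g r)"
    by (simp add: tagged_def)
  finally have "norm (tagged n k ?f r) \<le> Re (tagged n (0, 0) ?g r)"
    by (rule order_trans[OF b1])
  then show ?case by simp
qed

lemma tagged_const: "(tagged n (0, 0) ^^ m) (\<lambda>_. c) = (\<lambda>_. c)"
proof (induction m)
  case (Suc m)
  have "tagged n (0, 0) (\<lambda>_. c) = (\<lambda>_. c)"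
    by (simp add: tagged_def hop_def chr_def fun_eq_iff)
  then show ?case using Suc by simp
qed simp

lemma tagged_sup_bound:
  assumes "n \<ge> 2" "\<And>r. r \<in> holed n \<Longrightarrow> norm (f r) \<le> c" "r \<in> holed n"
  shows "norm ((tagged n k ^^ m) f r) \<le> c"
  using tagged_domination[where f = f and g = "\<lambda>_. of_real c" and n = n and r = r and k = k and m = m] assms by (simp add: tagged_const)

lemma sum_tagged:
  assumes n: "n \<ge> 2"
  shows "(\<Sum>r\<in>holed n. tagged n (0, 0) f r) = (\<Sum>r\<in>holed n. f r)"
proof -
  have "(\<Sum>r\<in>holed n. hop n (0, 0) v f r) = (\<Sum>r\<in>holed n. f r)"
    if "v \<in> {(0, 1), (0, -1), (-1, 0), (1, 0)}" for v
  proof -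
    have "hop n (0, 0) v f r = f (jump n v r)" for r by (simp add: hop_def chr_def)
    then show ?thesis
      using sum.reindex_bij_betw[OF bij_betw_jump[OF _ unit_shift_nonzero[OF n that]], of f] n by simp
  qed
  then show ?thesis
    by (simp add: tagged_def sum_divide_distrib[symmetric] sum.distrib)
qed

section \<open>Mixing of the walk and transfer to pointwise bounds\<close>

definition vol :: "nat \<Rightarrow> real" where
  "vol n = real (n\<^sup>2 - 1)"

context
  fixes n :: nat
  assumes n: "n \<ge> 2"
begin

lemma n_square_gt_1: "n\<^sup>2 > 1"
  using n by (intro one_less_power) auto

lemma vol_pos: "vol n > 0" "vol n \<le> real n ^ 2"
proof -
  have "real (n\<^sup>2) > 1" using n_square_gt_1 by (metis of_nat_1 of_nat_less_iff)
  then show "vol n > 0" "vol n \<le> real n ^ 2"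
    using n_square_gt_1 by (simp_all add: vol_def of_nat_diff)
qed

lemma card_holed_vol: "real (card (holed n)) = vol n"
  using card_holed[of n] n by (simp add: vol_def)

lemma holed_nonempty: "holed n \<noteq> {}"
  using card_holed_vol vol_pos by auto

lemma nsq_one: "nsq n (\<lambda>_. 1) = vol n"
  by (simp add: nsq_def card_holed_vol)

lemma nsq_le:
  assumes "\<And>r. r \<in> holed n \<Longrightarrow> (norm (f r))\<^sup>2 \<le> c"
  shows "nsq n f \<le> vol n * c"
  unfolding nsq_def using sum_bounded_above[of "holed n" "\<lambda>r. (norm (f r))\<^sup>2" c] assms
  by (simp add: card_holed_vol)

lemma oscillation_energy:
  "x \<in> holed n \<Longrightarrow> y \<in> holed n \<Longrightarrow> (norm (f x - f y))\<^sup>2 \<le> 80 * real n * energy n k f"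
  using oscillation[OF n, of x y f] mult_left_mono[OF dirichlet_le_energy[OF n, of f k], of "16 * real n"]
  by simp

text \<open>For mean zero, each value is an average of differences, which
  \<open>oscillation_energy\<close> bounds. The power 3 of n is good enough because it stays below
  the power 4 of the number of steps.\<close>

lemma poincare:
  assumes z: "(\<Sum>r\<in>holed n. f r) = 0"
  shows "nsq n f \<le> 80 * real n ^ 3 * energy n k f"
proof -
  define e where "e = 80 * real n * energy n k f"
  have e: "e \<ge> 0" using energy_nonneg by (simp add: e_def)
  have "(norm (f x))\<^sup>2 \<le> e" if x: "x \<in> holed n" for x
  proof -
    have "of_real (vol n) * f x = (\<Sum>y\<in>holed n. f x - f y)"
      using z by (simp add: sum_subtractf flip: card_holed_vol)
    then have "vol n * norm (f x) = norm (\<Sum>y\<in>holed n. f x - f y)"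
      using vol_pos by (metis abs_of_pos norm_mult norm_of_real)
    also have "\<dots> \<le> (\<Sum>y\<in>holed n. sqrt e)"
      using oscillation_energy[OF x, of _ f k] by (intro sum_norm_le real_le_rsqrt) (auto simp: e_def)
    also have "\<dots> = vol n * sqrt e" by (simp add: card_holed_vol)
    finally have "norm (f x) \<le> sqrt e" using vol_pos by simp
    then have "(norm (f x))\<^sup>2 \<le> (sqrt e)\<^sup>2" by (intro power_mono) auto
    then show ?thesis using e by simp
  qed
  then have "nsq n f \<le> vol n * e" by (rule nsq_le)
  also have "\<dots> \<le> real n ^ 2 * e" using vol_pos e by (intro mult_right_mono) auto
  finally show ?thesis by (simp add: e_def power3_eq_cube power2_eq_square mult_ac)
qed

definition mixing_rate :: real where
  "mixing_rate = 1 - 1 / (80 * real n ^ 3)"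

lemma mixing_rate_ge: "mixing_rate \<ge> 3 / 5"
proof -
  have "real n ^ 3 \<ge> 1" using n by simp
  then have "1 / (80 * real n ^ 3) \<le> 1 / 80" using n by (intro divide_left_mono) auto
  then show ?thesis by (simp add: mixing_rate_def)
qed

lemma nsq_tagged_mean_zero:
  assumes "(\<Sum>r\<in>holed n. f r) = 0"
  shows "nsq n ((tagged n (0, 0) ^^ m) f) \<le> (mixing_rate ^ m)\<^sup>2 * nsq n f
    \<and> (\<Sum>r\<in>holed n. (tagged n (0, 0) ^^ m) f r) = 0"
proof (induction m)
  case (Suc m)
  let ?T = "tagged n (0, 0)" and ?g = "(tagged n (0, 0) ^^ m) f"
  have "nsq n (?T ?g) \<le> mixing_rate\<^sup>2 * nsq n ?g"
  proof (rule nsq_tagged_le[OF n, where W = "{f. (\<Sum>r\<in>holed n. f r) = 0}"])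
    fix f :: "square \<Rightarrow> complex" assume "f \<in> {f. (\<Sum>r\<in>holed n. f r) = 0}"
    then have "nsq n f \<le> 80 * real n ^ 3 * energy n (0, 0) f" by (intro poincare) auto
    then have "energy n (0, 0) f \<ge> (1 - mixing_rate) * nsq n f"
      using n by (simp add: mixing_rate_def field_simps)
    moreover have "energy n (0, 0) f \<le> 8 / 5 * nsq n f" by (rule energy_le[OF n])
    moreover have "3 / 5 * nsq n f \<le> mixing_rate * nsq n f"
      using mixing_rate_ge by (rule mult_right_mono) simp
    ultimately show "\<bar>ip n f (?T f)\<bar> \<le> mixing_rate * nsq n f"
      unfolding ip_tagged_energy[OF n] by (simp add: algebra_simps)
  qed (use Suc mixing_rate_ge in \<open>auto simp: sum.distrib sum_tagged[OF n] simp flip: sum_distrib_left\<close>)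
  also have "\<dots> \<le> mixing_rate\<^sup>2 * ((mixing_rate ^ m)\<^sup>2 * nsq n f)"
    using Suc by (intro mult_left_mono) auto
  finally show ?case using Suc by (simp add: power_mult_distrib sum_tagged[OF n])
qed (use assms in simp)

text \<open>Dominate by the walk without phases started from the modulus of \<open>f\<close>. The
  mean of the modulus is invariant and at most \<open>sqrt (nsq n f / vol n)\<close> by
  Cauchy-Schwarz; the remainder has mean zero and decays at the mixing rate.\<close>

lemma tagged_mixing:
  assumes r: "r \<in> holed n"
  shows "norm ((tagged n k ^^ m) f r) \<le> sqrt (nsq n f) * (1 / sqrt (vol n) + mixing_rate ^ m)"
proof -
  define w where "w = (\<lambda>r. complex_of_real (norm (f r)))"
  define a where "a = (\<Sum>r\<in>holed n. norm (f r)) / vol n"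
  define u where "u = (\<lambda>r. w r - complex_of_real a)"
  have w: "w = (\<lambda>r. complex_of_real a + u r)" by (simp add: u_def)
  have sw: "(\<Sum>r\<in>holed n. norm (f r)) = vol n * a" using vol_pos by (simp add: a_def)
  have u0: "(\<Sum>r\<in>holed n. u r) = 0"
  proof -
    have "(\<Sum>r\<in>holed n. u r) = of_real (\<Sum>r\<in>holed n. norm (f r) - a)"
      by (simp add: u_def w_def)
    also have "(\<Sum>r\<in>holed n. norm (f r) - a) = 0"
      by (simp add: sum_subtractf sw card_holed_vol)
    finally show ?thesis by simp
  qed
  have "nsq n u = nsq n f - vol n * a\<^sup>2"
  proof -
    have "(norm (u r))\<^sup>2 = (norm (f r))\<^sup>2 - 2 * a * norm (f r) + a\<^sup>2" for r
      unfolding u_def w_def of_real_diff[symmetric] norm_of_real by (simp add: power2_eq_square algebra_simps)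
    then show ?thesis
      by (simp add: nsq_def sum.distrib sum_subtractf card_holed_vol sw power2_eq_square flip: sum_distrib_left)
  qed
  then have nu: "nsq n u \<le> nsq n f" "vol n * a\<^sup>2 \<le> nsq n f"
    using vol_pos nsq_nonneg[of n u] by (auto simp del: nsq_nonneg)
  have a: "a \<le> sqrt (nsq n f) / sqrt (vol n)"
    using nu(2) vol_pos unfolding real_sqrt_divide[symmetric] by (intro real_le_rsqrt) (simp add: field_simps)
  have "norm ((tagged n k ^^ m) f r) \<le> Re ((tagged n (0, 0) ^^ m) w r)"
    by (rule tagged_domination[OF n _ r]) (simp add: w_def)
  also have "\<dots> = a + Re ((tagged n (0, 0) ^^ m) u r)"
    unfolding w tagged_power_linear tagged_const by simp
  also have "Re ((tagged n (0, 0) ^^ m) u r) \<le> sqrt (nsq n ((tagged n (0, 0) ^^ m) u))"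
    using norm_le_nsq[OF r] complex_Re_le_cmod by (meson order_trans real_le_rsqrt)
  also have "\<dots> \<le> sqrt ((mixing_rate ^ m)\<^sup>2 * nsq n f)"
    using nsq_tagged_mean_zero[OF u0, of m] mult_left_mono[OF nu(1), of "(mixing_rate ^ m)\<^sup>2"]
    by (intro real_sqrt_le_mono) auto
  also have "\<dots> = mixing_rate ^ m * sqrt (nsq n f)"
    using mixing_rate_ge by (simp add: real_sqrt_mult)
  finally show ?thesis using a by (simp add: distrib_left mult.commute)
qed

text \<open>The last \<open>s\<close> steps mix and so turn the \<open>l\<^sup>2\<close> decay of the first \<open>j\<close> steps into a pointwise one
  without losing a power of \<open>n\<close>.\<close>

lemma tagged_one_decay:
  assumes \<Lambda>: "\<Lambda> \<ge> 3 / 5" "\<And>f. energy n k f \<ge> (1 - \<Lambda>) * nsq n f" and r: "r \<in> holed n"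
  shows "norm ((tagged n k ^^ (s + j)) (\<lambda>_. 1) r) \<le> \<Lambda> ^ j * (1 + real n * mixing_rate ^ s)"
proof -
  let ?u = "(tagged n k ^^ j) (\<lambda>_. 1)"
  have "nsq n ?u \<le> (\<Lambda> ^ j)\<^sup>2 * vol n"
    using nsq_tagged_energy[OF n \<Lambda>, of j "\<lambda>_. 1"] by (simp add: nsq_one)
  then have "sqrt (nsq n ?u) \<le> \<Lambda> ^ j * sqrt (vol n)"
    using \<Lambda>(1) real_sqrt_le_mono by (fastforce simp: real_sqrt_mult)
  moreover have "norm ((tagged n k ^^ (s + j)) (\<lambda>_. 1) r) \<le> sqrt (nsq n ?u) * (1 / sqrt (vol n) + mixing_rate ^ s)"
    using tagged_mixing[OF r, where f = ?u and m = s and k = k] by (simp add: funpow_add)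
  moreover have m0: "mixing_rate ^ s \<ge> 0" using mixing_rate_ge by simp
  ultimately have "norm ((tagged n k ^^ (s + j)) (\<lambda>_. 1) r) \<le> \<Lambda> ^ j * sqrt (vol n) * (1 / sqrt (vol n) + mixing_rate ^ s)"
    using vol_pos by (meson add_nonneg_nonneg divide_nonneg_nonneg mult_right_mono order_trans real_sqrt_ge_zero zero_le_one less_imp_le)
  also have "\<dots> = \<Lambda> ^ j * (1 + sqrt (vol n) * mixing_rate ^ s)"
    using vol_pos by (simp add: distrib_left)
  also have "sqrt (vol n) \<le> real n" using vol_pos by (intro real_le_lsqrt) auto
  finally show ?thesis using \<Lambda>(1) m0 by (simp add: mult_left_mono mult_right_mono)
qed

text \<open>Normalizing by mean square 1 makes the constant 1 admissible;
  \<open>1 - gap k / vol n\<close> is the top of the numerical range of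
  \<open>tagged n k\<close>.\<close>

definition gap :: "int \<times> int \<Rightarrow> real" where
  "gap k = Inf (energy n k ` {f. nsq n f = vol n})"

lemma gap_le: "nsq n f = vol n \<Longrightarrow> gap k \<le> energy n k f"
  unfolding gap_def by (intro cInf_lower bdd_belowI[of _ 0]) (auto simp: energy_nonneg)

lemma gap_ge:
  assumes "\<And>f. nsq n f = vol n \<Longrightarrow> c \<le> energy n k f"
  shows "c \<le> gap k"
  unfolding gap_def by (rule cInf_greatest) (use assms nsq_one in auto)

lemma gap_nonneg: "gap k \<ge> 0"
  by (rule gap_ge) (rule energy_nonneg)

lemma gap_approx:
  assumes "\<epsilon> > 0"
  obtains f where "nsq n f = vol n" "energy n k f < gap k + \<epsilon>"
proof -
  have "\<exists>x\<in>energy n k ` {f. nsq n f = vol n}. x < gap k + \<epsilon>"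
    unfolding gap_def using nsq_one assms by (intro cInf_lessD) auto
  then show ?thesis using that by auto
qed

lemma gap_energy: "gap k * nsq n f \<le> vol n * energy n k f"
proof (cases "nsq n f = 0")
  case True
  then show ?thesis using vol_pos energy_nonneg[of n k f] by simp
next
  case False
  then have p: "nsq n f > 0" using nsq_nonneg[of n f] by linarith
  define c where "c = sqrt (vol n / nsq n f)"
  have c: "(norm (complex_of_real c))\<^sup>2 = vol n / nsq n f" using p vol_pos by (simp add: c_def)
  have "nsq n (\<lambda>r. of_real c * f r) = vol n" unfolding nsq_scale c using p by simp
  then have "gap k \<le> energy n k (\<lambda>r. of_real c * f r)" by (rule gap_le)
  then show ?thesis unfolding energy_scale c using p by (simp add: field_simps)
qed

text \<open>The symmetric operator \<open>A = (1 - gap k / vol n) - tagged n k\<close> has its form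
  between 0 and 2, which forces \<open>nsq n (A f) \<le> 2 * ip n f (A f)\<close>. So an almost
  minimal energy means a small residual in the eigenvalue equation.\<close>

lemma near_minimizer:
  assumes f: "nsq n f = vol n" and e: "energy n k f \<le> gap k + \<epsilon>" and r: "r \<in> holed n"
  shows "norm (tagged n k f r - of_real (1 - gap k / vol n) * f r) \<le> sqrt (2 * \<epsilon>)"
proof -
  let ?T = "tagged n k" and ?l = "complex_of_real (1 - gap k / vol n)"
  define l where "l = ?l"
  define A where "A h = (\<lambda>r. l * h r - ?T h r)" for h
  have qA: "ip n h (A h) = energy n k h - gap k / vol n * nsq n h" for h
    unfolding A_def l_def ip_simps ip_tagged_energy[OF n] nsq_eq_ip[symmetric] by (simp add: algebra_simps)
  have pos: "ip n h (A h) \<ge> 0" for h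
    using gap_energy[of k h] vol_pos unfolding qA by (simp add: field_simps)
  have up: "ip n h (A h) \<le> 2 * nsq n h" for h
  proof -
    have "gap k / vol n * nsq n h \<ge> 0" using gap_nonneg vol_pos by simp
    then show ?thesis using energy_le[OF n, of k h] nsq_nonneg[of n h] unfolding qA by linarith
  qed
  have symA: "ip n (A g) h = ip n g (A h)" for g h
    unfolding A_def l_def ip_simps tagged_symmetric[OF n] ..
  have linA: "A (\<lambda>r. g r - of_real c * h r) = (\<lambda>r. A g r - of_real c * A h r)" for g h c
    by (simp add: A_def tagged_linear algebra_simps fun_eq_iff)
  define X where "X = nsq n (A f)"
  \<comment> \<open>Nonnegativity at \<open>f - A f / 2\<close> is the choice that makes the upper
    bound 2 on the form give the factor 2.\<close>
  have "0 \<le> ip n (\<lambda>r. f r - of_real (1 / 2) * A f r) (A (\<lambda>r. f r - of_real (1 / 2) * A f r))"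
    by (rule pos)
  also have "\<dots> = ip n f (A f) - X + 1 / 4 * ip n (A f) (A (A f))"
    unfolding linA ip_simps X_def nsq_eq_ip symA[of f "A f", symmetric] by simp
  also have "\<dots> \<le> ip n f (A f) - X / 2" using up[of "A f"] by (simp add: X_def)
  finally have "X \<le> 2 * ip n f (A f)" by simp
  also have "\<dots> \<le> 2 * \<epsilon>" using e f vol_pos unfolding qA by simp
  finally have "X \<le> 2 * \<epsilon>" .
  then have "(norm (A f r))\<^sup>2 \<le> 2 * \<epsilon>" using norm_le_nsq[OF r, of "A f"] by (simp add: X_def)
  then have "norm (A f r) \<le> sqrt (2 * \<epsilon>)" by (rule real_le_rsqrt)
  then show ?thesis by (simp add: A_def l_def norm_minus_commute)
qed

lemma gap_upper: "gap k / vol n \<le> 8 / 5"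
proof -
  have "gap k \<le> energy n k (\<lambda>_. 1)" by (rule gap_le[OF nsq_one])
  also have "\<dots> \<le> 8 / 5 * vol n" using energy_le[OF n, of k "\<lambda>_. 1"] by (simp add: nsq_one)
  finally show ?thesis using vol_pos by (simp add: divide_simps)
qed

text \<open>Arbitrarily good near-minimizers of the energy are near-eigenfunctions, so no eigenfunction is
  needed; they are also nearly constant, hence the constant function behaves like one of them.\<close>

lemma tagged_one_eigen:
  fixes \<delta> :: real
  assumes \<delta>: "0 < \<delta>" "\<delta> \<le> 1 / 2" and \<epsilon>: "\<epsilon> > 0"
    and osc: "\<And>f x y. nsq n f = vol n \<Longrightarrow> energy n k f \<le> gap k + \<epsilon> \<Longrightarrow> x \<in> holed n \<Longrightarrow> y \<in> holed n
      \<Longrightarrow> norm (f x - f y) \<le> \<delta>"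
    and r: "r \<in> holed n"
  shows "norm ((tagged n k ^^ m) (\<lambda>_. 1) r - of_real ((1 - gap k / vol n) ^ m)) \<le> 3 * \<delta>"
proof -
  define \<mu> where "\<mu> = 1 - gap k / vol n"
  have "gap k / vol n \<ge> 0" using gap_nonneg vol_pos by simp
  then have l1: "\<bar>\<mu>\<bar> \<le> 1" using gap_upper[of k] unfolding \<mu>_def by linarith
  \<comment> \<open>The residual is allowed to depend on the number of steps, so that
    \<open>m\<close> applications accumulate at most \<open>\<delta>\<close>, after the factor 2
    from dividing by \<open>w\<close>.\<close>
  define \<tau> where "\<tau> = \<delta> / (2 * (real m + 1))"
  have \<tau>: "\<tau> > 0" "2 * real m * \<tau> \<le> \<delta>" using \<delta> by (auto simp: \<tau>_def field_simps)
  have "min \<epsilon> (\<tau>\<^sup>2 / 2) > 0" using \<epsilon> \<tau> by simp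
  then obtain f where f: "nsq n f = vol n" "energy n k f < gap k + min \<epsilon> (\<tau>\<^sup>2 / 2)"
    by (rule gap_approx)
  have "energy n k f \<le> gap k + \<tau>\<^sup>2 / 2" using f(2) by linarith
  then have res: "norm (tagged n k f x - of_real \<mu> * f x) \<le> \<tau>" if "x \<in> holed n" for x
    using near_minimizer[OF f(1) _ that, of k "\<tau>\<^sup>2 / 2"] \<tau> by (simp add: \<mu>_def)
  have o: "norm (f x - f y) \<le> \<delta>" if "x \<in> holed n" "y \<in> holed n" for x y
    using osc[OF f(1) _ that] f(2) by simp
  define w where "w = f r"
  \<comment> \<open>Otherwise the small oscillation would keep the modulus below 1 at every square,
    against mean square 1.\<close>
  have w: "norm w \<ge> 1 / 2"
  proof (rule ccontr)
    assume "\<not> ?thesis"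
    then have "norm (f x) < 1" if "x \<in> holed n" for x
      using o[OF that r] \<delta> norm_triangle_sub[of "f x" w] unfolding w_def by linarith
    then have "(norm (f x))\<^sup>2 < 1" if "x \<in> holed n" for x
      using that by (simp add: power_less_one_iff)
    then have "nsq n f < (\<Sum>x\<in>holed n. 1)"
      unfolding nsq_def using holed_nonempty by (intro sum_strict_mono) auto
    then show False using f(1) card_holed_vol by simp
  qed
  then have w0: "w \<noteq> 0" by auto
  \<comment> \<open>Normalized to be exactly 1 at the square \<open>r\<close> where the claim is
    made.\<close>
  define \<psi> where "\<psi> = (\<lambda>x. inverse w * f x)"
  have iw: "norm (inverse w) \<le> 2" using le_imp_inverse_le[OF w] by (simp add: norm_inverse)
  have close: "norm (1 - \<psi> x) \<le> 2 * \<delta>" if "x \<in> holed n" for x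
  proof -
    have "1 - \<psi> x = inverse w * (f r - f x)" using w0 by (simp add: \<psi>_def w_def algebra_simps)
    then have "norm (1 - \<psi> x) = norm (inverse w) * norm (f r - f x)" by (simp only: norm_mult)
    also have "\<dots> \<le> 2 * \<delta>" using iw o[OF r that] by (intro mult_mono) auto
    finally show ?thesis .
  qed
  have res': "norm (tagged n k \<psi> x - of_real \<mu> * \<psi> x) \<le> 2 * \<tau>" if "x \<in> holed n" for x
  proof -
    have "tagged n k \<psi> x - of_real \<mu> * \<psi> x = inverse w * (tagged n k f x - of_real \<mu> * f x)"
      unfolding \<psi>_def tagged_linear by (simp add: algebra_simps)
    then have "norm (tagged n k \<psi> x - of_real \<mu> * \<psi> x)
        = norm (inverse w) * norm (tagged n k f x - of_real \<mu> * f x)" by (simp only: norm_mult)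
    also have "\<dots> \<le> 2 * \<tau>" using iw res[OF that] by (intro mult_mono) auto
    finally show ?thesis .
  qed
  \<comment> \<open>Residuals add up linearly: the operator is a contraction in the supremum norm,
    and \<open>\<bar>\<mu>\<bar> \<le> 1\<close>.\<close>
  have iter: "norm ((tagged n k ^^ j) \<psi> x - of_real (\<mu> ^ j) * \<psi> x) \<le> real j * (2 * \<tau>)" if "x \<in> holed n" for j x
    using that
  proof (induction j arbitrary: x)
    case (Suc j)
    define d where "d = (\<lambda>x. (tagged n k ^^ j) \<psi> x - of_real (\<mu> ^ j) * \<psi> x)"
    have "(tagged n k ^^ Suc j) \<psi> x - of_real (\<mu> ^ Suc j) * \<psi> x
        = tagged n k d x + of_real (\<mu> ^ j) * (tagged n k \<psi> x - of_real \<mu> * \<psi> x)"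
      unfolding d_def tagged_linear by (simp add: algebra_simps)
    also have "norm \<dots> \<le> real j * (2 * \<tau>) + 1 * (2 * \<tau>)"
    proof (rule norm_triangle_mono)
      show "norm (tagged n k d x) \<le> real j * (2 * \<tau>)"
        using tagged_sup_bound[OF n, where f = d and c = "real j * (2 * \<tau>)" and r = x and k = k and m = 1] Suc.IH Suc.prems by (simp add: d_def)
      have "\<bar>\<mu>\<bar> ^ j \<le> 1" using l1 by (simp add: power_le_one)
      then show "norm (of_real (\<mu> ^ j) * (tagged n k \<psi> x - of_real \<mu> * \<psi> x)) \<le> 1 * (2 * \<tau>)"
        unfolding norm_mult using res'[OF Suc.prems] by (intro mult_mono) (auto simp: norm_power power_abs)
    qed
    finally show ?case by (simp add: algebra_simps)
  qed simp
  have "(tagged n k ^^ m) (\<lambda>_. 1) r - of_real (\<mu> ^ m)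
      = (tagged n k ^^ m) (\<lambda>x. 1 - \<psi> x) r + ((tagged n k ^^ m) \<psi> r - of_real (\<mu> ^ m) * \<psi> r)"
    unfolding tagged_power_linear using w0 by (simp add: \<psi>_def w_def)
  also have "norm \<dots> \<le> 2 * \<delta> + real m * (2 * \<tau>)"
    by (intro norm_triangle_mono tagged_sup_bound[OF n] close iter r)
  also have "\<dots> \<le> 3 * \<delta>" using \<tau> by simp
  finally show ?thesis by (simp add: \<mu>_def)
qed

text \<open>The slack \<open>1 / n^2\<close> in the energy has the order expected of the gap at a
  fixed frequency, so it leaves the oscillation bound of the same order.\<close>

lemma tagged_one_asymptotics:
  assumes \<delta>: "\<delta> = sqrt (80 * real n * (gap k + 1 / real n ^ 2))" "\<delta> \<le> 1 / 2" and r: "r \<in> holed n"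
  shows "norm ((tagged n k ^^ m) (\<lambda>_. 1) r - of_real ((1 - gap k / vol n) ^ m)) \<le> 3 * \<delta>"
proof (rule tagged_one_eigen[OF _ \<delta>(2) _ _ r])
  have g: "gap k + 1 / real n ^ 2 > 0" using gap_nonneg[of k] n by (simp add: add_nonneg_pos)
  show "0 < \<delta>" using g n by (simp add: \<delta>(1))
  show "0 < 1 / real n ^ 2" using n by simp
  fix f x y assume f: "energy n k f \<le> gap k + 1 / real n ^ 2" "x \<in> holed n" "y \<in> holed n"
  have "(norm (f x - f y))\<^sup>2 \<le> 80 * real n * energy n k f"
    by (rule oscillation_energy[OF f(2,3)])
  also have "\<dots> \<le> 80 * real n * (gap k + 1 / real n ^ 2)" using f(1) by (intro mult_left_mono) auto
  finally show "norm (f x - f y) \<le> \<delta>" unfolding \<delta>(1) by (rule real_le_rsqrt)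
qed

text \<open>A dichotomy that is uniform in the frequency. Either the function oscillates by half its
  root mean square, and the oscillation bound alone gives \<open>1 / (320 n)\<close>; or its squared
  modulus is at least a quarter of the mean square everywhere, in particular next to the hole, where
  \<open>energy_ge\<close> applies.\<close>

lemma energy_ge_nsq:
  assumes h: "0 < dipole_height n" "dipole_height n < 1"
  shows "energy n k f \<ge> min (1 / (320 * real n))
     (conductance n / 20 * ((norm (1 - root1 n (- fst k)))\<^sup>2 + (norm (1 - root1 n (- snd k)))\<^sup>2)) * (nsq n f / vol n)"
    (is "_ \<ge> min ?a ?b * _")
proof -
  define M where "M = nsq n f / vol n"
  have M: "M \<ge> 0" using vol_pos by (simp add: M_def)
  have c0: "conductance n \<ge> 0" using h by (simp add: conductance_def)
  have "\<exists>x\<in>holed n. (norm (f x))\<^sup>2 \<ge> M"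
  proof (rule ccontr)
    assume "\<not> ?thesis"
    then have "(norm (f x))\<^sup>2 < M" if "x \<in> holed n" for x using that by force
    then have "nsq n f < (\<Sum>x\<in>holed n. M)"
      unfolding nsq_def using holed_nonempty by (intro sum_strict_mono) auto
    then show False using vol_pos card_holed_vol by (simp add: M_def)
  qed
  then obtain x where x: "x \<in> holed n" "(norm (f x))\<^sup>2 \<ge> M" by blast
  show ?thesis
  proof (cases "16 * real n * dirichlet n f \<ge> M / 4")
    case True
    then have "16 * real n * (5 * energy n k f) \<ge> M / 4"
      using mult_left_mono[OF dirichlet_le_energy[OF n, of f k], of "16 * real n"] by simp
    then have "?a * M \<le> energy n k f" using n by (simp add: field_simps)
    moreover have "min ?a ?b * M \<le> ?a * M" using M by (intro mult_right_mono) auto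
    ultimately show ?thesis by (simp add: M_def)
  next
    case False
    have lb: "(norm (f y))\<^sup>2 \<ge> M / 4" if y: "y \<in> holed n" for y
    proof -
      have "(norm (f x - f y))\<^sup>2 \<le> M / 4" using oscillation[OF n x(1) y, of f] False by simp
      then have "norm (f x - f y) \<le> sqrt (M / 4)" by (rule real_le_rsqrt)
      moreover have "sqrt M \<le> norm (f x)" by (rule real_le_lsqrt[OF norm_ge_zero x(2)])
      moreover have "norm (f x) \<le> norm (f y) + norm (f x - f y)" by (rule norm_triangle_sub)
      ultimately have "sqrt M / 2 \<le> norm (f y)" by (simp add: real_sqrt_divide)
      then have "(sqrt M / 2)\<^sup>2 \<le> (norm (f y))\<^sup>2" using M by (intro power_mono) auto
      then show ?thesis using M by (simp add: power_divide)
    qed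
    have "(1, 0) \<in> holed n" "(0, 1) \<in> holed n" using n by (auto simp: holed_def board_def)
    then have "(norm (1 - root1 n (- fst k)))\<^sup>2 * (M / 4) + (norm (1 - root1 n (- snd k)))\<^sup>2 * (M / 4)
       \<le> (norm (1 - root1 n (- fst k)))\<^sup>2 * (norm (f (1, 0)))\<^sup>2 + (norm (1 - root1 n (- snd k)))\<^sup>2 * (norm (f (0, 1)))\<^sup>2"
      using lb by (intro add_mono mult_left_mono) auto
    then have "conductance n * ((norm (1 - root1 n (- fst k)))\<^sup>2 * (M / 4) + (norm (1 - root1 n (- snd k)))\<^sup>2 * (M / 4)) \<le> 5 * energy n k f"
      using energy_ge[OF n h, of k f] mult_left_mono[OF _ c0] by (meson order_trans)
    then have "?b * M \<le> energy n k f" by (simp add: field_simps)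
    moreover have "min ?a ?b * M \<le> ?b * M" using M by (intro mult_right_mono) auto
    ultimately show ?thesis by (simp add: M_def)
  qed
qed

lemma gap_le_trial:
  "gap k \<le> energy n k (trial n b1 b2)"
proof -
  have "nsq n (trial n b1 b2) \<ge> vol n" using nsq_trial[of n b1 b2] n by (simp add: vol_def)
  then have "gap k * vol n \<le> gap k * nsq n (trial n b1 b2)" using gap_nonneg by (intro mult_left_mono)
  also have "\<dots> \<le> vol n * energy n k (trial n b1 b2)" by (rule gap_energy)
  finally show ?thesis using vol_pos by simp
qed

text \<open>A minimizer is nearly constant, so the bound by the energy at the four neighbours of the
  hole is sharp to leading order.\<close>

lemma gap_ge_conductance:
  assumes h: "0 < dipole_height n" "dipole_height n < 1"
    and \<delta>: "\<delta> = sqrt (80 * real n * (gap k + 1 / real n ^ 2))" "\<delta> \<le> 1"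
  shows "5 * gap k \<ge> conductance n * (1 - \<delta>)\<^sup>2 *
    ((norm (1 - root1 n (- fst k)))\<^sup>2 + (norm (1 - root1 n (- snd k)))\<^sup>2)"
    (is "_ \<ge> ?c * (1 - \<delta>)\<^sup>2 * ?s")
proof (rule field_le_epsilon)
  fix e :: real assume e: "e > 0"
  have "min (e / 5) (1 / real n ^ 2) > 0" using e n by simp
  then obtain f where f: "nsq n f = vol n" "energy n k f < gap k + min (e / 5) (1 / real n ^ 2)"
    by (rule gap_approx)
  have c0: "?c \<ge> 0" using h by (simp add: conductance_def)
  have o: "norm (f x - f y) \<le> \<delta>" if "x \<in> holed n" "y \<in> holed n" for x y
  proof -
    have "(norm (f x - f y))\<^sup>2 \<le> 80 * real n * energy n k f"
      by (rule oscillation_energy[OF that])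
    also have "\<dots> \<le> 80 * real n * (gap k + 1 / real n ^ 2)" using f(2) by (intro mult_left_mono) auto
    finally show ?thesis unfolding \<delta>(1) by (rule real_le_rsqrt)
  qed
  have lb: "(norm (f y))\<^sup>2 \<ge> (1 - \<delta>)\<^sup>2" if y: "y \<in> holed n" for y
  proof (rule power_mono)
    show "1 - \<delta> \<le> norm (f y)"
    proof (rule ccontr)
      assume "\<not> ?thesis"
      then have "norm (f x) < 1" if "x \<in> holed n" for x
        using o[OF that y] norm_triangle_sub[of "f x" "f y"] by linarith
      then have "(norm (f x))\<^sup>2 < 1" if "x \<in> holed n" for x
        using that by (simp add: power_less_one_iff)
      then have "nsq n f < (\<Sum>x\<in>holed n. 1)"
        unfolding nsq_def using holed_nonempty by (intro sum_strict_mono) auto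
      then show False using f(1) card_holed_vol by simp
    qed
  qed (use \<delta> in simp)
  have "(1, 0) \<in> holed n" "(0, 1) \<in> holed n" using n by (auto simp: holed_def board_def)
  then have "(norm (1 - root1 n (- fst k)))\<^sup>2 * (1 - \<delta>)\<^sup>2 + (norm (1 - root1 n (- snd k)))\<^sup>2 * (1 - \<delta>)\<^sup>2
     \<le> (norm (1 - root1 n (- fst k)))\<^sup>2 * (norm (f (1, 0)))\<^sup>2 + (norm (1 - root1 n (- snd k)))\<^sup>2 * (norm (f (0, 1)))\<^sup>2"
    using lb by (intro add_mono mult_left_mono) auto
  then have "?c * ((norm (1 - root1 n (- fst k)))\<^sup>2 * (1 - \<delta>)\<^sup>2 + (norm (1 - root1 n (- snd k)))\<^sup>2 * (1 - \<delta>)\<^sup>2) \<le> 5 * energy n k f"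
    using energy_ge[OF n h, of k f] mult_left_mono[OF _ c0] by (meson order_trans)
  then have "?c * (1 - \<delta>)\<^sup>2 * ?s \<le> 5 * energy n k f" by (simp add: algebra_simps)
  also have "\<dots> \<le> 5 * gap k + e" using f(2) by simp
  finally show "?c * (1 - \<delta>)\<^sup>2 * ?s \<le> 5 * gap k + e" .
qed

end

section \<open>Fourier coefficients of the position of the piece\<close>

definition rel_pos :: "nat \<Rightarrow> square \<Rightarrow> square \<Rightarrow> square" where
  "rel_pos n a y = shift n (- y) a"

lemma shift_origin: "y \<in> board n \<Longrightarrow> shift n y (0, 0) = y"
  by (auto simp: shift_def board_def)

lemma rel_pos_eq_origin:
  assumes "a \<in> board n" "y \<in> board n"
  shows "rel_pos n a y = (0, 0) \<longleftrightarrow> a = y"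
proof
  assume "rel_pos n a y = (0, 0)"
  then have "shift n y (shift n (- y) a) = y" using shift_origin[OF assms(2)] by (simp add: rel_pos_def)
  then show "a = y" using assms by simp
next
  assume "a = y"
  then show "rel_pos n a y = (0, 0)"
    using shift_uminus(2)[of "(0, 0)" n y] shift_origin[OF assms(2)] assms(2)
    by (auto simp: rel_pos_def shift_def)
qed

lemma rel_pos_in_holed:
  "n > 0 \<Longrightarrow> a \<in> board n \<Longrightarrow> y \<in> board n \<Longrightarrow> a \<noteq> y \<Longrightarrow> rel_pos n a y \<in> holed n"
  using rel_pos_eq_origin[of a n y] by (simp add: holed_def) (simp add: rel_pos_def)

text \<open>The class of observables that the chain preserves: a character of the position of the
  piece times any function of the relative position of the hole. One step of the chain acts on
  \<open>g\<close> alone.\<close>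

definition wave :: "nat \<Rightarrow> int \<times> int \<Rightarrow> nat \<Rightarrow> (square \<Rightarrow> complex) \<Rightarrow> config \<Rightarrow> complex" where
  "wave n k p g s = chr n k (s p) * g (rel_pos n (s 0) (s p))"

lemma wave_move:
  assumes n: "n > 0" and s: "s 0 \<in> board n" "s p \<in> board n" "s 0 \<noteq> s p"
  shows "wave n k p g (move_empty n v s) = chr n k (s p) * hop n k v g (rel_pos n (s 0) (s p))"
proof -
  let ?a = "s 0" and ?y = "s p"
  let ?b = "shift n v ?a" and ?r = "rel_pos n ?a ?y"
  have b: "?b \<in> board n" using n by simp
  have rb: "shift n v ?r = rel_pos n ?b ?y"
    by (simp add: rel_pos_def shift_shift add.commute)
  have s0: "move_empty n v s 0 = ?b" by (simp add: move_empty_def)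
  show ?thesis
  proof (cases "?b = ?y")
    case True
    have sp: "move_empty n v s p = ?a" using True by (simp add: move_empty_def)
    have rr: "rel_pos n ?b ?a = shift n v (0, 0)"
    proof -
      have "rel_pos n ?b ?a = shift n v (rel_pos n ?a ?a)"
        by (simp add: rel_pos_def shift_shift add.commute)
      then show ?thesis using rel_pos_eq_origin[OF s(1) s(1)] by simp
    qed
    have "chr n k ?y * chr n k ?r = chr n k ?a"
    proof -
      have "shift n ?y ?r = ?a" using s by (simp add: rel_pos_def)
      then show ?thesis using chr_shift[OF n, of k ?y ?r] by simp
    qed
    moreover have "shift n v ?r = (0, 0)" unfolding rb using rel_pos_eq_origin[OF b s(2)] True by simp
    ultimately show ?thesis
      unfolding wave_def s0 sp rr by (simp add: hop_def jump_def)
  next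
    case False
    have sp: "move_empty n v s p = ?y"
      using False s(3) by (simp add: move_empty_def transpose_apply_other)
    have "shift n v ?r \<noteq> (0, 0)" unfolding rb using rel_pos_eq_origin[OF b s(2)] False by simp
    then show ?thesis
      unfolding wave_def s0 sp by (simp add: hop_def jump_def rb)
  qed
qed

lemma finite_puzzle_step: "finite (set_pmf (puzzle_step n s))"
  by (simp add: puzzle_step_def set_pmf_of_set)

lemma finite_puzzle_chain: "finite (set_pmf (puzzle_chain n m))"
  by (induction m) (simp_all add: finite_puzzle_step)

lemma puzzle_chain_invariant:
  assumes n: "n \<ge> 2" and p: "p \<in> {1..n\<^sup>2 - 1}" and s: "s \<in> set_pmf (puzzle_chain n m)"
  shows "s 0 \<in> board n \<and> s p \<in> board n \<and> s 0 \<noteq> s p"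
  using s
proof (induction m arbitrary: s)
  case 0
  \<comment> \<open>Labels start at 1, so \<open>p - 1\<close> is at most \<open>n^2 - 2\<close> and
    misses the last square, where the hole starts.\<close>
  have "p - 1 < n * n - 1" using p by (auto simp: power2_eq_square)
  then have "(p - 1) div n < n" "(p - 1) mod n < n"
    using n by (auto simp: less_mult_imp_div_less)
  moreover have "int n - 1 \<noteq> int ((p - 1) div n) \<or> int n - 1 \<noteq> int ((p - 1) mod n)"
  proof (rule ccontr)
    assume "\<not> ?thesis"
    then have "(p - 1) div n = n - 1" "(p - 1) mod n = n - 1" by auto
    then have "p - 1 = (n - 1) * n + (n - 1)" by (metis div_mult_mod_eq)
    moreover have "(n - 1) * n + (n - 1) = n * n - 1" using n by (simp add: algebra_simps diff_mult_distrib)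
    ultimately show False using \<open>p - 1 < n * n - 1\<close> by simp
  qed
  ultimately show ?case using 0 n p by (auto simp: initial_config_def board_def)
next
  case (Suc m)
  then obtain u where u: "u \<in> set_pmf (puzzle_chain n m)" "s \<in> set_pmf (puzzle_step n u)" by auto
  then obtain v where v: "s = move_empty n v u" by (auto simp: puzzle_step_def)
  note IH = Suc.IH[OF u(1)]
  have "shift n v (u 0) \<in> board n" using n by simp
  moreover have "s 0 \<noteq> s p"
    unfolding v move_empty_def using IH by (metis comp_apply transpose_eq_iff)
  ultimately show ?case
    using IH unfolding v move_empty_def by (auto simp: Transposition.transpose_def)
qed

lemma expectation_wave_step:
  assumes n: "n > 0" and s: "s 0 \<in> board n" "s p \<in> board n" "s 0 \<noteq> s p"
  shows "measure_pmf.expectation (puzzle_step n s) (wave n k p g) = wave n k p (tagged n k g) s"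
proof -
  let ?D = "{(0, 0), (0, 1), (0, -1), (-1, 0), (1, 0)} :: (int \<times> int) set"
  let ?r = "rel_pos n (s 0) (s p)"
  have r: "?r \<in> holed n" by (rule rel_pos_in_holed[OF n s])
  \<comment> \<open>Staying is the hop by 0: the relative position is off the origin, so it triggers
    no jump.\<close>
  then have "hop n k (0, 0) g ?r = g ?r"
    using shift_0[of ?r n] by (simp add: hop_def jump_def holed_def zero_prod_def)
  have "measure_pmf.expectation (puzzle_step n s) (wave n k p g)
      = measure_pmf.expectation (pmf_of_set ?D) (\<lambda>v. wave n k p g (move_empty n v s))"
    by (simp add: puzzle_step_def)
  also have "\<dots> = (\<Sum>v\<in>?D. pmf (pmf_of_set ?D) v *\<^sub>R wave n k p g (move_empty n v s))"
    by (rule integral_measure_pmf) (auto simp: set_pmf_of_set)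
  also have "\<dots> = (\<Sum>v\<in>?D. (1 / 5) *\<^sub>R (chr n k (s p) * hop n k v g ?r))"
    by (intro sum.cong refl) (simp add: wave_move[OF assms])
  also have "\<dots> = chr n k (s p) * tagged n k g ?r"
    using \<open>hop n k (0, 0) g ?r = g ?r\<close>
    by (simp add: tagged_def scaleR_conv_of_real algebra_simps add_divide_distrib)
  finally show ?thesis by (simp add: wave_def)
qed

text \<open>The chain is built by appending steps, so the last step is averaged first, and the
  induction must hold for every \<open>g\<close>.\<close>

lemma expectation_wave:
  assumes n: "n \<ge> 2" and p: "p \<in> {1..n\<^sup>2 - 1}"
  shows "measure_pmf.expectation (puzzle_chain n m) (wave n k p g)
    = wave n k p ((tagged n k ^^ m) g) (initial_config n)"
proof (induction m arbitrary: g)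
  case (Suc m)
  let ?A = "set_pmf (puzzle_chain n m)"
  have "measure_pmf.expectation (puzzle_chain n (Suc m)) (wave n k p g)
      = (\<Sum>s\<in>?A. pmf (puzzle_chain n m) s *\<^sub>R measure_pmf.expectation (puzzle_step n s) (wave n k p g))"
    unfolding puzzle_chain.simps
    by (rule pmf_expectation_bind) (auto simp: finite_puzzle_chain finite_puzzle_step)
  also have "\<dots> = (\<Sum>s\<in>?A. pmf (puzzle_chain n m) s *\<^sub>R wave n k p (tagged n k g) s)"
    using puzzle_chain_invariant[OF n p] n
    by (intro sum.cong refl) (simp add: expectation_wave_step)
  also have "\<dots> = measure_pmf.expectation (puzzle_chain n m) (wave n k p (tagged n k g))"
    by (rule integral_measure_pmf[symmetric]) (auto simp: finite_puzzle_chain)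
  finally show ?case by (simp add: Suc.IH funpow_swap1)
qed simp

lemma piece_law_in_board:
  assumes "n \<ge> 2" "p \<in> {1..n\<^sup>2 - 1}"
  shows "set_pmf (piece_law n p m) \<subseteq> board n"
  using puzzle_chain_invariant[OF assms] by (auto simp: piece_law_def)

lemma piece_law_fourier:
  assumes n: "n \<ge> 2" and p: "p \<in> {1..n\<^sup>2 - 1}"
  defines "y \<equiv> initial_config n p" and "a \<equiv> initial_config n 0"
  shows "(\<Sum>x\<in>board n. of_real (pmf (piece_law n p m) x) * chr n k x)
    = chr n k y * (tagged n k ^^ m) (\<lambda>_. 1) (rel_pos n a y)"
proof -
  have "(\<Sum>x\<in>board n. of_real (pmf (piece_law n p m) x) * chr n k x)
      = (\<Sum>x\<in>board n. pmf (piece_law n p m) x *\<^sub>R chr n k x)"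
    by (simp add: scaleR_conv_of_real)
  also have "\<dots> = measure_pmf.expectation (piece_law n p m) (chr n k)"
    using piece_law_in_board[OF n p, of m] by (intro integral_measure_pmf[symmetric]) auto
  also have "\<dots> = measure_pmf.expectation (puzzle_chain n m) (wave n k p (\<lambda>_. 1))"
    by (simp add: piece_law_def wave_def[abs_def])
  also have "\<dots> = wave n k p ((tagged n k ^^ m) (\<lambda>_. 1)) (initial_config n)"
    by (rule expectation_wave[OF n p])
  finally show ?thesis by (simp add: wave_def y_def a_def)
qed

lemma initial_rel_pos:
  assumes "n \<ge> 2" "p \<in> {1..n\<^sup>2 - 1}"
  shows "initial_config n p \<in> board n" "rel_pos n (initial_config n 0) (initial_config n p) \<in> holed n"
  using puzzle_chain_invariant[OF assms, of "initial_config n" 0] assms rel_pos_in_holed by auto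

section \<open>Asymptotics of the leading eigenvalue\<close>

lemma pi_gt_2: "pi > 2"
  using pi_gt3 by simp

lemma eventually_dipole_height:
  "\<forall>\<^sub>F n in sequentially. 2 \<le> n \<and> 0 < dipole_height n \<and> dipole_height n < 1"
proof -
  have "1 - 2 / pi > 0" "1 - 2 / pi < 1" using pi_gt_2 by (simp_all add: field_simps)
  then have "\<forall>\<^sub>F n in sequentially. 0 < dipole_height n" "\<forall>\<^sub>F n in sequentially. dipole_height n < 1"
    using order_tendstoD[OF dipole_height_tendsto] by blast+
  then show ?thesis using eventually_ge_at_top[of 2] by eventually_elim auto
qed

lemma conductance_tendsto: "conductance \<longlonglongrightarrow> 1 / (pi - 1)"
proof -
  have "1 + (1 - 2 / pi) \<noteq> 0" using pi_gt_2 by (simp add: field_simps)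
  then have "(\<lambda>n. (1 - dipole_height n) / (1 + dipole_height n)) \<longlonglongrightarrow> (1 - (1 - 2 / pi)) / (1 + (1 - 2 / pi))"
    by (intro tendsto_intros dipole_height_tendsto)
  moreover have "(1 - (1 - 2 / pi)) / (1 + (1 - 2 / pi)) = 1 / (pi - 1)"
    using pi_gt_2 by (simp add: field_simps)
  ultimately show ?thesis by (simp add: conductance_def[abs_def])
qed

lemma scaled_sin_tendsto: "(\<lambda>n. real n * sin (a / real n)) \<longlonglongrightarrow> a"
proof (cases "a = 0")
  case False
  have 0: "(\<lambda>n. a / real n) \<longlonglongrightarrow> 0" by (rule lim_const_over_n)
  have "filterlim (\<lambda>n. a / real n) (at 0) sequentially"
    unfolding filterlim_at using 0 False by (auto intro!: eventually_sequentiallyI[of 1])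
  then have "(\<lambda>n. sin (a / real n) / (a / real n)) \<longlonglongrightarrow> 1"
    by (rule filterlim_compose[rotated]) (use DERIV_sin[of "0::real"] in \<open>simp add: DERIV_def\<close>)
  then have "(\<lambda>n. a * (sin (a / real n) / (a / real n))) \<longlonglongrightarrow> a * 1" by (intro tendsto_intros)
  then show ?thesis using False by (simp add: field_simps)
qed simp

lemma norm_one_minus_root1: "(norm (1 - root1 n (- j)))\<^sup>2 = 4 * (sin (pi * of_int j / real n))\<^sup>2"
  using norm_phase_difference[of 0 "2 * pi * of_int j / real n"] by (simp add: root1_def)

definition rate :: "int \<times> int \<Rightarrow> real" where
  "rate k = 4 * pi\<^sup>2 * ((of_int (fst k))\<^sup>2 + (of_int (snd k))\<^sup>2) / (5 * (pi - 1))"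

lemma gap_upper_limit:
  obtains U where "\<forall>\<^sub>F n in sequentially. real n ^ 2 * gap n k \<le> U n" "U \<longlonglongrightarrow> rate k"
proof -
  define \<eta> where "\<eta> = 1 - 2 / pi"
  have \<eta>: "1 + \<eta> \<noteq> 0" using pi_gt_2 by (simp add: \<eta>_def field_simps)
  \<comment> \<open>the minimizer of \<open>2 h (1 - h) b\<^sup>2 + 4 (s - b h)\<^sup>2\<close> in \<open>b\<close>\<close>
  define \<beta> where "\<beta> j n = 2 * sin (pi * of_int j / real n) / (1 + dipole_height n)" for j :: int and n
  define b where "b j n = real n * \<beta> j n" for j n
  define s where "s j n = real n * sin (pi * of_int j / real n)" for j :: int and n
  define U where "U n = (2 * dipole_height n * (1 - dipole_height n) * ((b (fst k) n)\<^sup>2 + (b (snd k) n)\<^sup>2)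
    + 4 * (s (fst k) n - b (fst k) n * dipole_height n * cos (pi * of_int (fst k) / real n))\<^sup>2
    + 4 * (s (snd k) n - b (snd k) n * dipole_height n * cos (pi * of_int (snd k) / real n))\<^sup>2) / 5" for n
  have "real n ^ 2 * gap n k \<le> U n" if n: "n \<ge> 2" for n
  proof -
    have "U n = real n ^ 2 * energy n k (trial n (\<beta> (fst k) n) (\<beta> (snd k) n))"
    proof -
      have "5 * (real n ^ 2 * energy n k (trial n (\<beta> (fst k) n) (\<beta> (snd k) n)))
          = real n ^ 2 * (5 * energy n k (trial n (\<beta> (fst k) n) (\<beta> (snd k) n)))" by simp
      also have "\<dots> = 5 * U n"
        unfolding energy_trial[OF n] U_def b_def s_def by (simp add: algebra_simps power2_eq_square)
      finally show ?thesis by simp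
    qed
    then show ?thesis using gap_le_trial[OF n, of k] by (simp add: mult_left_mono)
  qed
  then have 1: "\<forall>\<^sub>F n in sequentially. real n ^ 2 * gap n k \<le> U n"
    by (intro eventually_sequentiallyI[of 2])
  have ht: "dipole_height \<longlonglongrightarrow> \<eta>" using dipole_height_tendsto by (simp add: \<eta>_def)
  have st: "s j \<longlonglongrightarrow> pi * of_int j" for j
    unfolding s_def[abs_def] by (rule scaled_sin_tendsto)
  have bt: "b j \<longlonglongrightarrow> 2 * (pi * of_int j) / (1 + \<eta>)" for j
  proof -
    have "(\<lambda>n. 2 * s j n / (1 + dipole_height n)) \<longlonglongrightarrow> 2 * (pi * of_int j) / (1 + \<eta>)"
      using \<eta> by (intro tendsto_intros st ht)
    then show ?thesis by (simp add: b_def[abs_def] \<beta>_def s_def mult_ac)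
  qed
  have ct: "(\<lambda>n. cos (pi * of_int j / real n)) \<longlonglongrightarrow> 1" for j :: int
    using tendsto_cos[OF lim_const_over_n[of "pi * of_int j"]] by simp
  have "U \<longlonglongrightarrow> (2 * \<eta> * (1 - \<eta>) * ((2 * (pi * of_int (fst k)) / (1 + \<eta>))\<^sup>2 + (2 * (pi * of_int (snd k)) / (1 + \<eta>))\<^sup>2)
    + 4 * (pi * of_int (fst k) - 2 * (pi * of_int (fst k)) / (1 + \<eta>) * \<eta> * 1)\<^sup>2
    + 4 * (pi * of_int (snd k) - 2 * (pi * of_int (snd k)) / (1 + \<eta>) * \<eta> * 1)\<^sup>2) / 5" (is "_ \<longlonglongrightarrow> ?L")
    unfolding U_def[abs_def] by (intro tendsto_intros bt st ht ct) auto
  moreover have "?L = rate k"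
  proof -
    have e: "2 * \<eta> * (1 - \<eta>) * (2 * x / (1 + \<eta>))\<^sup>2 + 4 * (x - 2 * x / (1 + \<eta>) * \<eta> * 1)\<^sup>2
        = 4 * x\<^sup>2 * (1 / (pi - 1))" for x
    proof -
      have "x - 2 * x / (1 + \<eta>) * \<eta> * 1 = x * ((1 - \<eta>) / (1 + \<eta>))" using \<eta> by (simp add: field_simps)
      then have "2 * \<eta> * (1 - \<eta>) * (2 * x / (1 + \<eta>))\<^sup>2 + 4 * (x - 2 * x / (1 + \<eta>) * \<eta> * 1)\<^sup>2
        = (4 * x\<^sup>2 * (2 * \<eta> * (1 - \<eta>)) + 4 * x\<^sup>2 * (1 - \<eta>)\<^sup>2) / (1 + \<eta>)\<^sup>2"
        by (simp add: power_mult_distrib power_divide add_divide_distrib mult_ac)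
      also have "4 * x\<^sup>2 * (2 * \<eta> * (1 - \<eta>)) + 4 * x\<^sup>2 * (1 - \<eta>)\<^sup>2 = 4 * x\<^sup>2 * ((1 - \<eta>) * (1 + \<eta>))"
        by (simp add: power2_eq_square algebra_simps)
      also have "\<dots> / (1 + \<eta>)\<^sup>2 = 4 * x\<^sup>2 * ((1 - \<eta>) / (1 + \<eta>))"
        using \<eta> by (simp add: power2_eq_square)
      also have "(1 - \<eta>) / (1 + \<eta>) = 1 / (pi - 1)"
        using pi_gt_2 by (simp add: \<eta>_def field_simps)
      finally show ?thesis .
    qed
    have "?L = (4 * (pi * of_int (fst k))\<^sup>2 * (1 / (pi - 1)) + 4 * (pi * of_int (snd k))\<^sup>2 * (1 / (pi - 1))) / 5"
      unfolding e[symmetric] by (simp only: distrib_left add_ac)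
    also have "\<dots> = 4 * ((pi * of_int (fst k))\<^sup>2 + (pi * of_int (snd k))\<^sup>2) / (5 * (pi - 1))"
      by (simp add: add_divide_distrib distrib_left mult.commute)
    also have "\<dots> = rate k"
      by (simp add: rate_def power_mult_distrib flip: distrib_left)
    finally show ?thesis .
  qed
  ultimately show ?thesis using 1 that by simp
qed

text \<open>Bound on the oscillation of any function whose energy exceeds the gap by at most
  \<open>1 / n^2\<close>.\<close>

definition flatness :: "nat \<Rightarrow> int \<times> int \<Rightarrow> real" where
  "flatness n k = sqrt (80 * real n * (gap n k + 1 / real n ^ 2))"

text \<open>Only the upper bound on the gap enters here, so the sharp lower bound in
  \<open>gap_tendsto\<close> may rely on this without circularity.\<close>

lemma flatness_tendsto: "(\<lambda>n. flatness n k) \<longlonglongrightarrow> 0"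
proof -
  obtain U where U: "\<forall>\<^sub>F n in sequentially. real n ^ 2 * gap n k \<le> U n" "U \<longlonglongrightarrow> rate k"
    by (rule gap_upper_limit)
  have "(\<lambda>n. 80 * (U n * (1 / real n) + 1 / real n)) \<longlonglongrightarrow> 80 * (rate k * 0 + 0)"
    by (intro tendsto_intros U(2) lim_const_over_n)
  then have V: "(\<lambda>n. sqrt (80 * (U n * (1 / real n) + 1 / real n))) \<longlonglongrightarrow> 0"
    using tendsto_real_sqrt by fastforce
  show ?thesis
  proof (rule tendsto_sandwich[OF _ _ tendsto_const V])
    show "\<forall>\<^sub>F n in sequentially. 0 \<le> flatness n k"
      using eventually_ge_at_top[of 2] by eventually_elim (simp add: flatness_def gap_nonneg)
    show "\<forall>\<^sub>F n in sequentially. flatness n k \<le> sqrt (80 * (U n * (1 / real n) + 1 / real n))"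
      using U(1) eventually_ge_at_top[of 2]
    proof eventually_elim
      case (elim n)
      have "real n * gap n k = real n ^ 2 * gap n k * (1 / real n)"
        using elim by (simp add: power2_eq_square)
      also have "\<dots> \<le> U n * (1 / real n)" using elim by (intro mult_right_mono) auto
      finally have "real n * gap n k \<le> U n * (1 / real n)" .
      moreover have "real n * (1 / real n ^ 2) = 1 / real n" using elim by (simp add: power2_eq_square)
      ultimately have "80 * real n * (gap n k + 1 / real n ^ 2) \<le> 80 * (U n * (1 / real n) + 1 / real n)"
        by (simp add: distrib_left)
      then show ?case unfolding flatness_def by (rule real_sqrt_le_mono)
    qed
  qed
qed

lemma gap_tendsto: "(\<lambda>n. real n ^ 2 * gap n k) \<longlonglongrightarrow> rate k"
proof -
  obtain U where U: "\<forall>\<^sub>F n in sequentially. real n ^ 2 * gap n k \<le> U n" "U \<longlonglongrightarrow> rate k"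
    by (rule gap_upper_limit)
  define s where "s j n = real n * sin (pi * of_int j / real n)" for j :: int and n
  define L where "L n = conductance n * (1 - flatness n k)\<^sup>2 * (4 * (s (fst k) n)\<^sup>2 + 4 * (s (snd k) n)\<^sup>2) / 5" for n
  have st: "s j \<longlonglongrightarrow> pi * of_int j" for j
    unfolding s_def[abs_def] by (rule scaled_sin_tendsto)
  have "L \<longlonglongrightarrow> 1 / (pi - 1) * (1 - 0)\<^sup>2 * (4 * (pi * of_int (fst k))\<^sup>2 + 4 * (pi * of_int (snd k))\<^sup>2) / 5"
    unfolding L_def[abs_def] by (intro tendsto_intros conductance_tendsto flatness_tendsto st) auto
  moreover have "1 / (pi - 1) * (1 - 0)\<^sup>2 * (4 * (pi * of_int (fst k))\<^sup>2 + 4 * (pi * of_int (snd k))\<^sup>2) / 5 = rate k"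
    using pi_gt_2 by (simp add: rate_def power_mult_distrib field_simps)
  ultimately have L: "L \<longlonglongrightarrow> rate k" by simp
  have f1: "\<forall>\<^sub>F n in sequentially. flatness n k < 1"
    using order_tendstoD(2)[OF flatness_tendsto] by simp
  have "\<forall>\<^sub>F n in sequentially. L n \<le> real n ^ 2 * gap n k"
    using eventually_dipole_height f1
  proof eventually_elim
    case (elim n)
    then have "conductance n * (1 - flatness n k)\<^sup>2 * (4 * (sin (pi * of_int (fst k) / real n))\<^sup>2
        + 4 * (sin (pi * of_int (snd k) / real n))\<^sup>2) \<le> 5 * gap n k"
      using gap_ge_conductance[of n "flatness n k" k] by (simp add: flatness_def norm_one_minus_root1)
    then have "real n ^ 2 * (conductance n * (1 - flatness n k)\<^sup>2 * (4 * (sin (pi * of_int (fst k) / real n))\<^sup>2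
        + 4 * (sin (pi * of_int (snd k) / real n))\<^sup>2)) \<le> real n ^ 2 * (5 * gap n k)"
      by (intro mult_left_mono) auto
    then show ?case unfolding L_def s_def by (simp add: power_mult_distrib algebra_simps)
  qed
  then show ?thesis by (rule tendsto_sandwich[OF _ U(1) L U(2)])
qed

section \<open>The time scale and the decay of a fixed frequency\<close>

definition steps :: "nat \<Rightarrow> real \<Rightarrow> nat" where
  "steps n t = nat \<lfloor>c_puz * real n ^ 4 * t\<rfloor>"

lemma c_puz_ge: "c_puz \<ge> 5"
  using pi_gt3 by (simp add: c_puz_def)

lemma steps_bounds:
  assumes "t \<ge> 0"
  shows "real (steps n t) \<le> c_puz * real n ^ 4 * t" "c_puz * real n ^ 4 * t - 1 \<le> real (steps n t)"
proof -
  have "c_puz * real n ^ 4 * t \<ge> 0" using c_puz_ge assms by simp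
  then have "real (steps n t) = of_int \<lfloor>c_puz * real n ^ 4 * t\<rfloor>" by (simp add: steps_def)
  then show "real (steps n t) \<le> c_puz * real n ^ 4 * t" "c_puz * real n ^ 4 * t - 1 \<le> real (steps n t)"
    by linarith+
qed

text \<open>The Fourier coefficient at \<open>k\<close> of Brownian motion on the torus at time
  \<open>t\<close>.\<close>

definition heat :: "real \<Rightarrow> int \<times> int \<Rightarrow> real" where
  "heat t k = exp (- 2 * pi\<^sup>2 * ((of_int (fst k))\<^sup>2 + (of_int (snd k))\<^sup>2) * t)"

lemma abs_exp_diff_le:
  fixes a b :: real assumes "a \<le> 0" "b \<le> 0" shows "\<bar>exp a - exp b\<bar> \<le> \<bar>a - b\<bar>"
proof -
  have *: "exp b - exp a \<le> b - a" if "a \<le> b" "b \<le> 0" for a b :: real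
  proof -
    have "1 - exp (a - b) \<le> b - a" using exp_ge_add_one_self[of "a - b"] by linarith
    then have "exp b * (1 - exp (a - b)) \<le> 1 * (b - a)"
      using that by (intro mult_mono) auto
    then show ?thesis by (simp add: right_diff_distrib exp_diff)
  qed
  show ?thesis using *[of a b] *[of b a] assms by (cases "a \<le> b") auto
qed

text \<open>The times form an arbitrary bounded sequence, so the result is a vanishing difference
  instead of a limit; this is what later yields uniformity in time.\<close>

lemma eigenvalue_power_tendsto:
  fixes t :: "nat \<Rightarrow> real"
  assumes t: "\<And>n. 0 \<le> t n" "\<And>n. t n \<le> t1"
  shows "(\<lambda>n. (1 - gap n k / vol n) ^ steps n (t n) - heat (t n) k) \<longlonglongrightarrow> 0"
proof -
  define x where "x n = gap n k / vol n" for n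
  define m where "m n = real (steps n (t n))" for n
  have xt: "(\<lambda>n. real n ^ 4 * x n) \<longlonglongrightarrow> rate k"
  proof -
    have "(\<lambda>n. (real n ^ 2 * gap n k) / (1 - (1 / real n) * (1 / real n))) \<longlonglongrightarrow> rate k / (1 - 0 * 0)"
      by (intro tendsto_intros gap_tendsto lim_const_over_n) simp
    moreover have "\<forall>\<^sub>F n in sequentially. (real n ^ 2 * gap n k) / (1 - (1 / real n) * (1 / real n)) = real n ^ 4 * x n"
      using eventually_ge_at_top[of 2]
    proof eventually_elim
      case (elim n)
      have "vol n = real n ^ 2 * (1 - (1 / real n) * (1 / real n))"
        using elim n_square_gt_1[of n] by (simp add: vol_def of_nat_diff field_simps power2_eq_square)
      then show ?case using elim by (simp add: x_def power2_eq_square power4_eq_xxxx)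
    qed
    ultimately show ?thesis by (auto elim: Lim_transform_eventually)
  qed
  have i4: "(\<lambda>n. 1 / real n ^ 4) \<longlonglongrightarrow> 0"
    using tendsto_power[OF lim_const_over_n[of 1], of 4] by (simp add: power_divide)
  have x0: "x \<longlonglongrightarrow> 0"
  proof -
    have "(\<lambda>n. (real n ^ 4 * x n) * (1 / real n ^ 4)) \<longlonglongrightarrow> rate k * 0"
      by (intro tendsto_intros xt i4)
    moreover have "\<forall>\<^sub>F n in sequentially. (real n ^ 4 * x n) * (1 / real n ^ 4) = x n"
      using eventually_ge_at_top[of 2] by eventually_elim simp
    ultimately show ?thesis by (auto elim: Lim_transform_eventually)
  qed
  have xn: "\<forall>\<^sub>F n in sequentially. 0 \<le> x n"
    using eventually_ge_at_top[of 2] by eventually_elim (simp add: x_def gap_nonneg vol_pos(1) less_imp_le)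
  \<comment> \<open>The origin of \<open>c_puz\<close>: the factor \<open>pi - 1\<close> of the rate
    cancels and the exponent of \<open>heat\<close> remains.\<close>
  have cr: "c_puz * rate k = 2 * pi\<^sup>2 * ((of_int (fst k))\<^sup>2 + (of_int (snd k))\<^sup>2)"
    using pi_gt_2 by (simp add: c_puz_def rate_def field_simps)
  have tb: "\<bar>t n\<bar> \<le> t1" for n using t[of n] by simp
  have t1: "t1 \<ge> 0" using t[of 0] by linarith
  have d1: "(\<lambda>n. m n * x n - c_puz * rate k * t n) \<longlonglongrightarrow> 0"
  proof (rule Lim_null_comparison)
    show "\<forall>\<^sub>F n in sequentially. norm (m n * x n - c_puz * rate k * t n) \<le> \<bar>x n\<bar> + c_puz * t1 * \<bar>real n ^ 4 * x n - rate k\<bar>"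
    proof (intro always_eventually allI)
      fix n
      have "m n * x n - c_puz * rate k * t n = (m n - c_puz * real n ^ 4 * t n) * x n + c_puz * t n * (real n ^ 4 * x n - rate k)"
        by (simp add: algebra_simps)
      also have "\<bar>\<dots>\<bar> \<le> \<bar>m n - c_puz * real n ^ 4 * t n\<bar> * \<bar>x n\<bar> + c_puz * t n * \<bar>real n ^ 4 * x n - rate k\<bar>"
        using c_puz_ge t[of n] by (intro order_trans[OF abs_triangle_ineq]) (simp add: abs_mult)
      also have "\<dots> \<le> 1 * \<bar>x n\<bar> + c_puz * t1 * \<bar>real n ^ 4 * x n - rate k\<bar>"
        using steps_bounds[OF t(1)[of n], of n] c_puz_ge t[of n]
        by (intro add_mono mult_right_mono mult_left_mono) (auto simp: m_def abs_le_iff)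
      finally show "norm (m n * x n - c_puz * rate k * t n) \<le> \<bar>x n\<bar> + c_puz * t1 * \<bar>real n ^ 4 * x n - rate k\<bar>"
        by simp
    qed
    have "(\<lambda>n. \<bar>x n\<bar> + c_puz * t1 * \<bar>real n ^ 4 * x n - rate k\<bar>) \<longlonglongrightarrow> \<bar>0\<bar> + c_puz * t1 * \<bar>rate k - rate k\<bar>"
      by (intro tendsto_intros x0 xt)
    then show "(\<lambda>n. \<bar>x n\<bar> + c_puz * t1 * \<bar>real n ^ 4 * x n - rate k\<bar>) \<longlonglongrightarrow> 0" by simp
  qed
  have "(\<lambda>n. (\<bar>m n * x n - c_puz * rate k * t n\<bar> + 2 * (c_puz * t1) * (real n ^ 4 * x n) * x n)) \<longlonglongrightarrow> \<bar>0\<bar> + 2 * (c_puz * t1) * rate k * 0"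
    by (intro tendsto_intros d1 xt x0)
  then have E: "(\<lambda>n. (\<bar>m n * x n - c_puz * rate k * t n\<bar> + 2 * (c_puz * t1) * (real n ^ 4 * x n) * x n)) \<longlonglongrightarrow> 0" by simp
  have xh: "\<forall>\<^sub>F n in sequentially. x n < 1 / 2" using order_tendstoD(2)[OF x0, of "1 / 2"] by simp
  show ?thesis
  proof (rule Lim_null_comparison[OF _ E])
    show "\<forall>\<^sub>F n in sequentially. norm ((1 - gap n k / vol n) ^ steps n (t n) - heat (t n) k)
        \<le> \<bar>m n * x n - c_puz * rate k * t n\<bar> + 2 * (c_puz * t1) * (real n ^ 4 * x n) * x n"
      using xn xh
    proof eventually_elim
      case (elim n)
      have "(1 - x n) ^ steps n (t n) = exp (m n * ln (1 - x n))"
        using elim by (simp add: m_def exp_of_nat_mult)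
      moreover have h: "heat (t n) k = exp (- (c_puz * rate k * t n))"
        unfolding cr by (simp add: heat_def)
      have m0: "m n \<ge> 0" by (simp add: m_def)
      \<comment> \<open>The quadratic error is negligible: the number of steps times
        \<open>x^2\<close> is at most a constant times \<open>(n^4 x) * x\<close>, where the first
        factor converges and the second vanishes.\<close>
      have l: "ln (1 - x n) \<le> - x n" "- x n - 2 * (x n)\<^sup>2 \<le> ln (1 - x n)"
        using ln_one_minus_pos_upper_bound[of "x n"] ln_one_minus_pos_lower_bound[of "x n"] elim by auto
      have ml: "m n * ln (1 - x n) \<le> m n * (- x n)" "m n * (- x n - 2 * (x n)\<^sup>2) \<le> m n * ln (1 - x n)"
        using l m0 by (intro mult_left_mono; simp)+
      have mle: "m n \<le> c_puz * t1 * real n ^ 4"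
      proof -
        have "m n \<le> c_puz * real n ^ 4 * t n" using steps_bounds(1)[OF t(1)] by (simp add: m_def)
        also have "\<dots> \<le> c_puz * real n ^ 4 * t1" using t c_puz_ge by (intro mult_left_mono) auto
        finally show ?thesis by (simp add: mult_ac)
      qed
      have "m n * (2 * (x n)\<^sup>2) \<le> (c_puz * t1 * real n ^ 4) * (2 * (x n)\<^sup>2)"
        using mle by (intro mult_right_mono) auto
      then have b: "\<bar>m n * ln (1 - x n) + c_puz * rate k * t n\<bar>
          \<le> \<bar>m n * x n - c_puz * rate k * t n\<bar> + 2 * (c_puz * t1) * (real n ^ 4 * x n) * x n"
        using ml by (simp add: algebra_simps power2_eq_square abs_le_iff) linarith
      have neg: "m n * ln (1 - x n) \<le> 0" using ml(1) m0 elim by (simp add: order_trans mult_nonneg_nonneg)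
      have neg': "- (c_puz * rate k * t n) \<le> 0" unfolding cr using t(1)[of n] by simp
      have "\<bar>exp (m n * ln (1 - x n)) - heat (t n) k\<bar> \<le> \<bar>m n * ln (1 - x n) + c_puz * rate k * t n\<bar>"
        unfolding h using abs_exp_diff_le[OF neg neg'] by simp
      then show ?case using b \<open>(1 - x n) ^ steps n (t n) = _\<close> by (simp add: x_def)
    qed
  qed
qed

lemma tagged_one_tendsto:
  fixes t :: "nat \<Rightarrow> real"
  assumes t: "\<And>n. 0 \<le> t n" "\<And>n. t n \<le> t1" and r: "\<And>n. n \<ge> 2 \<Longrightarrow> r n \<in> holed n"
  shows "(\<lambda>n. (tagged n k ^^ steps n (t n)) (\<lambda>_. 1) (r n) - of_real (heat (t n) k)) \<longlonglongrightarrow> 0"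
proof (rule Lim_null_comparison)
  let ?m = "\<lambda>n. steps n (t n)"
  have "(\<lambda>n. 3 * flatness n k + \<bar>(1 - gap n k / vol n) ^ ?m n - heat (t n) k\<bar>) \<longlonglongrightarrow> 3 * 0 + \<bar>0\<bar>"
    by (intro tendsto_intros flatness_tendsto eigenvalue_power_tendsto[OF t])
  then show "(\<lambda>n. 3 * flatness n k + \<bar>(1 - gap n k / vol n) ^ ?m n - heat (t n) k\<bar>) \<longlonglongrightarrow> 0" by simp
  have f1: "\<forall>\<^sub>F n in sequentially. flatness n k < 1 / 2"
    using order_tendstoD(2)[OF flatness_tendsto, of "1 / 2"] by simp
  show "\<forall>\<^sub>F n in sequentially. norm ((tagged n k ^^ ?m n) (\<lambda>_. 1) (r n) - of_real (heat (t n) k))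
      \<le> 3 * flatness n k + \<bar>(1 - gap n k / vol n) ^ ?m n - heat (t n) k\<bar>"
    using f1 eventually_ge_at_top[of 2]
  proof eventually_elim
    case (elim n)
    have "norm ((tagged n k ^^ ?m n) (\<lambda>_. 1) (r n) - of_real ((1 - gap n k / vol n) ^ ?m n)) \<le> 3 * flatness n k"
      using tagged_one_asymptotics[of n "flatness n k" k "r n" "?m n"] elim r by (simp add: flatness_def)
    moreover have "norm (of_real ((1 - gap n k / vol n) ^ ?m n) - complex_of_real (heat (t n) k))
        = \<bar>(1 - gap n k / vol n) ^ ?m n - heat (t n) k\<bar>"
      unfolding of_real_diff[symmetric] norm_of_real ..
    ultimately show ?case using norm_diff_triangle_le by fastforce
  qed
qed

lemma half_le_sin:
  assumes "0 \<le> u" "u \<le> pi / 2"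
  shows "u / 2 \<le> sin u"
proof -
  define v where "v = u / 2"
  have v: "0 \<le> v" "v \<le> pi / 4" using assms by (auto simp: v_def)
  have c: "cos (pi / 4) \<le> cos w" if "0 \<le> w" "w \<le> v" for w
    using that v pi_gt_zero by (intro cos_monotone_0_pi_le) auto
  have c2: "(cos (pi / 4))\<^sup>2 = 1 / (2::real)" by (simp add: cos_45 power_divide)
  have s: "v * cos (pi / 4) \<le> sin v"
  proof (cases "v = 0")
    case False
    then have "0 < v" using v by simp
    from MVT2[OF this, of sin cos] obtain z where z: "0 < z" "z < v" "sin v - sin 0 = (v - 0) * cos z"
      by (auto simp: DERIV_sin)
    then show ?thesis using c[of z] v by (simp add: mult_left_mono)
  qed simp
  have p: "cos (pi / 4) \<ge> (0::real)" by (simp add: cos_45)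
  then have "0 \<le> v * cos (pi / 4)" using v by simp
  then have "sin v \<ge> 0" using s by linarith
  have "u / 2 = 2 * (v * cos (pi / 4) * cos (pi / 4))"
    using c2 by (simp add: v_def power2_eq_square)
  also have "\<dots> \<le> 2 * (sin v * cos v)"
    using s c[of v] v p \<open>sin v \<ge> 0\<close> by (intro mult_left_mono mult_mono) auto
  also have "\<dots> = sin u" using sin_double[of v] by (simp add: v_def)
  finally show ?thesis .
qed

lemma sin_frequency_ge:
  assumes "n > 0" "2 * \<bar>j\<bar> \<le> int n"
  shows "(sin (pi * of_int j / real n))\<^sup>2 \<ge> 2 * (of_int j)\<^sup>2 / real n ^ 2"
proof -
  let ?u = "pi * of_int \<bar>j\<bar> / real n"
  have "2 * real_of_int \<bar>j\<bar> \<le> real n" using assms(2) by linarith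
  then have "pi * (2 * of_int \<bar>j\<bar>) \<le> pi * real n" by (rule mult_left_mono) simp
  then have "?u / 2 \<le> sin ?u" using assms by (intro half_le_sin) (auto simp: field_simps)
  then have "(?u / 2)\<^sup>2 \<le> (sin ?u)\<^sup>2" using assms by (intro power_mono) auto
  moreover have "(sin ?u)\<^sup>2 = (sin (pi * of_int j / real n))\<^sup>2" by (cases "j \<ge> 0") auto
  moreover have "2 * (of_int j)\<^sup>2 / real n ^ 2 \<le> (?u / 2)\<^sup>2"
  proof -
    have "3 * 3 \<le> pi * pi" using pi_gt3 by (intro mult_mono) auto
    then have "8 * ((of_int j)\<^sup>2 / real n ^ 2) \<le> pi\<^sup>2 * ((of_int j)\<^sup>2 / real n ^ 2)"
      by (intro mult_right_mono) (auto simp: power2_eq_square)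
    moreover have "(?u / 2)\<^sup>2 = pi\<^sup>2 * ((of_int j)\<^sup>2 / real n ^ 2) / 4"
      by (simp add: power_mult_distrib power_divide)
    ultimately show ?thesis by simp
  qed
  ultimately show ?thesis by linarith
qed

section \<open>Decay at high frequencies\<close>

lemma one_minus_power_le_exp:
  fixes x :: real assumes "x \<le> 1"
  shows "(1 - x) ^ j \<le> exp (- (real j * x))"
proof -
  have "(1 - x) ^ j \<le> exp (- x) ^ j"
    using exp_ge_add_one_self[of "- x"] assms by (intro power_mono) auto
  then show ?thesis by (simp add: exp_of_nat_mult[symmetric])
qed

lemma abs_le_square_int: "\<bar>x\<bar> \<le> (x::int)\<^sup>2"
proof (cases "x = 0")
  case False
  then have "\<bar>x\<bar> * 1 \<le> \<bar>x\<bar> * \<bar>x\<bar>" by (intro mult_left_mono) auto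
  then show ?thesis by (simp add: power2_eq_square)
qed simp

lemma energy_ge_frequency:
  assumes n: "n \<ge> 2" and h: "0 < dipole_height n" "dipole_height n < 1" and c: "conductance n \<ge> 1 / 4"
    and k: "2 * \<bar>fst k\<bar> \<le> int n" "2 * \<bar>snd k\<bar> \<le> int n"
  defines "w \<equiv> (of_int (fst k))\<^sup>2 + (of_int (snd k))\<^sup>2 :: real"
  shows "energy n k f \<ge> min (1 / real n) (w / real n ^ 2) / 320 / real n ^ 2 * nsq n f"
proof -
  let ?s = "(norm (1 - root1 n (- fst k)))\<^sup>2 + (norm (1 - root1 n (- snd k)))\<^sup>2"
  have n0: "n > 0" using n by simp
  have s: "?s \<ge> 8 * (w / real n ^ 2)"
    using sin_frequency_ge[OF n0 k(1)] sin_frequency_ge[OF n0 k(2)]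
    unfolding norm_one_minus_root1 by (simp add: w_def add_divide_distrib)
  have w0: "w / real n ^ 2 \<ge> 0" by (simp add: w_def)
  have "1 / 4 / 20 * (8 * (w / real n ^ 2)) \<le> conductance n / 20 * ?s"
    using s c w0 by (intro mult_mono) auto
  moreover have "w / real n ^ 2 / 320 \<le> 1 / 4 / 20 * (8 * (w / real n ^ 2))" using w0 by simp
  ultimately have "w / real n ^ 2 / 320 \<le> conductance n / 20 * ?s" by (rule order_trans[rotated])
  moreover have "1 / real n / 320 = 1 / (320 * real n)" by simp
  ultimately have m: "min (1 / real n) (w / real n ^ 2) / 320 \<le> min (1 / (320 * real n)) (conductance n / 20 * ?s)"
    by (auto simp: min_def)
  have p: "min (1 / real n) (w / real n ^ 2) / 320 \<ge> 0" using w0 by simp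
  have "min (1 / real n) (w / real n ^ 2) / 320 / real n ^ 2 * nsq n f
      = min (1 / real n) (w / real n ^ 2) / 320 * (nsq n f / real n ^ 2)" by simp
  also have "\<dots> \<le> min (1 / (320 * real n)) (conductance n / 20 * ?s) * (nsq n f / vol n)"
  proof (rule mult_mono[OF m])
    have "0 < real n ^ 2 * vol n" using n vol_pos[OF n] by simp
    then show "nsq n f / real n ^ 2 \<le> nsq n f / vol n"
      using vol_pos[OF n] by (intro divide_left_mono) auto
  qed (use order_trans[OF p m] in auto)
  also have "\<dots> \<le> energy n k f" by (rule energy_ge_nsq[OF n h])
  finally show ?thesis .
qed

text \<open>Half of the steps mix, the other half decay. The decay exponent is
  \<open>t0 / 160 * min n w\<close>, with \<open>w\<close> the squared length of the frequency: the
  regime \<open>w > n\<close> leaves \<open>exp (- c n)\<close>, which survives summation over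
  \<open>n^2\<close> frequencies, and the other one leaves a geometric weight.\<close>

lemma tail_estimate:
  assumes n: "n \<ge> 2" and h: "0 < dipole_height n" "dipole_height n < 1" and c: "conductance n \<ge> 1 / 4"
    and t0: "t0 > 0" "real n ^ 4 * t0 \<ge> 1" and mix: "real n * exp (- (t0 / 160 * real n)) \<le> 1"
    and k: "2 * \<bar>fst k\<bar> \<le> int n" "2 * \<bar>snd k\<bar> \<le> int n" and t: "t \<ge> t0" and r: "r \<in> holed n"
  shows "(norm ((tagged n k ^^ steps n t) (\<lambda>_. 1) r))\<^sup>2
     \<le> 4 * (exp (- (t0 / 160 * real n)) + exp (- (t0 / 160)) ^ nat (\<bar>fst k\<bar> + \<bar>snd k\<bar>))"
proof -
  define w :: real where "w = (of_int (fst k))\<^sup>2 + (of_int (snd k))\<^sup>2"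
  define d where "d = min (1 / real n) (w / real n ^ 2) / 320 / real n ^ 2"
  define m where "m = steps n t"
  define s where "s = m div 2"
  define j where "j = m - s"
  have w0: "w \<ge> 0" by (simp add: w_def)
  have d: "0 \<le> d" "d \<le> 2 / 5"
  proof -
    show "0 \<le> d" using w0 by (simp add: d_def)
    have "min (1 / real n) (w / real n ^ 2) \<le> 1 / real n" by simp
    also have "\<dots> \<le> 1" using n by simp
    finally have "min (1 / real n) (w / real n ^ 2) / 320 \<le> 1 / 320" by simp
    then have "d \<le> 1 / 320 / real n ^ 2" unfolding d_def by (intro divide_right_mono) auto
    also have "\<dots> \<le> 1 / 320 / 1" using n by (intro divide_left_mono) auto
    finally show "d \<le> 2 / 5" by simp
  qed
  \<comment> \<open>\<open>c_puz \<ge> 5\<close> leaves ample room; \<open>n^4 * t0 \<ge> 1\<close>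
    absorbs the loss of 1 from rounding.\<close>
  have mge: "real m \<ge> 2 * (real n ^ 4 * t0)"
  proof -
    have "5 * (real n ^ 4 * t0) \<le> c_puz * (real n ^ 4 * t)"
      using c_puz_ge t t0 by (intro mult_mono mult_left_mono) auto
    then show ?thesis using steps_bounds(2)[of t n] t t0 by (simp add: m_def mult_ac)
  qed
  have sj: "real m \<le> 2 * real j" "real m - 1 \<le> 2 * real s" "s + j = m"
    unfolding j_def s_def by linarith+
  have E: "energy n k f \<ge> (1 - (1 - d)) * nsq n f" for f
    using energy_ge_frequency[OF n h c k, of f] by (simp add: d_def w_def)
  have "norm ((tagged n k ^^ (s + j)) (\<lambda>_. 1) r) \<le> (1 - d) ^ j * (1 + real n * mixing_rate n ^ s)"
    by (rule tagged_one_decay[OF n _ E r]) (use d in simp)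
  moreover have "real n * mixing_rate n ^ s \<le> 1"
  proof -
    have n3: "real n ^ 3 > 0" using n by simp
    have "mixing_rate n ^ s \<le> exp (- (real s * (1 / (80 * real n ^ 3))))"
      unfolding mixing_rate_def[OF n] using n by (intro one_minus_power_le_exp) (simp add: divide_le_eq_1 self_le_power order_trans[of 1 80])
    also have "\<dots> \<le> exp (- (t0 / 160 * real n))"
    proof -
      have "real n ^ 4 * t0 / 2 \<le> real s" using mge sj(2) t0(2) by linarith
      then have "real n ^ 4 * t0 / 2 * (1 / (80 * real n ^ 3)) \<le> real s * (1 / (80 * real n ^ 3))"
        by (intro mult_right_mono) auto
      moreover have "real n ^ 4 * t0 / 2 * (1 / (80 * real n ^ 3)) = t0 / 160 * real n"
        using n by (simp add: power4_eq_xxxx power3_eq_cube)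
      ultimately show ?thesis by simp
    qed
    finally have "real n * mixing_rate n ^ s \<le> real n * exp (- (t0 / 160 * real n))"
      by (intro mult_left_mono) auto
    then show ?thesis using mix by linarith
  qed
  then have "(1 - d) ^ j * (1 + real n * mixing_rate n ^ s) \<le> (1 - d) ^ j * 2"
    using d by (intro mult_left_mono) auto
  ultimately have "norm ((tagged n k ^^ m) (\<lambda>_. 1) r) \<le> (1 - d) ^ j * 2"
    using sj(3) by simp
  then have "(norm ((tagged n k ^^ m) (\<lambda>_. 1) r))\<^sup>2 \<le> ((1 - d) ^ j * 2)\<^sup>2"
    by (intro power_mono) auto
  also have "\<dots> = 4 * (1 - d) ^ (2 * j)"
    by (simp add: power_mult_distrib power_mult[symmetric] mult.commute)
  also have "(1 - d) ^ (2 * j) \<le> exp (- (real (2 * j) * d))"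
    using d by (intro one_minus_power_le_exp) auto
  also have "\<dots> \<le> exp (- (t0 / 160 * min (real n) w))"
  proof -
    have "real n ^ 4 * t0 * 2 * d \<le> real (2 * j) * d"
      using mge sj(1) d by (intro mult_right_mono) auto
    moreover have "real n ^ 4 * t0 * 2 * d = t0 / 160 * (real n ^ 2 * min (1 / real n) (w / real n ^ 2))"
      using n by (simp add: d_def power4_eq_xxxx power2_eq_square)
    moreover have "real n ^ 2 * min (1 / real n) (w / real n ^ 2) = min (real n) w"
      using n by (simp add: min_mult_distrib_left power2_eq_square)
    ultimately show ?thesis by simp
  qed
  \<comment> \<open>The sum of both regimes replaces the larger one, so that the two can be summed
    over frequencies separately.\<close>
  also have "\<dots> \<le> exp (- (t0 / 160 * real n)) + exp (- (t0 / 160 * w))"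
    by (cases "real n \<le> w") auto
  also have "exp (- (t0 / 160 * w)) \<le> exp (- (t0 / 160)) ^ nat (\<bar>fst k\<bar> + \<bar>snd k\<bar>)"
  proof -
    have "\<bar>fst k\<bar> + \<bar>snd k\<bar> \<le> (fst k)\<^sup>2 + (snd k)\<^sup>2" using abs_le_square_int add_mono by blast
    then have "real_of_int (\<bar>fst k\<bar> + \<bar>snd k\<bar>) \<le> of_int ((fst k)\<^sup>2 + (snd k)\<^sup>2)" by (simp only: of_int_le_iff)
    then have "real (nat (\<bar>fst k\<bar> + \<bar>snd k\<bar>)) \<le> w" by (simp add: w_def)
    then have "t0 / 160 * real (nat (\<bar>fst k\<bar> + \<bar>snd k\<bar>)) \<le> t0 / 160 * w"
      using t0 by (intro mult_left_mono) auto
    then show ?thesis unfolding exp_of_nat_mult[symmetric] by (simp add: mult.commute)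
  qed
  finally show ?thesis by (simp add: m_def)
qed

lemma sum_abs_power_le:
  fixes p :: real
  assumes p: "0 < p" "p < 1" and F: "finite F"
  shows "(\<Sum>k\<in>F. p ^ nat \<bar>k\<bar>) \<le> 2 / (1 - p)"
proof -
  have *: "(\<Sum>k\<in>G. p ^ nat \<bar>k\<bar>) \<le> 1 / (1 - p)" if G: "finite G" "inj_on (\<lambda>k. nat \<bar>k\<bar>) G" for G :: "int set"
  proof -
    have "(\<Sum>k\<in>G. p ^ nat \<bar>k\<bar>) = (\<Sum>j\<in>(\<lambda>k. nat \<bar>k\<bar>) ` G. p ^ j)"
      using G(2) by (simp add: sum.reindex)
    also have "\<dots> \<le> (\<Sum>j. p ^ j)"
      using p G(1) by (intro sum_le_suminf summable_geometric) auto
    finally show ?thesis using p by (simp add: suminf_geometric)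
  qed
  have "F = (F \<inter> {0..}) \<union> (F \<inter> {..<0})" by auto
  then have "(\<Sum>k\<in>F. p ^ nat \<bar>k\<bar>) = (\<Sum>k\<in>F \<inter> {0..}. p ^ nat \<bar>k\<bar>) + (\<Sum>k\<in>F \<inter> {..<0}. p ^ nat \<bar>k\<bar>)"
    using F by (metis (no_types, lifting) Int_Un_distrib disjoint_iff finite_Int sum.union_disjoint
        atLeast_iff lessThan_iff not_less IntD2)
  also have "\<dots> \<le> 1 / (1 - p) + 1 / (1 - p)"
    using F by (intro add_mono *) (auto simp: inj_on_def)
  finally show ?thesis by simp
qed

text \<open>The ratio is written as a square so that one factor \<open>p\<close> pays for leaving
  the box of size \<open>R\<close> and the other keeps the double series convergent.\<close>

lemma tail_sum_le:
  fixes p :: real and R :: nat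
  assumes p: "0 < p" "p < 1" and F: "finite F"
  shows "(\<Sum>k\<in>{k \<in> F \<times> F. \<not> (\<bar>fst k\<bar> \<le> int R \<and> \<bar>snd k\<bar> \<le> int R)}. (p\<^sup>2) ^ nat (\<bar>fst k\<bar> + \<bar>snd k\<bar>))
     \<le> p ^ R * (2 / (1 - p))\<^sup>2"
proof -
  let ?S = "{k \<in> F \<times> F. \<not> (\<bar>fst k\<bar> \<le> int R \<and> \<bar>snd k\<bar> \<le> int R)}"
  have "(\<Sum>k\<in>?S. (p\<^sup>2) ^ nat (\<bar>fst k\<bar> + \<bar>snd k\<bar>)) \<le> (\<Sum>k\<in>?S. p ^ R * (p ^ nat \<bar>fst k\<bar> * p ^ nat \<bar>snd k\<bar>))"
  proof (rule sum_mono)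
    fix k assume "k \<in> ?S"
    then have "R \<le> nat (\<bar>fst k\<bar> + \<bar>snd k\<bar>)" by auto
    then have "p ^ nat (\<bar>fst k\<bar> + \<bar>snd k\<bar>) \<le> p ^ R" using p by (intro power_decreasing) auto
    then have "p ^ nat (\<bar>fst k\<bar> + \<bar>snd k\<bar>) * p ^ nat (\<bar>fst k\<bar> + \<bar>snd k\<bar>) \<le> p ^ R * p ^ nat (\<bar>fst k\<bar> + \<bar>snd k\<bar>)"
      using p by (intro mult_right_mono) auto
    then show "(p\<^sup>2) ^ nat (\<bar>fst k\<bar> + \<bar>snd k\<bar>) \<le> p ^ R * (p ^ nat \<bar>fst k\<bar> * p ^ nat \<bar>snd k\<bar>)"
      by (simp add: power2_eq_square power_mult_distrib nat_add_distrib power_add mult_ac)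
  qed
  also have "\<dots> \<le> (\<Sum>k\<in>F \<times> F. p ^ R * (p ^ nat \<bar>fst k\<bar> * p ^ nat \<bar>snd k\<bar>))"
    using p F by (intro sum_mono2) auto
  also have "\<dots> = p ^ R * ((\<Sum>k\<in>F. p ^ nat \<bar>k\<bar>) * (\<Sum>k\<in>F. p ^ nat \<bar>k\<bar>))"
    unfolding sum_product sum.cartesian_product by (simp add: case_prod_beta sum_distrib_left)
  also have "\<dots> \<le> p ^ R * ((2 / (1 - p)) * (2 / (1 - p)))"
    using p sum_abs_power_le[OF p F] by (intro mult_left_mono mult_mono sum_nonneg) auto
  finally show ?thesis by (simp add: power2_eq_square)
qed

section \<open>The wrapped Gaussian\<close>

text \<open>All integer translates, enumerated over the naturals as the pairs \<open>j\<close> and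
  \<open>- 1 - j\<close>. This pairing is invariant under \<open>x\<close> to \<open>1 - x\<close>,
  which makes the reflection symmetry hold termwise.\<close>

abbreviation wrap_term :: "real \<Rightarrow> real \<Rightarrow> nat \<Rightarrow> real" where
  "wrap_term \<sigma> x j \<equiv> normal_density 0 \<sigma> (x + real j) + normal_density 0 \<sigma> (x - 1 - real j)"

definition wrapped :: "real \<Rightarrow> real \<Rightarrow> real" where
  "wrapped \<sigma> x = (\<Sum>j. wrap_term \<sigma> x j)"

lemma frac_measurable [measurable]: "(frac :: real \<Rightarrow> real) \<in> borel_measurable borel"
  unfolding frac_def[abs_def] by measurable

lemma normal_density_even: "normal_density 0 \<sigma> (- x) = normal_density 0 \<sigma> x"
  by (simp add: normal_density_def)

lemma normal_density_le:
  assumes \<sigma>: "\<sigma> > 0" and y: "\<bar>y\<bar> \<ge> real j"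
  shows "normal_density 0 \<sigma> y \<le> normal_density 0 \<sigma> 0 * exp (- 1 / (2 * \<sigma>\<^sup>2)) ^ j"
proof -
  have "real j \<le> (real j)\<^sup>2" by (cases j) (auto simp: power2_eq_square)
  also have "\<dots> \<le> y\<^sup>2" using y by (metis abs_of_nat abs_le_square_iff)
  finally have "- y\<^sup>2 / (2 * \<sigma>\<^sup>2) \<le> real j * (- 1 / (2 * \<sigma>\<^sup>2))"
    using \<sigma> by (simp add: divide_right_mono)
  then have "exp (- y\<^sup>2 / (2 * \<sigma>\<^sup>2)) \<le> exp (- 1 / (2 * \<sigma>\<^sup>2)) ^ j"
    by (metis exp_le_cancel_iff exp_of_nat_mult)
  then show ?thesis unfolding normal_density_def by (simp add: divide_right_mono)
qed

context
  fixes \<sigma> :: real assumes \<sigma>: "\<sigma> > 0"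
begin

lemma wrapped_term_le:
  assumes "x \<in> {0..1}"
  shows "norm (wrap_term \<sigma> x j)
    \<le> 2 * normal_density 0 \<sigma> 0 * exp (- 1 / (2 * \<sigma>\<^sup>2)) ^ j"
  using normal_density_le[OF \<sigma>, of j "x + real j"] normal_density_le[OF \<sigma>, of j "x - 1 - real j"] assms
  by simp

lemma wrapped_summable_bound: "summable (\<lambda>j. 2 * normal_density 0 \<sigma> 0 * exp (- 1 / (2 * \<sigma>\<^sup>2)) ^ j)"
  using \<sigma> by (intro summable_mult summable_geometric) simp

lemma wrapped_summable:
  "x \<in> {0..1} \<Longrightarrow> summable (\<lambda>j. wrap_term \<sigma> x j)"
  using wrapped_term_le by (intro summable_comparison_test'[OF wrapped_summable_bound, of 0]) auto

lemma wrapped_continuous: "continuous_on {0..1} (wrapped \<sigma>)"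
proof -
  have "uniform_limit {0..1} (\<lambda>n x. \<Sum>j<n. wrap_term \<sigma> x j)
     (\<lambda>x. \<Sum>j. wrap_term \<sigma> x j) sequentially"
    using wrapped_term_le wrapped_summable_bound by (rule Weierstrass_m_test)
  moreover have "continuous_on {0..1} (\<lambda>x. \<Sum>j<n. wrap_term \<sigma> x j)" for n
    unfolding normal_density_def by (intro continuous_intros) (use \<sigma> in auto)
  ultimately show ?thesis
    unfolding wrapped_def[abs_def] by (intro uniform_limit_theorem) auto
qed

lemma wrapped_nonneg: "x \<in> {0..1} \<Longrightarrow> wrapped \<sigma> x \<ge> 0"
  unfolding wrapped_def by (intro suminf_nonneg wrapped_summable) auto

lemma wrapped_reflect: "wrapped \<sigma> (1 - x) = wrapped \<sigma> x"
proof -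
  have "wrap_term \<sigma> (1 - x) j
      = wrap_term \<sigma> x j" for j
    using normal_density_even[of \<sigma> "x + real j"] normal_density_even[of \<sigma> "x - 1 - real j"]
    by (simp add: algebra_simps)
  then show ?thesis by (simp add: wrapped_def)
qed

text \<open>Cut the line into unit intervals, translate each to the first one, and sum. Stated for a
  general integrand so that it can be applied to the two coordinates in turn.\<close>

lemma nn_integral_frac_normal:
  assumes [measurable]: "f \<in> borel_measurable borel"
  shows "(\<integral>\<^sup>+x. f (frac x) * ennreal (normal_density 0 \<sigma> x) \<partial>lborel)
       = (\<integral>\<^sup>+x. f x * (ennreal (wrapped \<sigma> x) * indicator {0..<1} x) \<partial>lborel)"
proof -
  let ?g = "normal_density 0 \<sigma>"
  let ?I = "\<lambda>j x. indicator {real j..<real j + 1} x + indicator {-1 - real j..<- real j} x :: ennreal"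
  have one: "(\<Sum>j. ?I j x) = 1" for x
  proof -
    \<comment> \<open>The index of the pair of unit intervals that contains \<open>x\<close>: the
      floors \<open>i\<close> and \<open>- 1 - i\<close> share one index.\<close>
    define i where "i = (if 0 \<le> \<lfloor>x\<rfloor> then nat \<lfloor>x\<rfloor> else nat (- 1 - \<lfloor>x\<rfloor>))"
    have "?I j x = (if j = i then 1 else 0)" for j
    proof (cases "0 \<le> \<lfloor>x\<rfloor>")
      case True
      then have "x \<ge> 0" by simp
      then have f1: "(x \<in> {-1 - real j..<- real j}) = False" by auto
      have f2: "x \<in> {real j..<real j + 1} \<longleftrightarrow> j = i"
      proof -
        have "x \<in> {real j..<real j + 1} \<longleftrightarrow> \<lfloor>x\<rfloor> = int j" by (simp add: floor_eq_iff)
        then show ?thesis using True by (auto simp: i_def)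
      qed
      show ?thesis unfolding indicator_def f1 f2 by simp
    next
      case False
      then have "x < 0" by simp
      then have f1: "(x \<in> {real j..<real j + 1}) = False" by auto
      have f2: "x \<in> {-1 - real j..<- real j} \<longleftrightarrow> j = i"
      proof -
        have "x \<in> {-1 - real j..<- real j} \<longleftrightarrow> \<lfloor>x\<rfloor> = - 1 - int j" by (simp add: floor_eq_iff)
        moreover have "int i = - 1 - \<lfloor>x\<rfloor>"
          unfolding i_def if_not_P[OF False] using False by (subst int_nat_eq, subst if_P) linarith+
        then have "\<lfloor>x\<rfloor> = - 1 - int j \<longleftrightarrow> j = i" by (safe; linarith)
        ultimately show ?thesis by simp
      qed
      show ?thesis unfolding indicator_def f1 f2 by simp
    qed
    then have "(\<lambda>j. ?I j x) = (\<lambda>j. if j = i then 1 else 0)" by auto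
    then show ?thesis using sums_single[of i "\<lambda>_. 1 :: ennreal"] by (simp add: sums_iff)
  qed
  have shift: "(\<integral>\<^sup>+x. f (frac x) * ennreal (?g x) * indicator {of_int m..<of_int m + 1} x \<partial>lborel)
      = (\<integral>\<^sup>+x. f x * (ennreal (?g (x + of_int m)) * indicator {0..<1} x) \<partial>lborel)" for m :: int
  proof -
    have "(\<integral>\<^sup>+x. f (frac x) * ennreal (?g x) * indicator {of_int m..<of_int m + 1} x \<partial>lborel)
      = (\<integral>\<^sup>+x. f (frac (of_int m + x)) * ennreal (?g (of_int m + x)) * indicator {of_int m..<of_int m + 1} (of_int m + x) \<partial>lborel)"
      using nn_integral_real_affine[of "\<lambda>x. f (frac x) * ennreal (?g x) * indicator {of_int m..<of_int m + 1} x" 1 "of_int m"]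
      by simp
    also have "\<dots> = (\<integral>\<^sup>+x. f x * (ennreal (?g (x + of_int m)) * indicator {0..<1} x) \<partial>lborel)"
    proof (rule nn_integral_cong)
      fix x :: real
      show "f (frac (of_int m + x)) * ennreal (?g (of_int m + x)) * indicator {of_int m..<of_int m + 1} (of_int m + x)
          = f x * (ennreal (?g (x + of_int m)) * indicator {0..<1} x)"
      proof (cases "x \<in> {0..<1}")
        case True
        then have "frac (of_int m + x) = x"
          by (simp add: frac_def floor_eq_iff)
        then show ?thesis using True by (simp add: indicator_def add.commute)
      qed (auto simp: indicator_def)
    qed
    finally show ?thesis .
  qed
  have "(\<integral>\<^sup>+x. f (frac x) * ennreal (?g x) \<partial>lborel)
      = (\<integral>\<^sup>+x. (\<Sum>j. f (frac x) * ennreal (?g x) * ?I j x) \<partial>lborel)"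
    by (simp only: ennreal_suminf_cmult one mult_1_right)
  also have "\<dots> = (\<Sum>j. \<integral>\<^sup>+x. f (frac x) * ennreal (?g x) * ?I j x \<partial>lborel)"
    by (rule nn_integral_suminf) simp
  also have "\<dots> = (\<Sum>j. \<integral>\<^sup>+x. f x * (ennreal (wrap_term \<sigma> x j) * indicator {0..<1} x) \<partial>lborel)"
  proof (rule suminf_cong)
    fix j
    have "(\<integral>\<^sup>+x. f (frac x) * ennreal (?g x) * ?I j x \<partial>lborel)
        = (\<integral>\<^sup>+x. f (frac x) * ennreal (?g x) * indicator {real j..<real j + 1} x \<partial>lborel)
        + (\<integral>\<^sup>+x. f (frac x) * ennreal (?g x) * indicator {-1 - real j..<- real j} x \<partial>lborel)"
      by (simp add: distrib_left nn_integral_add)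
    also have "\<dots> = (\<integral>\<^sup>+x. f x * (ennreal (?g (x + real j)) * indicator {0..<1} x) \<partial>lborel)
        + (\<integral>\<^sup>+x. f x * (ennreal (?g (x - 1 - real j)) * indicator {0..<1} x) \<partial>lborel)"
      using shift[of "int j"] shift[of "-1 - int j"] by (simp add: algebra_simps)
    also have "\<dots> = (\<integral>\<^sup>+x. f x * (ennreal (wrap_term \<sigma> x j) * indicator {0..<1} x) \<partial>lborel)"
      by (simp add: nn_integral_add[symmetric] distrib_left distrib_right ennreal_plus)
    finally show "(\<integral>\<^sup>+x. f (frac x) * ennreal (?g x) * ?I j x \<partial>lborel)
        = (\<integral>\<^sup>+x. f x * (ennreal (wrap_term \<sigma> x j) * indicator {0..<1} x) \<partial>lborel)" .
  qed
  also have "\<dots> = (\<integral>\<^sup>+x. (\<Sum>j. f x * (ennreal (wrap_term \<sigma> x j) * indicator {0..<1} x)) \<partial>lborel)"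
    by (rule nn_integral_suminf[symmetric]) simp
  also have "\<dots> = (\<integral>\<^sup>+x. f x * (ennreal (wrapped \<sigma> x) * indicator {0..<1} x) \<partial>lborel)"
  proof (rule nn_integral_cong)
    fix x :: real
    show "(\<Sum>j. f x * (ennreal (wrap_term \<sigma> x j) * indicator {0..<1} x))
        = f x * (ennreal (wrapped \<sigma> x) * indicator {0..<1} x)"
    proof (cases "x \<in> {0..<1}")
      case True
      then have "(\<Sum>j. ennreal (wrap_term \<sigma> x j)) = ennreal (wrapped \<sigma> x)"
        unfolding wrapped_def by (intro suminf_ennreal2 wrapped_summable) auto
      then show ?thesis using True by (simp add: ennreal_suminf_cmult)
    qed simp
  qed
  finally show ?thesis .
qed

end

lemma wrapped_measurable [measurable]: "wrapped \<sigma> \<in> borel_measurable borel"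
  unfolding wrapped_def[abs_def] by measurable

abbreviation gaussian :: "real \<Rightarrow> real measure" where
  "gaussian \<sigma> \<equiv> density lborel (normal_density 0 \<sigma>)"

lemma distr_frac_normal:
  assumes \<sigma>: "\<sigma> > 0"
  shows "distr (gaussian \<sigma>) borel frac
       = density lborel (\<lambda>x. ennreal (wrapped \<sigma> x) * indicator {0..<1} x)"
proof (rule measure_eqI)
  fix A :: "real set" assume "A \<in> sets (distr (gaussian \<sigma>) borel frac)"
  then have A [measurable]: "A \<in> sets borel" by simp
  have "emeasure (distr (gaussian \<sigma>) borel frac) A
      = (\<integral>\<^sup>+x. ennreal (normal_density 0 \<sigma> x) * indicator (frac -` A) x \<partial>lborel)"
    using measurable_sets_borel[OF frac_measurable A] by (simp add: emeasure_distr emeasure_density)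
  also have "\<dots> = (\<integral>\<^sup>+x. indicator A (frac x) * ennreal (normal_density 0 \<sigma> x) \<partial>lborel)"
    by (intro nn_integral_cong) (simp add: indicator_def)
  also have "\<dots> = (\<integral>\<^sup>+x. indicator A x * (ennreal (wrapped \<sigma> x) * indicator {0..<1} x) \<partial>lborel)"
    by (rule nn_integral_frac_normal[OF \<sigma>]) simp
  also have "\<dots> = emeasure (density lborel (\<lambda>x. ennreal (wrapped \<sigma> x) * indicator {0..<1} x)) A"
    by (simp add: emeasure_density mult.commute)
  finally show "emeasure (distr (gaussian \<sigma>) borel frac) A
      = emeasure (density lborel (\<lambda>x. ennreal (wrapped \<sigma> x) * indicator {0..<1} x)) A" .
qed simp

abbreviation cosine :: "int \<Rightarrow> real \<Rightarrow> real" where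
  "cosine m x \<equiv> cos (2 * pi * of_int m * x)"

lemma cos_frac: "cosine m (frac x) = cosine m x"
proof -
  have "2 * pi * of_int m * frac x = 2 * pi * of_int m * x - 2 * pi * of_int (m * \<lfloor>x\<rfloor>)"
    by (simp add: frac_def algebra_simps)
  moreover have "cos (2 * pi * of_int m * x - 2 * pi * of_int (m * \<lfloor>x\<rfloor>)) = cosine m x"
    unfolding cos_diff using sin_int_2pin[of "m * \<lfloor>x\<rfloor>"] cos_int_2pin[of "m * \<lfloor>x\<rfloor>"] by simp
  ultimately show ?thesis by simp
qed

lemma integral_normal_cos:
  assumes \<sigma>: "\<sigma> > 0"
  shows "(LBINT x. normal_density 0 \<sigma> x * cos (s * x)) = exp (- (s * \<sigma>)\<^sup>2 / 2)"
proof -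
  have "(LBINT x. normal_density 0 \<sigma> x * cos (s * x)) = \<bar>\<sigma>\<bar> * (LBINT x. normal_density 0 \<sigma> (0 + \<sigma> * x) * cos (s * (0 + \<sigma> * x)))"
    using lborel_integral_real_affine[of \<sigma> "\<lambda>x. normal_density 0 \<sigma> x * cos (s * x)" 0] \<sigma> by simp
  also have "\<dots> = (LBINT x. std_normal_density x * cos ((s * \<sigma>) * x))"
    unfolding integral_mult_right_zero[symmetric]
    by (rule Bochner_Integration.integral_cong) (use \<sigma> in \<open>auto simp: normal_density_def real_sqrt_mult power_mult_distrib mult_ac\<close>)
  also have "\<dots> = Re (LBINT x. std_normal_density x *\<^sub>R iexp ((s * \<sigma>) * x))"
  proof -
    have "integrable lborel (\<lambda>x. std_normal_density x *\<^sub>R iexp ((s * \<sigma>) * x))"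
      by (rule Bochner_Integration.integrable_bound[of _ std_normal_density]) auto
    then have "Re (LBINT x. std_normal_density x *\<^sub>R iexp ((s * \<sigma>) * x)) = (LBINT x. Re (std_normal_density x *\<^sub>R iexp ((s * \<sigma>) * x)))"
      by (rule integral_Re[symmetric])
    then show ?thesis by (simp add: Re_exp)
  qed
  also have "(LBINT x. std_normal_density x *\<^sub>R iexp ((s * \<sigma>) * x)) = char std_normal_distribution (s * \<sigma>)"
    unfolding char_def by (subst integral_density) auto
  also have "Re \<dots> = exp (- (s * \<sigma>)\<^sup>2 / 2)"
    by (simp only: char_std_normal_distribution Re_complex_of_real)
  finally show ?thesis .
qed

text \<open>The cosine has period 1, so wrapping does not change its expectation, and the value is
  read off the characteristic function of the normal law.\<close>

lemma wrapped_cos_integral: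
  assumes \<sigma>: "\<sigma> > 0"
  shows "integral {0..1} (\<lambda>x. wrapped \<sigma> x * cosine m x) = exp (- 2 * pi\<^sup>2 * (of_int m)\<^sup>2 * \<sigma>\<^sup>2)"
proof -
  let ?c = "\<lambda>x. cosine m x"
  have "(LBINT x. normal_density 0 \<sigma> x * ?c x) = integral\<^sup>L (gaussian \<sigma>) ?c"
    by (subst integral_density) auto
  also have "\<dots> = integral\<^sup>L (gaussian \<sigma>) (\<lambda>x. ?c (frac x))"
    by (simp only: cos_frac)
  also have "\<dots> = integral\<^sup>L (distr (gaussian \<sigma>) borel frac) ?c"
    by (rule integral_distr[symmetric]) auto
  also have "distr (gaussian \<sigma>) borel frac
      = density lborel (\<lambda>x. ennreal (wrapped \<sigma> x * indicator {0..<1} x))"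
    unfolding distr_frac_normal[OF \<sigma>]
    by (intro density_cong) (auto simp: indicator_def)
  also have "integral\<^sup>L \<dots> ?c = (LBINT x. (wrapped \<sigma> x * indicator {0..<1} x) * ?c x)"
    using wrapped_nonneg[OF \<sigma>]
    by (subst integral_density) (auto simp: indicator_def)
  also have "\<dots> = (LBINT x. indicator {0..1} x *\<^sub>R (wrapped \<sigma> x * ?c x))"
  proof (rule integral_cong_AE)
    have "AE x in lborel. x \<noteq> (1::real)" by (rule AE_lborel_singleton)
    then show "AE x in lborel. (wrapped \<sigma> x * indicator {0..<1} x) * ?c x = indicator {0..1} x *\<^sub>R (wrapped \<sigma> x * ?c x)"
      by eventually_elim (auto simp: indicator_def)
  qed auto
  also have "\<dots> = integral {0..1} (\<lambda>x. wrapped \<sigma> x * ?c x)"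
    unfolding set_lebesgue_integral_def[symmetric]
    by (intro set_borel_integral_eq_integral borel_integrable_atLeastAtMost' continuous_intros wrapped_continuous \<sigma>)
  finally show ?thesis
    unfolding integral_normal_cos[OF \<sigma>] by (simp add: power_mult_distrib mult_ac)
qed

section \<open>Theta series and Poisson summation\<close>

abbreviation theta_coeff :: "real \<Rightarrow> nat \<Rightarrow> real" where
  "theta_coeff t j \<equiv> exp (- 2 * pi\<^sup>2 * (real (Suc j))\<^sup>2 * t)"

definition theta :: "real \<Rightarrow> real \<Rightarrow> real" where
  "theta t x = 1 + 2 * (\<Sum>j. theta_coeff t j * cos (2 * pi * real (Suc j) * x))"

definition theta_part :: "nat \<Rightarrow> real \<Rightarrow> real \<Rightarrow> real" where
  "theta_part R t x = 1 + 2 * (\<Sum>j<R. theta_coeff t j * cos (2 * pi * real (Suc j) * x))"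

text \<open>The first Fourier coefficient. Since the exponents are squares and
  \<open>j^2 \<ge> j\<close>, its powers dominate all later coefficients, also for larger
  times.\<close>

definition nome :: "real \<Rightarrow> real" where
  "nome t = exp (- 2 * pi\<^sup>2 * t)"

lemma nome_bounds: "t > 0 \<Longrightarrow> 0 < nome t \<and> nome t < 1"
  by (simp add: nome_def)

lemma theta_term_le:
  assumes "0 < t0" "t0 \<le> t"
  shows "norm (theta_coeff t j * cos (2 * pi * real (Suc j) * x)) \<le> nome t0 ^ Suc j"
proof -
  have "1 * real (Suc j) \<le> real (Suc j) * real (Suc j)" by (intro mult_right_mono) auto
  then have "real (Suc j) * t0 \<le> (real (Suc j))\<^sup>2 * t"
    using assms by (intro mult_mono) (auto simp: power2_eq_square)
  then have "2 * pi\<^sup>2 * (real (Suc j) * t0) \<le> 2 * pi\<^sup>2 * ((real (Suc j))\<^sup>2 * t)"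
    by (intro mult_left_mono) auto
  then have "- 2 * pi\<^sup>2 * (real (Suc j))\<^sup>2 * t \<le> real (Suc j) * (- 2 * pi\<^sup>2 * t0)"
    by (simp add: algebra_simps)
  then have "theta_coeff t j \<le> nome t0 ^ Suc j"
    unfolding nome_def exp_of_nat_mult[symmetric] by (simp only: exp_le_cancel_iff)
  then have "theta_coeff t j * \<bar>cos (2 * pi * real (Suc j) * x)\<bar> \<le> nome t0 ^ Suc j * 1"
    by (intro mult_mono) (auto simp: nome_def)
  then show ?thesis by (simp only: norm_mult real_norm_def abs_mult abs_exp_cancel mult_1_right)
qed

lemma
  assumes t: "0 < t0" "t0 \<le> t"
  shows theta_approx: "\<bar>theta t x - theta_part R t x\<bar> \<le> 2 * nome t0 ^ Suc R / (1 - nome t0)"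
    and theta_part_bound: "\<bar>theta_part R t x\<bar> \<le> (1 + nome t0) / (1 - nome t0)"
    and theta_bound: "\<bar>theta t x\<bar> \<le> (1 + nome t0) / (1 - nome t0)"
proof -
  let ?f = "\<lambda>j. theta_coeff t j * cos (2 * pi * real (Suc j) * x)"
  let ?q = "nome t0"
  have q: "0 < ?q" "?q < 1" using nome_bounds t by auto
  have sg: "summable (\<lambda>j. ?q ^ Suc j)"
    using q by (simp add: summable_mult summable_geometric)
  have sn: "summable (\<lambda>j. norm (?f j))"
    by (rule summable_comparison_test'[OF sg, of 0]) (use theta_term_le[OF t] in simp)
  have sf: "summable ?f" using sn by (rule summable_norm_cancel)
  have geo: "(\<Sum>j. ?q ^ Suc (j + R)) = ?q ^ Suc R / (1 - ?q)" for R
  proof -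
    have "(\<Sum>j. ?q ^ Suc (j + R)) = (\<Sum>j. ?q ^ Suc R * ?q ^ j)" by (simp add: power_add mult_ac)
    also have "\<dots> = ?q ^ Suc R * (\<Sum>j. ?q ^ j)" using q by (intro suminf_mult summable_geometric) simp
    finally show ?thesis using q by (simp add: suminf_geometric)
  qed
  have tail: "\<bar>\<Sum>j. ?f (j + R)\<bar> \<le> ?q ^ Suc R / (1 - ?q)" for R
  proof -
    have "\<bar>\<Sum>j. ?f (j + R)\<bar> \<le> (\<Sum>j. norm (?f (j + R)))"
      using summable_norm[of "\<lambda>j. ?f (j + R)"] summable_ignore_initial_segment[OF sn, of R] by simp
    also have "\<dots> \<le> (\<Sum>j. ?q ^ Suc (j + R))"
      by (intro suminf_le theta_term_le[OF t] summable_ignore_initial_segment[OF sn, of R]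
          summable_ignore_initial_segment[OF sg, of R])
    finally show ?thesis using geo by simp
  qed
  have "theta t x - theta_part R t x = 2 * (\<Sum>j. ?f (j + R))"
    unfolding theta_def theta_part_def suminf_split_initial_segment[OF sf, of R] by (simp del: of_nat_Suc)
  then show "\<bar>theta t x - theta_part R t x\<bar> \<le> 2 * ?q ^ Suc R / (1 - ?q)"
    using tail[of R] by (simp only: abs_mult abs_numeral)
  have e: "1 + 2 * (?q / (1 - ?q)) = (1 + ?q) / (1 - ?q)" using q by (simp add: field_simps)
  have "\<bar>theta t x\<bar> \<le> 1 + 2 * (?q / (1 - ?q))"
    using tail[of 0] unfolding theta_def by (simp del: of_nat_Suc)
  then show "\<bar>theta t x\<bar> \<le> (1 + ?q) / (1 - ?q)" by (simp only: e)
  have "\<bar>\<Sum>j<R. ?f j\<bar> \<le> (\<Sum>j<R. ?q ^ Suc j)"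
    by (intro order_trans[OF sum_abs] sum_mono) (use theta_term_le[OF t] in simp)
  also have "\<dots> \<le> (\<Sum>j. ?q ^ Suc j)" using q by (intro sum_le_suminf sg) auto
  also have "\<dots> = ?q / (1 - ?q)" using geo[of 0] by simp
  finally have "\<bar>theta_part R t x\<bar> \<le> 1 + 2 * (?q / (1 - ?q))"
    unfolding theta_part_def by linarith
  then show "\<bar>theta_part R t x\<bar> \<le> (1 + ?q) / (1 - ?q)" by (simp only: e)
qed


lemma cos_integral:
  fixes m :: int
  shows "integral {0..1} (\<lambda>x. cosine m x) = (if m = 0 then 1 else 0)"
proof (cases "m = 0")
  case False
  let ?F = "\<lambda>x. sin (2 * pi * of_int m * x) / (2 * pi * of_int m)"
  have "((\<lambda>x. cosine m x) has_integral (?F 1 - ?F 0)) {0..1}"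
    using False by (intro fundamental_theorem_of_calculus)
      (auto intro!: derivative_eq_intros simp: has_real_derivative_iff_has_vector_derivative[symmetric])
  then show ?thesis using False sin_int_2pin[of m] by (simp add: integral_unique)
qed simp

lemma cos_cos_integral:
  fixes m :: int
  assumes "j > 0"
  shows "integral {0..1} (\<lambda>x. cosine j x * cosine m x) = (if \<bar>m\<bar> = j then 1 / 2 else 0)"
proof -
  have e: "cosine j x * cosine m x
      = (cosine (j - m) x + cosine (j + m) x) / 2" for x :: real
    by (simp add: cos_times_cos algebra_simps)
  have "integral {0..1} (\<lambda>x. cosine j x * cosine m x)
      = (integral {0..1} (\<lambda>x. cosine (j - m) x) + integral {0..1} (\<lambda>x. cosine (j + m) x)) / 2"
    unfolding e
    by (subst integral_divide, subst Henstock_Kurzweil_Integration.integral_add)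
      (auto intro!: integrable_continuous_real continuous_intros)
  then show ?thesis using assms unfolding cos_integral by auto
qed

lemma theta_part_cos_integral:
  fixes m :: int
  assumes "\<bar>m\<bar> \<le> int R"
  shows "integral {0..1} (\<lambda>x. theta_part R t x * cosine m x) = exp (- 2 * pi\<^sup>2 * (of_int m)\<^sup>2 * t)"
proof -
  let ?c = "\<lambda>m x. cosine m x"
  let ?a = "\<lambda>j. theta_coeff t j"
  have e: "theta_part R t x * ?c m x = ?c m x + (\<Sum>j<R. 2 * ?a j * (?c (int (Suc j)) x * ?c m x))" for x
    by (simp add: theta_part_def distrib_right sum_distrib_left sum_distrib_right distrib_left mult_ac del: of_nat_Suc)
  have "integral {0..1} (\<lambda>x. theta_part R t x * ?c m x)
      = integral {0..1} (?c m) + (\<Sum>j<R. integral {0..1} (\<lambda>x. 2 * ?a j * (?c (int (Suc j)) x * ?c m x)))"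
    unfolding e
    by (subst Henstock_Kurzweil_Integration.integral_add, (auto intro!: integrable_continuous_real continuous_intros)[2],
        subst integral_sum) (auto intro!: integrable_continuous_real continuous_intros)
  also have "\<dots> = (if m = 0 then 1 else 0) + (\<Sum>j<R. 2 * ?a j * (if \<bar>m\<bar> = int (Suc j) then 1 / 2 else 0))"
    by (simp only: integral_mult_right cos_integral cos_cos_integral of_nat_0_less_iff zero_less_Suc)
  also have "\<dots> = exp (- 2 * pi\<^sup>2 * (of_int m)\<^sup>2 * t)"
  proof (cases "m = 0")
    case False
    define i where "i = nat \<bar>m\<bar> - 1"
    have i: "i < R" "\<bar>m\<bar> = int (Suc i)" using False assms by (auto simp: i_def)
    have "(of_int m)\<^sup>2 = (real_of_int \<bar>m\<bar>)\<^sup>2" by simp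
    then have m2: "(real_of_int m)\<^sup>2 = (real (Suc i))\<^sup>2" unfolding i(2) by simp
    have "(\<Sum>j<R. 2 * ?a j * (if \<bar>m\<bar> = int (Suc j) then 1 / 2 else 0)) = (\<Sum>j<R. if j = i then ?a j else 0)"
      by (intro sum.cong refl) (use i in auto)
    then show ?thesis using False i(1) unfolding m2 by simp
  qed simp
  finally show ?thesis .
qed

lemma theta_part_continuous: "continuous_on S (theta_part R t)"
  unfolding theta_part_def[abs_def] by (intro continuous_intros)

lemma theta_continuous:
  assumes t: "t > 0"
  shows "continuous_on S (theta t)"
proof -
  have q: "0 < nome t" "nome t < 1" using nome_bounds t by auto
  have "uniform_limit S (\<lambda>R. theta_part R t) (theta t) sequentially"
  proof (rule uniform_limitI)
    fix e :: real assume "e > 0"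
    have "(\<lambda>R. 2 * (nome t * nome t ^ R) / (1 - nome t)) \<longlonglongrightarrow> 2 * (nome t * 0) / (1 - nome t)"
      using q by (intro tendsto_intros LIMSEQ_realpow_zero) auto
    then have "\<forall>\<^sub>F R in sequentially. 2 * (nome t * nome t ^ R) / (1 - nome t) < e"
      using \<open>e > 0\<close> by (intro order_tendstoD(2)) auto
    then show "\<forall>\<^sub>F R in sequentially. \<forall>x\<in>S. dist (theta_part R t x) (theta t x) < e"
    proof eventually_elim
      case (elim R)
      have "dist (theta_part R t x) (theta t x) \<le> 2 * (nome t * nome t ^ R) / (1 - nome t)" for x
        using theta_approx[OF t order_refl, where x = x and R = R] by (simp add: dist_real_def abs_minus_commute)
      then show ?case using elim by (meson le_less_trans)
    qed
  qed
  then show ?thesis by (rule uniform_limit_theorem[rotated]) (auto intro!: always_eventually theta_part_continuous)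
qed

lemma theta_cos_integral:
  fixes m :: int
  assumes t: "t > 0"
  shows "integral {0..1} (\<lambda>x. theta t x * cosine m x) = exp (- 2 * pi\<^sup>2 * (of_int m)\<^sup>2 * t)"
    (is "?I = ?e")
proof -
  let ?c = "\<lambda>x. cosine m x"
  let ?b = "\<lambda>R. 2 * (nome t * nome t ^ R) / (1 - nome t)"
  have q: "0 < nome t" "nome t < 1" using nome_bounds t by auto
  have le: "\<bar>?I - ?e\<bar> \<le> ?b R" if R: "nat \<bar>m\<bar> \<le> R" for R
  proof -
    have "?I - ?e = integral {0..1} (\<lambda>x. theta t x * ?c x) - integral {0..1} (\<lambda>x. theta_part R t x * ?c x)"
      using R by (subst theta_part_cos_integral) auto
    also have "\<dots> = integral {0..1} (\<lambda>x. theta t x * ?c x - theta_part R t x * ?c x)"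
      by (intro Henstock_Kurzweil_Integration.integral_diff[symmetric] integrable_continuous_real
          continuous_intros theta_continuous theta_part_continuous t)
    also have "norm \<dots> \<le> ?b R * (1 - 0)"
    proof (rule integral_bound)
      show "continuous_on {0..1} (\<lambda>x. theta t x * ?c x - theta_part R t x * ?c x)"
        by (intro continuous_intros theta_continuous theta_part_continuous t)
      fix x :: real
      have "\<bar>theta t x - theta_part R t x\<bar> * \<bar>?c x\<bar> \<le> ?b R * 1"
        using theta_approx[OF t order_refl, where x = x and R = R] q by (intro mult_mono) auto
      then show "norm (theta t x * ?c x - theta_part R t x * ?c x) \<le> ?b R"
        by (simp add: abs_mult flip: left_diff_distrib)
    qed simp
    finally show ?thesis by simp
  qed
  have "?b \<longlonglongrightarrow> 2 * (nome t * 0) / (1 - nome t)"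
    using q by (intro tendsto_intros LIMSEQ_realpow_zero) auto
  then have "\<bar>?I - ?e\<bar> \<le> 2 * (nome t * 0) / (1 - nome t)"
    by (rule Lim_bounded2) (use le in auto)
  then show ?thesis by simp
qed

lemma theta_reflect: "theta t (1 - x) = theta t x"
proof -
  have "cos (2 * pi * real (Suc j) * (1 - x)) = cos (2 * pi * real (Suc j) * x)" for j
  proof -
    have "2 * pi * real (Suc j) * (1 - x) = of_int (int (Suc j)) * (2 * pi) - 2 * pi * real (Suc j) * x"
      by (simp add: algebra_simps)
    then show ?thesis
      using sin_int_2pin[of "int (Suc j)"] cos_int_2pin[of "int (Suc j)"]
      by (simp only: cos_diff mult.commute[of "of_int _" "2 * pi"])
  qed
  then show ?thesis by (simp add: theta_def)
qed

text \<open>A continuous function on $[0,1]$ symmetric about $1/2$ is a continuous function of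
  $\cos(2 \pi x)$, so Weierstrass applies.\<close>

lemma cos_moments_unique:
  fixes u :: "real \<Rightarrow> real"
  assumes c: "continuous_on {0..1} u" and s: "\<And>x. x \<in> {0..1} \<Longrightarrow> u (1 - x) = u x"
    and m: "\<And>m::int. integral {0..1} (\<lambda>x. u x * cosine m x) = 0"
    and x: "x \<in> {0..1}"
  shows "u x = 0"
proof -
  let ?c = "\<lambda>x. cos (2 * pi * x)"
  \<comment> \<open>Turning products of cosines into sums lowers the power while shifting the
    frequency, so \<open>m\<close> has to vary; only \<open>m = 0\<close> is used
    afterwards.\<close>
  have mom: "integral {0..1} (\<lambda>x. u x * ?c x ^ i * cosine m x) = 0" for i and m :: int
  proof (induction i arbitrary: m)
    case 0
    then show ?case using m by simp
  next
    case (Suc i)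
    have e: "u x * ?c x ^ Suc i * cosine m x
        = (u x * ?c x ^ i * cosine (m - 1) x + u x * ?c x ^ i * cosine (m + 1) x) / 2" for x
    proof -
      have "cosine m x * ?c x = (cosine (m - 1) x + cosine (m + 1) x) / 2"
        using cos_times_cos[of "2 * pi * of_int m * x" "2 * pi * x"] by (simp add: algebra_simps)
      then have "u x * ?c x ^ i * (cosine m x * ?c x)
          = u x * ?c x ^ i * ((cosine (m - 1) x + cosine (m + 1) x) / 2)" by simp
      then show ?thesis by (simp only: power_Suc) (simp add: algebra_simps)
    qed
    have "integral {0..1} (\<lambda>x. u x * ?c x ^ Suc i * cosine m x)
        = (integral {0..1} (\<lambda>x. u x * ?c x ^ i * cosine (m - 1) x)
           + integral {0..1} (\<lambda>x. u x * ?c x ^ i * cosine (m + 1) x)) / 2"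
      unfolding e by (subst integral_divide, subst Henstock_Kurzweil_Integration.integral_add)
        (auto intro!: integrable_continuous_real continuous_intros c)
    then show ?case by (simp only: Suc.IH) simp
  qed
  \<comment> \<open>The arc cosine recovers the angle on the first half of the interval; on the
    second half the symmetry of \<open>u\<close> is used.\<close>
  define U where "U y = u (arccos y / (2 * pi))" for y
  have U: "u x = U (?c x)" if "x \<in> {0..1}" for x
  proof (cases "x \<le> 1 / 2")
    case True
    then have "2 * pi * x \<le> pi" using mult_left_mono[of x "1 / 2" "2 * pi"] by simp
    then have "arccos (?c x) = 2 * pi * x" using that by (intro arccos_cos) auto
    then show ?thesis by (simp add: U_def)
  next
    case False
    have "?c x = ?c (1 - x)" by (simp add: right_diff_distrib cos_diff)
    moreover have "2 * pi * (1 - x) \<le> pi" using False mult_left_mono[of "1 - x" "1 / 2" "2 * pi"] by simp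
    then have "arccos (?c (1 - x)) = 2 * pi * (1 - x)" using that by (intro arccos_cos) auto
    ultimately show ?thesis using s[OF that] by (simp add: U_def)
  qed
  have Uc: "continuous_on {-1..1} U"
    unfolding U_def
  proof (rule continuous_on_compose2[OF c])
    show "continuous_on {-1..1} (\<lambda>y. arccos y / (2 * pi))"
      by (intro continuous_intros) auto
    show "(\<lambda>y. arccos y / (2 * pi)) ` {-1..1} \<subseteq> {0..1}"
    proof clarify
      fix y :: real assume "y \<in> {-1..1}"
      then have "0 \<le> arccos y" "arccos y \<le> pi" using arccos_lbound arccos_ubound by auto
      then show "arccos y / (2 * pi) \<in> {0..1}" by (auto simp: divide_simps)
    qed
  qed
  define I where "I = integral {0..1} (\<lambda>x. \<bar>u x\<bar>)"
  have I0: "I \<ge> 0" unfolding I_def by (intro integral_nonneg integrable_continuous_real continuous_intros c) auto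
  \<comment> \<open>As \<open>u\<close> is orthogonal to every polynomial in
    \<open>cos (2 pi x)\<close>, its square integral equals that of \<open>u * (u - g)\<close>,
    which is arbitrarily small.\<close>
  have "integral {0..1} (\<lambda>x. (u x)\<^sup>2) \<le> 0"
  proof (rule field_le_epsilon)
    fix e :: real assume "e > 0"
    define \<epsilon> where "\<epsilon> = e / (I + 1)"
    have \<epsilon>: "\<epsilon> > 0" using \<open>e > 0\<close> I0 by (simp add: \<epsilon>_def)
    obtain g where g: "real_polynomial_function g" "\<And>y. y \<in> {-1..1} \<Longrightarrow> \<bar>U y - g y\<bar> < \<epsilon>"
      using Stone_Weierstrass_real_polynomial_function[OF compact_Icc Uc \<epsilon>] by blast
    obtain a N where g': "g = (\<lambda>y. \<Sum>i\<le>N. a i * y ^ i)"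
      using g(1) real_polynomial_function_iff_sum by metis
    have gc: "continuous_on {0..1} (\<lambda>x. g (?c x))" unfolding g' by (intro continuous_intros)
    have "integral {0..1} (\<lambda>x. u x * g (?c x)) = integral {0..1} (\<lambda>x. \<Sum>i\<le>N. a i * (u x * ?c x ^ i))"
      unfolding g' by (simp add: sum_distrib_left mult_ac)
    also have "\<dots> = (\<Sum>i\<le>N. integral {0..1} (\<lambda>x. a i * (u x * ?c x ^ i)))"
      by (rule integral_sum) (auto intro!: integrable_continuous_real continuous_intros c)
    also have "\<dots> = 0" using mom[of _ 0] by simp
    finally have g0: "integral {0..1} (\<lambda>x. u x * g (?c x)) = 0" .
    have "integral {0..1} (\<lambda>x. (u x)\<^sup>2) = integral {0..1} (\<lambda>x. u x * u x) - integral {0..1} (\<lambda>x. u x * g (?c x))"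
      by (simp add: g0 power2_eq_square)
    also have "\<dots> = integral {0..1} (\<lambda>x. u x * u x - u x * g (?c x))"
      by (intro Henstock_Kurzweil_Integration.integral_diff[symmetric] integrable_continuous_real continuous_intros c gc)
    also have "\<dots> \<le> integral {0..1} (\<lambda>x. \<epsilon> * \<bar>u x\<bar>)"
    proof (rule integral_le)
      fix x :: real assume x: "x \<in> {0..1}"
      have "u x * u x - u x * g (?c x) = u x * (U (?c x) - g (?c x))" by (simp add: U[OF x] algebra_simps)
      also have "\<dots> \<le> \<bar>u x\<bar> * \<bar>U (?c x) - g (?c x)\<bar>" by (simp flip: abs_mult)
      also have "\<dots> \<le> \<bar>u x\<bar> * \<epsilon>" using g(2)[of "?c x"] by (intro mult_left_mono) auto
      finally show "u x * u x - u x * g (?c x) \<le> \<epsilon> * \<bar>u x\<bar>" by (simp add: mult.commute)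
    qed (intro integrable_continuous_real continuous_intros c gc)+
    also have "\<dots> = \<epsilon> * I" by (simp add: I_def)
    also have "\<dots> \<le> e" using \<open>e > 0\<close> I0 by (simp add: \<epsilon>_def field_simps)
    finally show "integral {0..1} (\<lambda>x. (u x)\<^sup>2) \<le> 0 + e" by simp
  qed
  moreover have "integral {0..1} (\<lambda>x. (u x)\<^sup>2) \<ge> 0"
    by (intro integral_nonneg integrable_continuous_real continuous_intros c) auto
  ultimately have "integral {0..1} (\<lambda>x. (u x)\<^sup>2) = 0" by simp
  then have "\<forall>x\<in>{0..1}. (u x)\<^sup>2 = 0"
    using integral_eq_0_iff[of 0 1 "\<lambda>x. (u x)\<^sup>2"] c by (auto intro!: continuous_intros)
  then show ?thesis using x by simp
qed

text \<open>Poisson summation by uniqueness: both sides are continuous, symmetric about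
  \<open>1 / 2\<close> and have the same cosine coefficients.\<close>

lemma wrapped_eq_theta:
  assumes t: "t > 0" and x: "x \<in> {0..1}"
  shows "wrapped (sqrt t) x = theta t x"
proof -
  have \<sigma>: "sqrt t > 0" using t by simp
  have "wrapped (sqrt t) x - theta t x = 0"
  proof (rule cos_moments_unique[OF _ _ _ x])
    show "continuous_on {0..1} (\<lambda>x. wrapped (sqrt t) x - theta t x)"
      by (intro continuous_intros wrapped_continuous theta_continuous t \<sigma>)
    show "wrapped (sqrt t) (1 - x) - theta t (1 - x) = wrapped (sqrt t) x - theta t x" for x
      by (simp add: wrapped_reflect[OF \<sigma>] theta_reflect)
    fix m :: int
    let ?c = "\<lambda>x. cosine m x"
    have "integral {0..1} (\<lambda>x. (wrapped (sqrt t) x - theta t x) * ?c x)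
        = integral {0..1} (\<lambda>x. wrapped (sqrt t) x * ?c x) - integral {0..1} (\<lambda>x. theta t x * ?c x)"
      unfolding left_diff_distrib
      by (intro Henstock_Kurzweil_Integration.integral_diff integrable_continuous_real continuous_intros
          wrapped_continuous theta_continuous t \<sigma>)
    also have "\<dots> = 0"
      using t unfolding wrapped_cos_integral[OF \<sigma>] theta_cos_integral[OF t] by simp
    finally show "integral {0..1} (\<lambda>x. (wrapped (sqrt t) x - theta t x) * ?c x) = 0" .
  qed
  then show ?thesis by simp
qed

section \<open>Total variation distances\<close>

lemma measure_density_real:
  fixes f :: "'a \<Rightarrow> real"
  assumes f: "integrable L f" "\<And>x. f x \<ge> 0" and A: "A \<in> sets L"
  shows "measure (density L (\<lambda>x. ennreal (f x))) A = (LINT x|L. f x * indicator A x)"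
proof -
  have i: "integrable L (\<lambda>x. f x * indicator A x)" using integrable_real_mult_indicator[OF A f(1)] .
  have "emeasure (density L (\<lambda>x. ennreal (f x))) A = (\<integral>\<^sup>+x. ennreal (f x * indicator A x) \<partial>L)"
    using f A by (subst emeasure_density) (auto intro!: nn_integral_cong simp: indicator_def)
  also have "\<dots> = ennreal (LINT x|L. f x * indicator A x)"
    using i f by (intro nn_integral_eq_integral) auto
  finally show ?thesis
    using f by (simp add: measure_def integral_nonneg_AE)
qed

text \<open>Since the total masses agree, twice the integral of \<open>f - h\<close> over a set is
  its integral against a sign, 1 on the set and -1 off it. The supremum is attained where
  \<open>f\<close> exceeds \<open>h\<close>.\<close>

lemma tv_dist_density:
  fixes f h :: "'a \<Rightarrow> real"
  assumes f: "integrable L f" "\<And>x. f x \<ge> 0" and h: "integrable L h" "\<And>x. h x \<ge> 0"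
    and eq: "(LINT x|L. f x) = (LINT x|L. h x)"
  shows "tv_dist (density L (\<lambda>x. ennreal (f x))) (density L (\<lambda>x. ennreal (h x))) = (LINT x|L. \<bar>f x - h x\<bar>) / 2"
proof -
  let ?M = "\<lambda>f. density L (\<lambda>x. ennreal (f x))"
  let ?d = "\<lambda>x. f x - h x"
  have d: "integrable L ?d" "integrable L (\<lambda>x. \<bar>?d x\<bar>)" using f h by auto
  have d0: "(LINT x|L. ?d x) = 0" using f h eq by simp
  have diff: "measure (?M f) A - measure (?M h) A
      = (LINT x|L. ?d x * indicator A x)" if "A \<in> sets L" for A
    using integrable_real_mult_indicator[OF that f(1)] integrable_real_mult_indicator[OF that h(1)]
    by (simp add: measure_density_real[OF f that] measure_density_real[OF h that] left_diff_distrib)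
  have half: "2 * (LINT x|L. ?d x * indicator A x) = (LINT x|L. ?d x * (2 * indicator A x - 1))" if "A \<in> sets L" for A
  proof -
    have i: "integrable L (\<lambda>x. ?d x * indicator A x)" by (rule integrable_real_mult_indicator[OF that d(1)])
    have "(LINT x|L. ?d x * (2 * indicator A x - 1)) = (LINT x|L. 2 * (?d x * indicator A x) - ?d x)"
      by (simp add: algebra_simps)
    also have "\<dots> = (LINT x|L. 2 * (?d x * indicator A x)) - (LINT x|L. ?d x)"
      using i d(1) by (intro Bochner_Integration.integral_diff integrable_mult_right) auto
    finally show ?thesis unfolding d0 by simp
  qed
  show ?thesis
    unfolding tv_dist_def
  proof (rule cSup_eq_maximum)
    let ?A = "{x \<in> space L. ?d x > 0}"
    have A: "?A \<in> sets L" using d(1) by measurable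
    have "2 * (LINT x|L. ?d x * indicator ?A x) = (LINT x|L. \<bar>?d x\<bar>)"
      unfolding half[OF A] by (intro Bochner_Integration.integral_cong refl) (auto simp: indicator_def)
    moreover have "(LINT x|L. \<bar>?d x\<bar>) \<ge> 0" by simp
    ultimately have "(LINT x|L. \<bar>?d x\<bar>) / 2 = \<bar>measure (?M f) ?A - measure (?M h) ?A\<bar>"
      unfolding diff[OF A] by linarith
    then show "(LINT x|L. \<bar>?d x\<bar>) / 2 \<in> (\<lambda>A. \<bar>measure (?M f) A - measure (?M h) A\<bar>)
        ` sets (?M f)"
      using A by (intro image_eqI[of _ _ ?A]) auto
  next
    fix y assume "y \<in> (\<lambda>A. \<bar>measure (?M f) A - measure (?M h) A\<bar>)
        ` sets (?M f)"
    then obtain A where A: "A \<in> sets L" and y: "y = \<bar>(LINT x|L. ?d x * indicator A x)\<bar>"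
      using diff by auto
    have "2 * y = \<bar>(LINT x|L. ?d x * (2 * indicator A x - 1))\<bar>" unfolding half[OF A, symmetric] y by simp
    also have "\<dots> \<le> (LINT x|L. \<bar>?d x * (2 * indicator A x - 1)\<bar>)" by (rule integral_abs_bound)
    also have "\<dots> = (LINT x|L. \<bar>?d x\<bar>)"
      by (intro Bochner_Integration.integral_cong refl) (auto simp: indicator_def)
    finally show "y \<le> (LINT x|L. \<bar>?d x\<bar>) / 2" by simp
  qed
qed

lemma tv_dist_pmf:
  assumes A: "finite A" "set_pmf p \<subseteq> A" "set_pmf q \<subseteq> A"
  shows "tv_dist (measure_pmf p) (measure_pmf q) = (\<Sum>x\<in>A. \<bar>pmf p x - pmf q x\<bar>) / 2"
proof -
  have i: "integrable (count_space UNIV) (pmf r)" "(LINT x|count_space UNIV. pmf r x) = 1"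
    for r :: "'a pmf"
    by (simp_all add: integrable_pmf integral_pmf)
  have "tv_dist (measure_pmf p) (measure_pmf q) = (LINT x|count_space UNIV. \<bar>pmf p x - pmf q x\<bar>) / 2"
    unfolding measure_pmf_eq_density[of p] measure_pmf_eq_density[of q]
    by (rule tv_dist_density) (auto simp: i)
  also have "(LINT x|count_space UNIV. \<bar>pmf p x - pmf q x\<bar>) = (\<Sum>x\<in>{x. \<bar>pmf p x - pmf q x\<bar> \<noteq> 0}. \<bar>pmf p x - pmf q x\<bar>)"
  proof -
    have "finite {x. \<bar>pmf p x - pmf q x\<bar> \<noteq> 0}"
      by (rule finite_subset[OF _ A(1)]) (use A in \<open>force simp: set_pmf_eq\<close>)
    then show ?thesis by (subst lebesgue_integral_count_space_finite_support) auto
  qed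
  also have "\<dots> = (\<Sum>x\<in>A. \<bar>pmf p x - pmf q x\<bar>)"
    by (rule sum.mono_neutral_left) (use A in \<open>force simp: set_pmf_eq\<close>)+
  finally show ?thesis .
qed

section \<open>The law of Brownian motion on the torus\<close>

abbreviation unit_square :: "(real \<times> real) set" where
  "unit_square \<equiv> {0..<1} \<times> {0..<1}"

lemma emeasure_rectangle:
  fixes a b c d :: real
  assumes "a \<le> b" "c \<le> d"
  shows "emeasure lborel ({a..<b} \<times> {c..<d}) = ennreal ((b - a) * (d - c))"
proof -
  have "emeasure lborel ({a..<b} \<times> {c..<d}) = emeasure lborel {a..<b} * emeasure lborel {c..<d}"
    unfolding lborel_prod[symmetric] by (rule lborel.emeasure_pair_measure_Times) auto
  then show ?thesis using assms by (simp add: ennreal_mult)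
qed

lemma rectangle_measurable [measurable]:
  fixes a b c d :: real
  shows "{a..<b} \<times> {c..<d} \<in> sets borel"
  unfolding borel_prod[symmetric] by measurable

lemma uniform_torus_density:
  "uniform_torus = density lborel (\<lambda>z. ennreal (indicator unit_square z))"
proof -
  have "emeasure lborel unit_square = 1" using emeasure_rectangle[of 0 1 0 1] by simp
  then show ?thesis
    unfolding uniform_torus_def uniform_measure_def by (simp add: ennreal_indicator divide_ennreal_def)
qed

lemma theta_measurable [measurable]: "theta t \<in> borel_measurable borel"
  unfolding theta_def[abs_def] by measurable

text \<open>Positivity is invisible in the Fourier series and is imported from the wrapped
  Gaussian.\<close>

lemma theta_nonneg: "t > 0 \<Longrightarrow> x \<in> {0..1} \<Longrightarrow> theta t x \<ge> 0"
  using wrapped_nonneg[of "sqrt t" x] wrapped_eq_theta[of t x] by simp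

definition torus_density :: "real \<Rightarrow> real \<times> real \<Rightarrow> real" where
  "torus_density t z = theta t (fst z) * theta t (snd z)"

lemma torus_density_measurable [measurable]: "torus_density t \<in> borel_measurable borel"
  unfolding torus_density_def[abs_def] borel_prod[symmetric] by measurable

lemma torus_proj_measurable [measurable]: "torus_proj \<in> borel_measurable borel"
  unfolding torus_proj_def[abs_def] borel_prod[symmetric] by measurable

lemma nn_integral_torus_proj:
  assumes t: "t > 0" and [measurable]: "G \<in> borel_measurable borel"
  shows "(\<integral>\<^sup>+z. ennreal (gauss2_density t z) * G (torus_proj z) \<partial>lborel)
       = (\<integral>\<^sup>+z. ennreal (torus_density t z * indicator unit_square z) * G z \<partial>lborel)"
proof -
  let ?g = "\<lambda>x. ennreal (normal_density 0 (sqrt t) x)"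
  let ?W = "\<lambda>x. ennreal (wrapped (sqrt t) x) * indicator {0..<1} x"
  have \<sigma>: "sqrt t > 0" using t by simp
  have [measurable]: "G \<in> borel_measurable (borel \<Otimes>\<^sub>M borel)" by (simp add: borel_prod)
  define F where "F x = (\<integral>\<^sup>+y. G (x, y) * ?W y \<partial>lborel)" for x
  have F [measurable]: "F \<in> borel_measurable borel"
    unfolding F_def[abs_def] by (rule lborel.borel_measurable_nn_integral) measurable
  have "(\<integral>\<^sup>+z. ennreal (gauss2_density t z) * G (torus_proj z) \<partial>lborel)
      = (\<integral>\<^sup>+z. ?g (fst z) * ?g (snd z) * G (frac (fst z), frac (snd z)) \<partial>(lborel \<Otimes>\<^sub>M lborel))"
    unfolding lborel_prod by (simp add: gauss2_density_def torus_proj_def ennreal_mult)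
  also have "\<dots> = (\<integral>\<^sup>+x. \<integral>\<^sup>+y. ?g x * ?g y * G (frac x, frac y) \<partial>lborel \<partial>lborel)"
    by (subst lborel.nn_integral_fst[symmetric]) simp_all
  also have "\<dots> = (\<integral>\<^sup>+x. F (frac x) * ?g x \<partial>lborel)"
  proof (rule nn_integral_cong)
    fix x :: real
    have "(\<integral>\<^sup>+y. ?g x * ?g y * G (frac x, frac y) \<partial>lborel) = ?g x * (\<integral>\<^sup>+y. G (frac x, frac y) * ?g y \<partial>lborel)"
      by (subst nn_integral_cmult[symmetric]) (auto simp: mult_ac)
    also have "(\<integral>\<^sup>+y. G (frac x, frac y) * ?g y \<partial>lborel) = F (frac x)"
      unfolding F_def by (rule nn_integral_frac_normal[OF \<sigma>]) measurable
    finally show "(\<integral>\<^sup>+y. ?g x * ?g y * G (frac x, frac y) \<partial>lborel) = F (frac x) * ?g x"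
      by (simp add: mult.commute)
  qed
  also have "\<dots> = (\<integral>\<^sup>+x. F x * ?W x \<partial>lborel)"
    by (rule nn_integral_frac_normal[OF \<sigma> F])
  also have "\<dots> = (\<integral>\<^sup>+x. \<integral>\<^sup>+y. ?W x * ?W y * G (x, y) \<partial>lborel \<partial>lborel)"
  proof (rule nn_integral_cong)
    fix x :: real
    show "F x * ?W x = (\<integral>\<^sup>+y. ?W x * ?W y * G (x, y) \<partial>lborel)"
      unfolding F_def by (subst nn_integral_multc[symmetric]) (auto simp: mult_ac)
  qed
  also have "\<dots> = (\<integral>\<^sup>+z. ?W (fst z) * ?W (snd z) * G (fst z, snd z) \<partial>(lborel \<Otimes>\<^sub>M lborel))"
    by (subst lborel.nn_integral_fst[symmetric]) simp_all
  also have "\<dots> = (\<integral>\<^sup>+z. ennreal (torus_density t z * indicator unit_square z) * G z \<partial>lborel)"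
    unfolding lborel_prod
  proof (rule nn_integral_cong)
    fix z :: "real \<times> real"
    show "?W (fst z) * ?W (snd z) * G (fst z, snd z) = ennreal (torus_density t z * indicator unit_square z) * G z"
    proof (cases "z \<in> unit_square")
      case True
      then have z: "fst z \<in> {0..1}" "snd z \<in> {0..1}" by (auto simp: mem_Times_iff)
      show ?thesis using True t z theta_nonneg[OF t z(1)] theta_nonneg[OF t z(2)]
        by (simp add: wrapped_eq_theta[OF t z(1)] wrapped_eq_theta[OF t z(2)] torus_density_def ennreal_mult indicator_def mem_Times_iff)
    next
      case False
      then show ?thesis by (auto simp: indicator_def mem_Times_iff)
    qed
  qed
  finally show ?thesis .
qed

lemma distr_torus_proj:
  assumes "planar_brownian_motion M B" and t: "t > 0"
  shows "distr M borel (\<lambda>\<omega>. torus_proj (B t \<omega>)) = density lborel (\<lambda>z. ennreal (torus_density t z * indicator unit_square z))"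
proof (rule measure_eqI)
  interpret planar_brownian_motion M B by fact
  fix A assume "A \<in> sets (distr M borel (\<lambda>\<omega>. torus_proj (B t \<omega>)))"
  then have A [measurable]: "A \<in> sets borel" by simp
  have Bt [measurable]: "B t \<in> borel_measurable M" "B 0 \<in> borel_measurable M"
    using random_variable[of t] random_variable[of 0] t by auto
  have D: "distributed M lborel (\<lambda>\<omega>. B t \<omega> - B 0 \<omega>) (gauss2_density t)"
    using gaussian_increments[of 0 t] t by simp
  have "emeasure (distr M borel (\<lambda>\<omega>. torus_proj (B t \<omega>))) A = (\<integral>\<^sup>+z. indicator A z \<partial>distr M borel (\<lambda>\<omega>. torus_proj (B t \<omega>)))"
    by simp
  also have "\<dots> = (\<integral>\<^sup>+\<omega>. indicator A (torus_proj (B t \<omega>)) \<partial>M)"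
    by (rule nn_integral_distr) auto
  \<comment> \<open>The Gaussian assumption concerns increments, so the almost surely vanishing
    start is subtracted.\<close>
  also have "\<dots> = (\<integral>\<^sup>+\<omega>. indicator A (torus_proj (B t \<omega> - B 0 \<omega>)) \<partial>M)"
    using start by (intro nn_integral_cong_AE) (auto elim!: eventually_mono simp: zero_prod_def[symmetric])
  also have "\<dots> = (\<integral>\<^sup>+z. ennreal (gauss2_density t z) * indicator A (torus_proj z) \<partial>lborel)"
    by (rule distributed_nn_integral[OF D, symmetric]) measurable
  also have "\<dots> = (\<integral>\<^sup>+z. ennreal (torus_density t z * indicator unit_square z) * indicator A z \<partial>lborel)"
    by (rule nn_integral_torus_proj[OF t]) measurable
  also have "\<dots> = emeasure (density lborel (\<lambda>z. ennreal (torus_density t z * indicator unit_square z))) A"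
    by (subst emeasure_density) auto
  finally show "emeasure (distr M borel (\<lambda>\<omega>. torus_proj (B t \<omega>))) A
    = emeasure (density lborel (\<lambda>z. ennreal (torus_density t z * indicator unit_square z))) A" .
qed simp

lemma unit_square_integrable:
  fixes F :: "real \<times> real \<Rightarrow> real"
  assumes [measurable]: "F \<in> borel_measurable borel" and b: "\<And>z. \<bar>F z\<bar> \<le> c"
  shows "integrable lborel (\<lambda>z. F z * indicator unit_square z)"
proof (rule Bochner_Integration.integrable_bound[of _ "\<lambda>z. c * indicator unit_square z"])
  have "integrable lborel (indicator unit_square :: _ \<Rightarrow> real)"
    using emeasure_rectangle[of 0 1 0 1] by (intro integrable_real_indicator) auto
  then show "integrable lborel (\<lambda>z. c * indicator unit_square z)" by simp
  have "0 \<le> c" using b[of 0] by linarith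
  then show "AE z in lborel. norm (F z * indicator unit_square z) \<le> norm (c * indicator unit_square z :: real)"
    using b by (auto simp: indicator_def intro: order_trans)
qed simp

lemma torus_density_bound:
  assumes t: "0 < t0" "t0 \<le> t"
  shows "\<bar>torus_density t z\<bar> \<le> ((1 + nome t0) / (1 - nome t0))\<^sup>2"
  unfolding torus_density_def abs_mult power2_eq_square
  using theta_bound[OF t] by (intro mult_mono) (auto intro: order_trans[OF abs_ge_zero])

lemma d_Br_formula:
  assumes BM: "planar_brownian_motion M B" and t: "t > 0"
  shows "d_Br M B t = (LINT z|lborel. \<bar>torus_density t z - 1\<bar> * indicator unit_square z) / 2"
proof -
  interpret planar_brownian_motion M B by fact
  have [measurable]: "B t \<in> borel_measurable M" using random_variable[of t] t by simp
  interpret D: prob_space "distr M borel (\<lambda>\<omega>. torus_proj (B t \<omega>))"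
    by (rule prob_space_distr) measurable
  have nn: "torus_density t z * indicator unit_square z \<ge> 0" for z
    using theta_nonneg[OF t] by (auto simp: torus_density_def indicator_def mem_Times_iff)
  have i1: "integrable lborel (\<lambda>z. torus_density t z * indicator unit_square z)"
    by (rule unit_square_integrable[OF _ torus_density_bound[OF t order_refl]]) measurable
  have "(\<integral>\<^sup>+z. ennreal (torus_density t z * indicator unit_square z) \<partial>lborel) = 1"
    using D.emeasure_space_1 unfolding distr_torus_proj[OF BM t] by (simp add: emeasure_density)
  then have one: "(LINT z|lborel. torus_density t z * indicator unit_square z) = 1"
    using nn by (subst integral_eq_nn_integral) auto
  have i2: "integrable lborel (indicator unit_square :: _ \<Rightarrow> real)" 
    using unit_square_integrable[of "\<lambda>_. 1" 1] by simp
  have one': "(LINT z|lborel. indicator unit_square z :: real) = 1"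
    using emeasure_rectangle[of 0 1 0 1] by (simp add: measure_def)
  have "d_Br M B t = (LINT z|lborel. \<bar>torus_density t z * indicator unit_square z - indicator unit_square z\<bar>) / 2"
    unfolding d_Br_def distr_torus_proj[OF BM t] uniform_torus_density
    by (rule tv_dist_density) (use nn i1 i2 one one' in auto)
  also have "(LINT z|lborel. \<bar>torus_density t z * indicator unit_square z - indicator unit_square z\<bar>)
      = (LINT z|lborel. \<bar>torus_density t z - 1\<bar> * indicator unit_square z)"
    by (intro Bochner_Integration.integral_cong refl) (auto simp: indicator_def)
  finally show ?thesis .
qed

section \<open>Truncated densities and Riemann sums\<close>

definition torus_density_part :: "nat \<Rightarrow> real \<Rightarrow> real \<times> real \<Rightarrow> real" where
  "torus_density_part R t z = theta_part R t (fst z) * theta_part R t (snd z)"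

lemma torus_density_part_measurable [measurable]: "torus_density_part R t \<in> borel_measurable borel"
  unfolding torus_density_part_def[abs_def] theta_part_def borel_prod[symmetric] by measurable

lemma abs_mult_diff_le:
  fixes a b c d K :: real
  assumes "\<bar>b\<bar> \<le> K" "\<bar>c\<bar> \<le> K"
  shows "\<bar>a * b - c * d\<bar> \<le> K * (\<bar>a - c\<bar> + \<bar>b - d\<bar>)"
proof -
  have "a * b - c * d = (a - c) * b + c * (b - d)" by (simp add: algebra_simps)
  also have "\<bar>\<dots>\<bar> \<le> \<bar>a - c\<bar> * \<bar>b\<bar> + \<bar>c\<bar> * \<bar>b - d\<bar>"
    by (intro order_trans[OF abs_triangle_ineq]) (simp add: abs_mult)
  also have "\<dots> \<le> \<bar>a - c\<bar> * K + K * \<bar>b - d\<bar>"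
    using assms by (intro add_mono mult_left_mono mult_right_mono) auto
  finally show ?thesis by (simp add: algebra_simps)
qed

lemma torus_density_approx:
  assumes t: "0 < t0" "t0 \<le> t"
  shows "\<bar>torus_density t z - torus_density_part R t z\<bar>
    \<le> 4 * (1 + nome t0) / (1 - nome t0)\<^sup>2 * nome t0 ^ Suc R"
proof -
  let ?q = "nome t0"
  have q: "0 < ?q" "?q < 1" using nome_bounds t by auto
  have "\<bar>torus_density t z - torus_density_part R t z\<bar>
    \<le> (1 + ?q) / (1 - ?q) * (\<bar>theta t (fst z) - theta_part R t (fst z)\<bar> + \<bar>theta t (snd z) - theta_part R t (snd z)\<bar>)"
    unfolding torus_density_def torus_density_part_def
    by (rule abs_mult_diff_le[OF theta_bound[OF t] theta_part_bound[OF t]])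
  also have "\<dots> \<le> (1 + ?q) / (1 - ?q) * (2 * ?q ^ Suc R / (1 - ?q) + 2 * ?q ^ Suc R / (1 - ?q))"
    using q by (intro mult_left_mono add_mono theta_approx[OF t]) auto
  also have "\<dots> = 4 * (1 + ?q) / (1 - ?q)\<^sup>2 * ?q ^ Suc R"
    by (simp add: power2_eq_square)
  finally show ?thesis .
qed

text \<open>The exponential coefficients are bounded by 1, so this Lipschitz constant of
  \<open>theta_part R t\<close> is uniform in \<open>t\<close>.\<close>

definition theta_lipschitz :: "nat \<Rightarrow> real" where
  "theta_lipschitz R = 2 * (\<Sum>j<R. 2 * pi * real (Suc j))"

lemma abs_cos_diff_le: "\<bar>cos x - cos y\<bar> \<le> \<bar>x - (y::real)\<bar>"
proof -
  have "\<bar>cos x - cos y\<bar> = 2 * (\<bar>sin ((x + y) / 2)\<bar> * \<bar>sin ((y - x) / 2)\<bar>)"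
    unfolding cos_diff_cos by (simp add: abs_mult)
  also have "\<dots> \<le> 2 * (1 * \<bar>(y - x) / 2\<bar>)"
    by (intro mult_left_mono mult_mono abs_sin_x_le_abs_x) auto
  finally show ?thesis by (simp add: abs_minus_commute)
qed

lemma theta_part_lipschitz:
  assumes t: "t > 0"
  shows "\<bar>theta_part R t x - theta_part R t y\<bar> \<le> theta_lipschitz R * \<bar>x - y\<bar>"
proof -
  have e: "theta_part R t x - theta_part R t y = 2 * (\<Sum>j<R. exp (- 2 * pi\<^sup>2 * (real (Suc j))\<^sup>2 * t)
      * (cos (2 * pi * real (Suc j) * x) - cos (2 * pi * real (Suc j) * y)))"
    unfolding theta_part_def by (simp add: right_diff_distrib sum_subtractf del: of_nat_Suc)
  have "\<bar>theta_part R t x - theta_part R t y\<bar> \<le> 2 * (\<Sum>j<R. 1 * (2 * pi * real (Suc j) * \<bar>x - y\<bar>))"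
    unfolding e abs_mult[of 2] abs_numeral
  proof (intro mult_left_mono order_trans[OF sum_abs] sum_mono)
    fix j
    have "\<bar>cos (2 * pi * real (Suc j) * x) - cos (2 * pi * real (Suc j) * y)\<bar> \<le> \<bar>2 * pi * real (Suc j) * x - 2 * pi * real (Suc j) * y\<bar>"
      by (rule abs_cos_diff_le)
    also have "\<dots> = 2 * pi * real (Suc j) * \<bar>x - y\<bar>"
      unfolding right_diff_distrib[symmetric] abs_mult by (simp del: of_nat_Suc)
    finally show "\<bar>exp (- 2 * pi\<^sup>2 * (real (Suc j))\<^sup>2 * t)
      * (cos (2 * pi * real (Suc j) * x) - cos (2 * pi * real (Suc j) * y))\<bar> \<le> 1 * (2 * pi * real (Suc j) * \<bar>x - y\<bar>)"
      unfolding abs_mult using t by (intro mult_mono) (auto simp del: of_nat_Suc)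
  qed simp
  then show ?thesis by (simp add: theta_lipschitz_def sum_distrib_left mult_ac del: of_nat_Suc)
qed

abbreviation grid :: "nat \<Rightarrow> square \<Rightarrow> real \<times> real" where
  "grid n x \<equiv> (of_int (fst x) / real n, of_int (snd x) / real n)"

text \<open>In each cell of side \<open>1 / n\<close> a point differs from the lower corner by at
  most \<open>1 / n\<close> per coordinate, so the error is at most \<open>2 K / n\<close> on a set
  of measure 1.\<close>

lemma riemann_square:
  fixes F :: "real \<times> real \<Rightarrow> real"
  assumes n: "n > 0" and lip: "\<And>z w. \<bar>F z - F w\<bar> \<le> K * (\<bar>fst z - fst w\<bar> + \<bar>snd z - snd w\<bar>)"
    and K: "K \<ge> 0" and int: "integrable lborel (\<lambda>z. F z * indicator unit_square z)"
  shows "\<bar>(LINT z|lborel. F z * indicator unit_square z)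
    - (\<Sum>x\<in>board n. F (grid n x)) / real n ^ 2\<bar> \<le> 2 * K / real n"
proof -
  define p where "p x = grid n x" for x
  define C where "C x = {of_int (fst x) / real n..<(of_int (fst x) + 1) / real n}
      \<times> {of_int (snd x) / real n..<(of_int (snd x) + 1) / real n}" for x :: square
  have C [measurable]: "C x \<in> sets borel" for x unfolding C_def by measurable
  have cell: "a / real n \<le> y \<and> y < (a + 1) / real n \<longleftrightarrow> a \<le> real n * y \<and> real n * y < a + 1" for a y
    using n by (auto simp: divide_simps mult.commute)
  have memC: "z \<in> C x \<longleftrightarrow> \<lfloor>real n * fst z\<rfloor> = fst x \<and> \<lfloor>real n * snd z\<rfloor> = snd x" for x z
    unfolding C_def mem_Times_iff atLeastLessThan_iff cell floor_eq_iff ..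
  have fin: "finite (board n)" by (simp add: board_def)
  have floor_range: "\<lfloor>real n * y\<rfloor> \<in> {0..<int n} \<longleftrightarrow> y \<in> {0..<1}" for y
  proof -
    have "real n * y < real n \<longleftrightarrow> y < 1" "0 \<le> real n * y \<longleftrightarrow> 0 \<le> y" using n by (auto simp: zero_le_mult_iff)
    then show ?thesis by (auto simp: floor_less_iff)
  qed
  have part: "(\<Sum>x\<in>board n. a x * indicator (C x) z) = a (\<lfloor>real n * fst z\<rfloor>, \<lfloor>real n * snd z\<rfloor>) * indicator unit_square z"
    for a :: "square \<Rightarrow> real" and z
  proof -
    have "(\<Sum>x\<in>board n. a x * indicator (C x) z) = (\<Sum>x\<in>board n. if x = (\<lfloor>real n * fst z\<rfloor>, \<lfloor>real n * snd z\<rfloor>) then a x else 0)"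
      by (intro sum.cong refl) (auto simp: memC indicator_def prod_eq_iff)
    also have "\<dots> = (if (\<lfloor>real n * fst z\<rfloor>, \<lfloor>real n * snd z\<rfloor>) \<in> board n then a (\<lfloor>real n * fst z\<rfloor>, \<lfloor>real n * snd z\<rfloor>) else 0)"
      using fin by simp
    also have "(\<lfloor>real n * fst z\<rfloor>, \<lfloor>real n * snd z\<rfloor>) \<in> board n \<longleftrightarrow> z \<in> unit_square"
      unfolding board_def mem_Times_iff fst_conv snd_conv floor_range ..
    finally show ?thesis by (simp add: indicator_def)
  qed
  have mC: "measure lborel (C x) = 1 / real n ^ 2" "emeasure lborel (C x) < \<infinity>" for x
  proof -
    have e: "(of_int a + 1) / real n - of_int a / real n = 1 / real n" for a :: int
      by (simp add: diff_divide_distrib[symmetric])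
    have "emeasure lborel (C x) = ennreal (1 / real n * (1 / real n))"
      unfolding C_def using emeasure_rectangle[of "of_int (fst x) / real n" "(of_int (fst x) + 1) / real n"
          "of_int (snd x) / real n" "(of_int (snd x) + 1) / real n"] by (simp add: e divide_right_mono)
    then show "measure lborel (C x) = 1 / real n ^ 2" "emeasure lborel (C x) < \<infinity>"
      by (simp_all add: measure_def power2_eq_square)
  qed
  have iC: "integrable lborel (\<lambda>z. a x * indicator (C x) z)" for a :: "square \<Rightarrow> real" and x
    using mC(2) by (intro integrable_mult_right integrable_real_indicator) auto
  have "(LINT z|lborel. (\<Sum>x\<in>board n. F (p x) * indicator (C x) z)) = (\<Sum>x\<in>board n. (LINT z|lborel. F (p x) * indicator (C x) z))"
    by (rule Bochner_Integration.integral_sum) (rule iC)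
  also have "\<dots> = (\<Sum>x\<in>board n. F (p x)) / real n ^ 2"
    by (simp add: mC(1) sum_divide_distrib)
  finally have S: "(LINT z|lborel. (\<Sum>x\<in>board n. F (p x) * indicator (C x) z)) = (\<Sum>x\<in>board n. F (p x)) / real n ^ 2" .
  have iS: "integrable lborel (\<lambda>z. \<Sum>x\<in>board n. F (p x) * indicator (C x) z)"
    by (rule Bochner_Integration.integrable_sum) (rule iC)
  have "\<bar>(LINT z|lborel. F z * indicator unit_square z) - (\<Sum>x\<in>board n. F (p x)) / real n ^ 2\<bar>
      = \<bar>(LINT z|lborel. F z * indicator unit_square z - (\<Sum>x\<in>board n. F (p x) * indicator (C x) z))\<bar>"
    unfolding S[symmetric] by (subst Bochner_Integration.integral_diff[OF int iS]) simp
  also have "\<dots> \<le> (LINT z|lborel. \<bar>F z * indicator unit_square z - (\<Sum>x\<in>board n. F (p x) * indicator (C x) z)\<bar>)"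
    by (rule integral_abs_bound)
  also have "\<dots> \<le> (LINT z|lborel. 2 * K / real n * indicator unit_square z)"
  proof (rule integral_mono)
    show "integrable lborel (\<lambda>z. \<bar>F z * indicator unit_square z - (\<Sum>x\<in>board n. F (p x) * indicator (C x) z)\<bar>)"
      using int iS by simp
    show "integrable lborel (\<lambda>z. 2 * K / real n * indicator unit_square z)"
      by (rule unit_square_integrable[where c = "\<bar>2 * K / real n\<bar>"]) auto
    fix z :: "real \<times> real"
    have d: "\<bar>y - of_int \<lfloor>real n * y\<rfloor> / real n\<bar> \<le> 1 / real n" for y
    proof -
      have "y - of_int \<lfloor>real n * y\<rfloor> / real n = frac (real n * y) / real n"
        using n by (simp add: frac_def diff_divide_distrib)
      then show ?thesis using frac_ge_0[of "real n * y"] frac_lt_1[of "real n * y"] n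
        by (simp add: divide_right_mono)
    qed
    let ?w = "p (\<lfloor>real n * fst z\<rfloor>, \<lfloor>real n * snd z\<rfloor>)"
    have "\<bar>fst z - fst ?w\<bar> + \<bar>snd z - snd ?w\<bar> \<le> 1 / real n + 1 / real n"
      using d[of "fst z"] d[of "snd z"] by (simp add: p_def)
    then have "\<bar>F z - F ?w\<bar> \<le> K * (1 / real n + 1 / real n)"
      using lip[of z ?w] K by (meson mult_left_mono order_trans)
    then show "\<bar>F z * indicator unit_square z - (\<Sum>x\<in>board n. F (p x) * indicator (C x) z)\<bar> \<le> 2 * K / real n * indicator unit_square z"
      unfolding part[of "\<lambda>x. F (p x)"] by (auto simp: indicator_def mult.commute)
  qed
  also have "\<dots> = 2 * K / real n"
    using emeasure_rectangle[of 0 1 0 1] by (simp add: measure_def)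
  finally show ?thesis by (simp add: p_def)
qed

section \<open>Convergence\<close>

definition band :: "nat \<Rightarrow> int set" where
  "band R = {- int R..int R}"

abbreviation low_freqs :: "nat \<Rightarrow> (int \<times> int) set" where
  "low_freqs R \<equiv> band R \<times> band R"

lemma sum_band_Suc:
  fixes f :: "int \<Rightarrow> 'a::comm_monoid_add"
  shows "(\<Sum>j\<in>band (Suc R). f j) = (\<Sum>j\<in>band R. f j) + (f (int (Suc R)) + f (- int (Suc R)))"
proof -
  have "band (Suc R) = insert (int (Suc R)) (insert (- int (Suc R)) (band R))" by (auto simp: band_def)
  then show ?thesis by (simp add: band_def add_ac)
qed

lemma theta_part_cis:
  "complex_of_real (theta_part R t x) = (\<Sum>j\<in>band R. of_real (exp (- 2 * pi\<^sup>2 * (of_int j)\<^sup>2 * t)) * cis (2 * pi * of_int j * x))"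
proof (induction R)
  case 0
  then show ?case by (simp add: band_def theta_part_def)
next
  case (Suc R)
  let ?e = "theta_coeff t R"
  have c: "cis (2 * pi * real (Suc R) * x) + cis (- (2 * pi * real (Suc R) * x)) = of_real (2 * cos (2 * pi * real (Suc R) * x))"
    by (simp add: complex_eq_iff)
  have "complex_of_real (theta_part (Suc R) t x) = of_real (theta_part R t x) + of_real (2 * (?e * cos (2 * pi * real (Suc R) * x)))"
    unfolding of_real_add[symmetric] by (simp add: theta_part_def distrib_left)
  also have "of_real (2 * (?e * cos (2 * pi * real (Suc R) * x))) = of_real ?e * (cis (2 * pi * real (Suc R) * x) + cis (- (2 * pi * real (Suc R) * x)))"
    unfolding c by simp
  finally show ?case
    unfolding sum_band_Suc Suc.IH by (simp add: distrib_left del: of_nat_Suc)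
qed

lemma heat_prod: "heat t k = exp (- 2 * pi\<^sup>2 * (of_int (fst k))\<^sup>2 * t) * exp (- 2 * pi\<^sup>2 * (of_int (snd k))\<^sup>2 * t)"
  by (simp add: heat_def exp_add[symmetric] algebra_simps)

lemma torus_density_part_chr:
  "complex_of_real (torus_density_part R t (grid n x))
     = (\<Sum>k\<in>low_freqs R. of_real (heat t k) * chr n k x)"
proof -
  let ?e = "\<lambda>j::int. complex_of_real (exp (- 2 * pi\<^sup>2 * (of_int j)\<^sup>2 * t))"
  have "complex_of_real (torus_density_part R t (grid n x))
      = (\<Sum>j\<in>band R. ?e j * root1 n (j * fst x)) * (\<Sum>j\<in>band R. ?e j * root1 n (j * snd x))"
    by (simp add: torus_density_part_def theta_part_cis root1_def mult_ac)
  also have "\<dots> = (\<Sum>k\<in>low_freqs R. (?e (fst k) * root1 n (fst k * fst x)) * (?e (snd k) * root1 n (snd k * snd x)))"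
    unfolding sum_product sum.cartesian_product by (simp add: case_prod_beta)
  also have "\<dots> = (\<Sum>k\<in>low_freqs R. of_real (heat t k) * chr n k x)"
    by (intro sum.cong refl) (simp add: heat_prod chr_def root1_add mult_ac)
  finally show ?thesis .
qed

text \<open>There is no aliasing: with \<open>2 R < n\<close> and \<open>l\<close> in the centred
  window, the components of \<open>k + l\<close> are smaller than n in modulus, so n divides them
  only if they vanish.\<close>

lemma torus_density_part_fourier:
  assumes n: "n > 0" and R: "2 * R < n" and l: "2 * \<bar>fst l\<bar> \<le> int n" "2 * \<bar>snd l\<bar> \<le> int n"
  shows "(\<Sum>x\<in>board n. (\<Sum>k\<in>low_freqs R. of_real (heat t k) * chr n k (x - y)) * chr n l x)
    = (if l \<in> low_freqs R then of_nat n ^ 2 * of_real (heat t l) * chr n l y else 0)"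
proof -
  have board: "board n = {0..<0 + int n} \<times> {0..<0 + int n}" by (simp add: board_def)
  have "chr n k (x - y) * chr n l x = chr n k (- y) * chr n x (k + l)" for k x
    by (simp add: chr_def algebra_simps flip: root1_add)
  then have orth: "(\<Sum>x\<in>board n. chr n k (x - y) * chr n l x)
      = chr n k (- y) * (if int n dvd fst k + fst l \<and> int n dvd snd k + snd l then of_nat n ^ 2 else 0)" for k
    unfolding board using sum_chr[OF n, where a = 0 and b = 0 and x = "k + l"] by (simp flip: sum_distrib_left)
  have dv: "int n dvd a + b \<longleftrightarrow> a = - b" if "a \<in> band R" "2 * \<bar>b\<bar> \<le> int n" for a b
  proof
    assume "int n dvd a + b"
    moreover have "\<bar>a + b\<bar> < int n" using that R by (auto simp: band_def)
    ultimately have "a + b = 0" using zdvd_not_zless zdvd_imp_le by (metis abs_of_nonneg dvd_abs_iff abs_ge_zero linorder_not_less zero_less_abs_iff)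
    then show "a = - b" by simp
  qed simp
  have "(\<Sum>x\<in>board n. (\<Sum>k\<in>low_freqs R. of_real (heat t k) * chr n k (x - y)) * chr n l x)
      = (\<Sum>k\<in>low_freqs R. of_real (heat t k) * (\<Sum>x\<in>board n. chr n k (x - y) * chr n l x))"
    unfolding sum_distrib_left sum_distrib_right by (subst sum.swap) (simp add: mult_ac)
  also have "\<dots> = (\<Sum>k\<in>low_freqs R. if k = - l then of_real (heat t k) * (chr n k (- y) * of_nat n ^ 2) else 0)"
    unfolding orth
  proof (intro sum.cong refl)
    fix k assume "k \<in> low_freqs R"
    then have "(int n dvd fst k + fst l \<and> int n dvd snd k + snd l) = (k = - l)"
      using dv[of "fst k" "fst l"] dv[of "snd k" "snd l"] l by (auto simp: prod_eq_iff)
    then show "of_real (heat t k) * (chr n k (- y) * (if int n dvd fst k + fst l \<and> int n dvd snd k + snd l then of_nat n ^ 2 else 0))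
      = (if k = - l then of_real (heat t k) * (chr n k (- y) * of_nat n ^ 2) else 0)" by simp
  qed
  also have "\<dots> = (if - l \<in> low_freqs R then of_real (heat t (- l)) * (chr n (- l) (- y) * of_nat n ^ 2) else 0)"
    by (subst sum.delta) (auto simp: band_def)
  also have "- l \<in> low_freqs R \<longleftrightarrow> l \<in> low_freqs R"
    by (cases l) (auto simp: band_def)
  also have "heat t (- l) = heat t l" by (simp add: heat_def)
  also have "chr n (- l) (- y) = chr n l y" by (simp add: chr_def)
  finally show ?thesis by (simp add: mult_ac)
qed

definition freqs :: "nat \<Rightarrow> int set" where
  "freqs n = {- int (n div 2)..<- int (n div 2) + int n}"

abbreviation high_freqs :: "nat \<Rightarrow> nat \<Rightarrow> (int \<times> int) set" where
  "high_freqs n R \<equiv> freqs n \<times> freqs n - low_freqs R"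

lemma freqs_bound: "j \<in> freqs n \<Longrightarrow> 2 * \<bar>j\<bar> \<le> int n"
  by (auto simp: freqs_def)

lemma band_subset_freqs: "2 * R < n \<Longrightarrow> band R \<subseteq> freqs n"
  by (auto simp: band_def freqs_def)

text \<open>Cauchy-Schwarz over the \<open>n^2\<close> squares costs exactly the factor that
  Parseval returns. The start \<open>y\<close> of the piece gives both transforms the same phase,
  which the norm removes.\<close>

lemma piece_law_L1:
  fixes n p m R :: nat and t :: real
  assumes n: "n \<ge> 2" and p: "p \<in> {1..n\<^sup>2 - 1}" and R: "2 * R < n"
  defines "y \<equiv> initial_config n p"
  defines "r \<equiv> rel_pos n (initial_config n 0) y"
  defines "\<phi> \<equiv> \<lambda>k. (tagged n k ^^ m) (\<lambda>_. 1) r"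
  shows "(\<Sum>x\<in>board n. \<bar>pmf (piece_law n p m) x
      - torus_density_part R t (grid n (x - y)) / real n ^ 2\<bar>)
    \<le> sqrt ((\<Sum>k\<in>low_freqs R. (norm (\<phi> k - of_real (heat t k)))\<^sup>2)
          + (\<Sum>k\<in>high_freqs n R. (norm (\<phi> k))\<^sup>2))"
proof -
  have n0: "n > 0" using n by simp
  define g where "g x = pmf (piece_law n p m) x
      - torus_density_part R t (grid n (x - y)) / real n ^ 2" for x
  define G where "G k = (\<Sum>x\<in>board n. complex_of_real (g x) * chr n k x)" for k
  have G: "G k = chr n k y * (\<phi> k - (if k \<in> low_freqs R then of_real (heat t k) else 0))"
    if k: "k \<in> freqs n \<times> freqs n" for k
  proof -
    have kb: "2 * \<bar>fst k\<bar> \<le> int n" "2 * \<bar>snd k\<bar> \<le> int n" using k freqs_bound by auto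
    define Q where "Q x = (\<Sum>k\<in>low_freqs R. of_real (heat t k) * chr n k (x - y))" for x
    have "G k = (\<Sum>x\<in>board n. of_real (pmf (piece_law n p m) x) * chr n k x)
        - (\<Sum>x\<in>board n. Q x * chr n k x) / of_nat n ^ 2"
      unfolding G_def g_def of_real_diff of_real_divide torus_density_part_chr Q_def[symmetric]
      by (simp add: left_diff_distrib sum_subtractf sum_divide_distrib)
    then show ?thesis
      unfolding Q_def piece_law_fourier[OF n p] torus_density_part_fourier[OF n0 R kb]
      using n0 by (simp add: \<phi>_def r_def y_def right_diff_distrib)
  qed
  have sub: "low_freqs R \<subseteq> freqs n \<times> freqs n" using band_subset_freqs[OF R] by auto
  have fin: "finite (freqs n \<times> freqs n)" by (simp add: freqs_def)
  have "real n ^ 2 * (\<Sum>x\<in>board n. (g x)\<^sup>2) = (\<Sum>k\<in>freqs n \<times> freqs n. (norm (G k))\<^sup>2)"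
    using parseval[OF n0, of "\<lambda>x. complex_of_real (g x)" "- int (n div 2)"] by (simp add: G_def freqs_def)
  also have "\<dots> = (\<Sum>k\<in>freqs n \<times> freqs n. (norm (\<phi> k - (if k \<in> low_freqs R then of_real (heat t k) else 0)))\<^sup>2)"
    by (intro sum.cong refl) (simp add: G norm_mult)
  also have "\<dots> = (\<Sum>k\<in>high_freqs n R. (norm (\<phi> k))\<^sup>2)
      + (\<Sum>k\<in>low_freqs R. (norm (\<phi> k - of_real (heat t k)))\<^sup>2)"
    by (subst sum.subset_diff[OF sub fin]) simp
  finally have P: "real n ^ 2 * (\<Sum>x\<in>board n. (g x)\<^sup>2) = (\<Sum>k\<in>low_freqs R. (norm (\<phi> k - of_real (heat t k)))\<^sup>2)
          + (\<Sum>k\<in>high_freqs n R. (norm (\<phi> k))\<^sup>2)" by simp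
  have "(\<Sum>x\<in>board n. \<bar>g x\<bar>)\<^sup>2 \<le> real n ^ 2 * (\<Sum>x\<in>board n. (g x)\<^sup>2)"
    using sum_squared_le_sum_of_squares[of "\<lambda>x. \<bar>g x\<bar>" "board n"] by (simp add: mult.commute)
  then have "(\<Sum>x\<in>board n. \<bar>g x\<bar>) \<le> sqrt (real n ^ 2 * (\<Sum>x\<in>board n. (g x)\<^sup>2))"
    by (rule real_le_rsqrt)
  then show ?thesis unfolding P unfolding g_def .
qed

lemma theta_part_periodic: "theta_part R t (x + of_int m) = theta_part R t x"
proof -
  have "cos (2 * pi * real (Suc j) * (x + of_int m)) = cos (2 * pi * real (Suc j) * x)" for j
  proof -
    have "2 * pi * real (Suc j) * (x + of_int m) = 2 * pi * real (Suc j) * x + 2 * pi * of_int (int (Suc j) * m)"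
      by (simp add: algebra_simps)
    then show ?thesis
      using sin_int_2pin[of "int (Suc j) * m"] cos_int_2pin[of "int (Suc j) * m"] by (simp only: cos_add)
  qed
  then show ?thesis by (simp add: theta_part_def)
qed

lemma theta_part_mod:
  assumes "n > 0"
  shows "theta_part R t (of_int (a mod int n) / real n) = theta_part R t (of_int a / real n)"
proof -
  have "real_of_int a = of_int (a mod int n) + of_int (a div int n) * real n"
    by (metis mod_mult_div_eq mult.commute of_int_add of_int_mult of_int_of_nat_eq)
  then have "of_int a / real n = of_int (a mod int n) / real n + of_int (a div int n)"
    using assms by (simp add: field_simps)
  then show ?thesis by (simp only: theta_part_periodic)
qed

text \<open>Any statistic summed over the board is translation invariant, so the starting square of
  the piece drops out of the comparison with the uniform law.\<close>

lemma sum_torus_density_shift: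
  assumes n: "n > 0"
  shows "(\<Sum>x\<in>board n. h (torus_density_part R t (grid n (x - y))))
    = (\<Sum>x\<in>board n. h (torus_density_part R t (grid n x)))"
proof -
  have "torus_density_part R t (grid n (x - y))
      = torus_density_part R t (grid n (shift n (- y) x))" for x
    using theta_part_mod[OF n, of R t "fst x - fst y"] theta_part_mod[OF n, of R t "snd x - snd y"]
    by (simp add: torus_density_part_def shift_def)
  then show ?thesis
    using sum_shift[OF n, of "\<lambda>x. h (torus_density_part R t (grid n x))" "- y"]
    by simp
qed

text \<open>The first term is the Riemann sum error of the truncated density, the second its
  truncation error. Both depend on \<open>t\<close> only through the lower bound
  \<open>t0\<close>.\<close>

lemma d_Br_riemann:
  assumes BM: "planar_brownian_motion M B" and t: "0 < t0" "t0 \<le> t" and n: "n > 0"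
  defines "C \<equiv> (1 + nome t0) / (1 - nome t0)"
  shows "\<bar>d_Br M B t - (\<Sum>x\<in>board n. \<bar>torus_density_part R t (grid n x) - 1\<bar>) / real n ^ 2 / 2\<bar>
    \<le> C * theta_lipschitz R / real n + 2 * (1 + nome t0) / (1 - nome t0)\<^sup>2 * nome t0 ^ Suc R"
proof -
  have t': "t > 0" using t by simp
  define e where "e = 4 * (1 + nome t0) / (1 - nome t0)\<^sup>2 * nome t0 ^ Suc R"
  define F where "F z = \<bar>torus_density_part R t z - 1\<bar>" for z
  define H where "H z = \<bar>torus_density t z - 1\<bar>" for z
  have C: "C \<ge> 0" using nome_bounds[OF t(1)] by (simp add: C_def)
  have part_bound: "\<bar>torus_density_part R t z\<bar> \<le> C * C" for z
    unfolding torus_density_part_def abs_mult C_def using theta_part_bound[OF t]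
    by (intro mult_mono) (auto intro: order_trans[OF abs_ge_zero])
  have [measurable]: "F \<in> borel_measurable borel" "H \<in> borel_measurable borel"
    unfolding F_def[abs_def] H_def[abs_def] by measurable
  have iF: "integrable lborel (\<lambda>z. F z * indicator unit_square z)"
  proof (rule unit_square_integrable[where c = "C * C + 1"])
    show "\<bar>F z\<bar> \<le> C * C + 1" for z using part_bound[of z] unfolding F_def by linarith
  qed measurable
  have iH: "integrable lborel (\<lambda>z. H z * indicator unit_square z)"
  proof (rule unit_square_integrable[where c = "C\<^sup>2 + 1"])
    show "\<bar>H z\<bar> \<le> C\<^sup>2 + 1" for z using torus_density_bound[OF t, of z] unfolding H_def C_def by linarith
  qed measurable
  have L0: "theta_lipschitz R \<ge> 0" by (simp add: theta_lipschitz_def sum_nonneg)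
  have lip: "\<bar>F z - F w\<bar> \<le> (C * theta_lipschitz R) * (\<bar>fst z - fst w\<bar> + \<bar>snd z - snd w\<bar>)" for z w
  proof -
    have "\<bar>F z - F w\<bar> \<le> \<bar>torus_density_part R t z - torus_density_part R t w\<bar>" unfolding F_def by linarith
    also have "\<dots> \<le> C * (\<bar>theta_part R t (fst z) - theta_part R t (fst w)\<bar> + \<bar>theta_part R t (snd z) - theta_part R t (snd w)\<bar>)"
      unfolding torus_density_part_def C_def
      by (rule abs_mult_diff_le[OF theta_part_bound[OF t] theta_part_bound[OF t]])
    also have "\<dots> \<le> C * (theta_lipschitz R * \<bar>fst z - fst w\<bar> + theta_lipschitz R * \<bar>snd z - snd w\<bar>)"
      using C by (intro mult_left_mono add_mono theta_part_lipschitz t')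
    finally show ?thesis by (simp add: algebra_simps)
  qed
  have "\<bar>(LINT z|lborel. F z * indicator unit_square z) - (\<Sum>x\<in>board n. F (grid n x)) / real n ^ 2\<bar>
      \<le> 2 * (C * theta_lipschitz R) / real n"
    using C L0 by (intro riemann_square n lip iF) auto
  then have 1: "\<bar>(LINT z|lborel. F z * indicator unit_square z) - (\<Sum>x\<in>board n. F (grid n x)) / real n ^ 2\<bar>
      \<le> 2 * (C * theta_lipschitz R / real n)" by simp
  have "\<bar>(LINT z|lborel. H z * indicator unit_square z) - (LINT z|lborel. F z * indicator unit_square z)\<bar> \<le> e"
  proof -
    have "\<bar>(LINT z|lborel. H z * indicator unit_square z) - (LINT z|lborel. F z * indicator unit_square z)\<bar>
        = \<bar>(LINT z|lborel. H z * indicator unit_square z - F z * indicator unit_square z)\<bar>"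
      by (subst Bochner_Integration.integral_diff[OF iH iF]) simp
    also have "\<dots> \<le> (LINT z|lborel. \<bar>H z * indicator unit_square z - F z * indicator unit_square z\<bar>)"
      by (rule integral_abs_bound)
    also have "\<dots> \<le> (LINT z|lborel. e * indicator unit_square z)"
    proof (rule integral_mono)
      show "integrable lborel (\<lambda>z. \<bar>H z * indicator unit_square z - F z * indicator unit_square z\<bar>)"
        using iH iF by simp
      show "integrable lborel (\<lambda>z. e * indicator unit_square z)"
        by (rule unit_square_integrable[where c = "\<bar>e\<bar>"]) auto
      fix z
      have "\<bar>H z - F z\<bar> \<le> e"
        using torus_density_approx[OF t, of z R] unfolding H_def F_def e_def by linarith
      then show "\<bar>H z * indicator unit_square z - F z * indicator unit_square z\<bar> \<le> e * indicator unit_square z"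
        by (auto simp: indicator_def)
    qed
    also have "\<dots> = e"
      using emeasure_rectangle[of 0 1 0 1] by (simp add: measure_def)
    finally show ?thesis .
  qed
  then have 2: "\<bar>(LINT z|lborel. H z * indicator unit_square z) - (LINT z|lborel. F z * indicator unit_square z)\<bar>
      \<le> 2 * (2 * (1 + nome t0) / (1 - nome t0)\<^sup>2 * nome t0 ^ Suc R)"
  proof -
    have "4 * a / b * c = 2 * (2 * a / b * c)" for a b c :: real by simp
    then have "e = 2 * (2 * (1 + nome t0) / (1 - nome t0)\<^sup>2 * nome t0 ^ Suc R)" unfolding e_def .
    then show ?thesis using \<open>_ \<le> e\<close> by (simp only:)
  qed
  have 3: "d_Br M B t = (LINT z|lborel. H z * indicator unit_square z) / 2"
    unfolding H_def by (rule d_Br_formula[OF BM t'])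
  have "\<bar>d - s / 2\<bar> \<le> x + y" if "\<bar>a - s\<bar> \<le> 2 * x" "\<bar>b - a\<bar> \<le> 2 * y" "d = b / 2" for a b d s x y :: real
    using that by linarith
  from this[OF 1 2 3] show ?thesis unfolding F_def .
qed

text \<open>If uniformity failed, a bad point chosen for each n would form a sequence contradicting
  the hypothesis. This lets all estimates be made along one arbitrary sequence of times.\<close>

lemma uniform_limit_sequences:
  fixes F :: "nat \<Rightarrow> 'a \<Rightarrow> real"
  assumes "\<And>t :: nat \<Rightarrow> 'a. (\<And>n. t n \<in> K) \<Longrightarrow> (\<lambda>n. F n (t n) - G (t n)) \<longlonglongrightarrow> 0"
  shows "uniform_limit K F G sequentially"
proof (rule uniform_limitI)
  fix e :: real assume e: "e > 0"
  show "\<forall>\<^sub>F n in sequentially. \<forall>x\<in>K. dist (F n x) (G x) < e"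
  proof (cases "K = {}")
    case False
    then obtain a where a: "a \<in> K" by blast
    define t where "t n = (if \<exists>x\<in>K. \<not> dist (F n x) (G x) < e then SOME x. x \<in> K \<and> \<not> dist (F n x) (G x) < e else a)" for n
    have t: "t n \<in> K \<and> ((\<exists>x\<in>K. \<not> dist (F n x) (G x) < e) \<longrightarrow> \<not> dist (F n (t n)) (G (t n)) < e)" for n
    proof (cases "\<exists>x\<in>K. \<not> dist (F n x) (G x) < e")
      case True
      then have "\<exists>x. x \<in> K \<and> \<not> dist (F n x) (G x) < e" by blast
      from someI_ex[OF this] show ?thesis using True by (simp add: t_def)
    qed (use a in \<open>simp add: t_def\<close>)
    have "(\<lambda>n. F n (t n) - G (t n)) \<longlonglongrightarrow> 0" using assms t by blast
    then have "\<forall>\<^sub>F n in sequentially. dist (F n (t n) - G (t n)) 0 < e" using e by (rule tendstoD)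
    then show ?thesis by eventually_elim (use t in \<open>force simp: dist_real_def\<close>)
  qed simp
qed

lemma piece_law_tv:
  assumes n: "n \<ge> 2" and p: "p \<in> {1..n\<^sup>2 - 1}"
  shows "tv_dist (measure_pmf (piece_law n p m)) (measure_pmf (pmf_of_set (board n)))
    = (\<Sum>x\<in>board n. \<bar>pmf (piece_law n p m) x - 1 / real n ^ 2\<bar>) / 2"
proof -
  have ne: "board n \<noteq> {}" using origin_in_board[of n] n by auto
  have "tv_dist (measure_pmf (piece_law n p m)) (measure_pmf (pmf_of_set (board n)))
    = (\<Sum>x\<in>board n. \<bar>pmf (piece_law n p m) x - pmf (pmf_of_set (board n)) x\<bar>) / 2"
    using piece_law_in_board[OF n p] ne by (intro tv_dist_pmf) auto
  then show ?thesis using ne by simp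
qed

lemma pmf_sum_triangle:
  fixes n p m R :: nat and t :: real
  assumes n: "n \<ge> 2" and p: "p \<in> {1..n\<^sup>2 - 1}"
  defines "y \<equiv> initial_config n p"
  shows "\<bar>tv_dist (measure_pmf (piece_law n p m)) (measure_pmf (pmf_of_set (board n)))
      - (\<Sum>x\<in>board n. \<bar>torus_density_part R t (grid n x) - 1\<bar>) / real n ^ 2 / 2\<bar>
    \<le> (\<Sum>x\<in>board n. \<bar>pmf (piece_law n p m) x
      - torus_density_part R t (grid n (x - y)) / real n ^ 2\<bar>) / 2"
proof -
  have n0: "n > 0" using n by simp
  let ?q = "\<lambda>x. torus_density_part R t (grid n (x - y))"
  let ?\<nu> = "pmf (piece_law n p m)"
  have "(\<Sum>x\<in>board n. \<bar>torus_density_part R t (grid n x) - 1\<bar>) = (\<Sum>x\<in>board n. \<bar>?q x - 1\<bar>)"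
    by (rule sum_torus_density_shift[OF n0, symmetric])
  moreover have "(\<Sum>x\<in>board n. \<bar>?q x - 1\<bar>) / real n ^ 2 = (\<Sum>x\<in>board n. \<bar>?q x / real n ^ 2 - 1 / real n ^ 2\<bar>)"
    unfolding sum_divide_distrib
    by (intro sum.cong refl) (simp add: diff_divide_distrib[symmetric] abs_divide)
  moreover have "\<bar>(\<Sum>x\<in>board n. \<bar>?\<nu> x - 1 / real n ^ 2\<bar>) - (\<Sum>x\<in>board n. \<bar>?q x / real n ^ 2 - 1 / real n ^ 2\<bar>)\<bar>
      \<le> (\<Sum>x\<in>board n. \<bar>?\<nu> x - ?q x / real n ^ 2\<bar>)"
    unfolding sum_subtractf[symmetric] by (rule order_trans[OF sum_abs sum_mono]) linarith
  ultimately show ?thesis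
    unfolding piece_law_tv[OF n p] by (simp add: abs_divide flip: diff_divide_distrib)
qed


lemma power_times_exp_tendsto_0:
  assumes a: "a > 0"
  shows "(\<lambda>n. real n ^ j * exp (- (a * real n))) \<longlonglongrightarrow> 0"
proof -
  have "filterlim (\<lambda>n. a * real n) at_top sequentially"
    using a by (intro filterlim_tendsto_pos_mult_at_top[OF tendsto_const _ filterlim_real_sequentially])
  then have "(\<lambda>n. (a * real n) ^ j / exp (a * real n)) \<longlonglongrightarrow> 0"
    by (rule filterlim_compose[OF tendsto_power_div_exp_0])
  then have "(\<lambda>n. 1 / a ^ j * ((a * real n) ^ j / exp (a * real n))) \<longlonglongrightarrow> 1 / a ^ j * 0"
    by (intro tendsto_intros)
  then show ?thesis using a by (simp add: power_mult_distrib exp_minus field_simps)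
qed

theorem theorem1:
  fixes M :: "'a measure" and B :: "real \<Rightarrow> 'a \<Rightarrow> real \<times> real"
    and piece :: "nat \<Rightarrow> nat" and K :: "real set"
  assumes "planar_brownian_motion M B"
    and "\<And>n. n \<ge> 2 \<Longrightarrow> piece n \<in> {1..n^2 - 1}"
    and "compact K" and "K \<subseteq> {0<..}"
  shows "uniform_limit K
    (\<lambda>n t. tv_dist (measure_pmf (piece_law n (piece n) (nat \<lfloor>c_puz * real n ^ 4 * t\<rfloor>)))
                   (measure_pmf (pmf_of_set (board n))))
    (d_Br M B) sequentially"
  unfolding steps_def[symmetric]
proof (rule uniform_limit_sequences)
  fix t :: "nat \<Rightarrow> real" assume tK: "\<And>n. t n \<in> K"
  let ?tv = "\<lambda>n. tv_dist (measure_pmf (piece_law n (piece n) (steps n (t n)))) (measure_pmf (pmf_of_set (board n)))"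
  have ne: "K \<noteq> {}" using tK by blast
  \<comment> \<open>Compactness keeps the times away from 0 and bounded, which all tail and
    truncation constants require.\<close>
  obtain t0 where t0: "t0 \<in> K" "\<And>x. x \<in> K \<Longrightarrow> t0 \<le> x"
    using compact_attains_inf[OF assms(3) ne] by blast
  obtain t1 where t1: "\<And>x. x \<in> K \<Longrightarrow> x \<le> t1"
    using compact_attains_sup[OF assms(3) ne] by blast
  have t0p: "t0 > 0" using t0(1) assms(4) by auto
  have tb: "t0 \<le> t n" "0 \<le> t n" "t n \<le> t1" for n
    using t0(2)[OF tK[of n]] t1[OF tK[of n]] t0p by auto
  define q where "q = nome t0"
  have q: "0 < q" "q < 1" using nome_bounds[OF t0p] by (auto simp: q_def)
  define a where "a = t0 / 160"
  have a: "a > 0" using t0p by (simp add: a_def)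
  \<comment> \<open>Its square is the geometric ratio of \<open>tail_estimate\<close>, as
    \<open>tail_sum_le\<close> needs.\<close>
  define p where "p = exp (- (a / 2))"
  have p: "0 < p" "p < 1" "p\<^sup>2 = exp (- a)"
    using a by (simp_all add: p_def power2_eq_square flip: exp_add)
  show "(\<lambda>n. ?tv n - d_Br M B (t n)) \<longlonglongrightarrow> 0"
  proof (rule LIMSEQ_I)
    fix e :: real assume e: "e > 0"
    have "(\<lambda>R. 2 * (1 + q) / (1 - q)\<^sup>2 * (q * q ^ R)) \<longlonglongrightarrow> 2 * (1 + q) / (1 - q)\<^sup>2 * (q * 0)"
      using q by (intro tendsto_intros LIMSEQ_realpow_zero) auto
    then have R1: "\<forall>\<^sub>F R in sequentially. 2 * (1 + q) / (1 - q)\<^sup>2 * (q * q ^ R) < e / 4"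
      by (rule order_tendstoD(2)) (use e in auto)
    have "(\<lambda>R. 4 * (p ^ R * (2 / (1 - p))\<^sup>2)) \<longlonglongrightarrow> 4 * (0 * (2 / (1 - p))\<^sup>2)"
      using p by (intro tendsto_intros LIMSEQ_realpow_zero) auto
    then have R2: "\<forall>\<^sub>F R in sequentially. 4 * (p ^ R * (2 / (1 - p))\<^sup>2) < e\<^sup>2 / 4"
      by (rule order_tendstoD(2)) (use e in auto)
    \<comment> \<open>The cutoff is fixed before n: it controls the truncation of the theta series
      and the geometric tail. For this fixed \<open>R\<close> only finitely many low frequencies
      remain, and they converge one by one.\<close>
    obtain R where R: "2 * (1 + q) / (1 - q)\<^sup>2 * (q * q ^ R) < e / 4" "4 * (p ^ R * (2 / (1 - p))\<^sup>2) < e\<^sup>2 / 4"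
      using eventually_happens[OF eventually_conj[OF R1 R2]] by auto
    define C where "C = (1 + q) / (1 - q)"
    define r where "r n = rel_pos n (initial_config n 0) (initial_config n (piece n))" for n
    define \<phi> where "\<phi> n k = (tagged n k ^^ steps n (t n)) (\<lambda>_. 1) (r n)" for n k
    define X where "X n = (\<Sum>k\<in>low_freqs R. (norm (\<phi> n k - of_real (heat (t n) k)))\<^sup>2)" for n
    have r: "r n \<in> holed n" if "n \<ge> 2" for n
      using initial_rel_pos(2)[OF that] assms(2)[OF that] by (simp add: r_def)
    have "X \<longlonglongrightarrow> (\<Sum>k\<in>low_freqs R. (norm (0::complex))\<^sup>2)"
      unfolding X_def[abs_def] \<phi>_def by (intro tendsto_intros tagged_one_tendsto[OF tb(2,3)] r)
    then have X0: "\<forall>\<^sub>F n in sequentially. X n < e\<^sup>2 / 4"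
      by (rule order_tendstoD(2)) (use e in auto)
    have "(\<lambda>n. 4 * (real n ^ 2 * exp (- (a * real n)))) \<longlonglongrightarrow> 4 * 0"
      by (intro tendsto_intros power_times_exp_tendsto_0 a)
    then have T0: "\<forall>\<^sub>F n in sequentially. 4 * (real n ^ 2 * exp (- (a * real n))) < e\<^sup>2 / 4"
      by (rule order_tendstoD(2)) (use e in auto)
    have A0: "\<forall>\<^sub>F n in sequentially. C * theta_lipschitz R / real n < e / 4"
      using e by (intro order_tendstoD(2)[OF lim_const_over_n]) auto
    have M0: "\<forall>\<^sub>F n in sequentially. real n ^ 1 * exp (- (a * real n)) < 1"
      by (intro order_tendstoD(2)[OF power_times_exp_tendsto_0[OF a]]) auto
    have "1 / (pi - 1) > 1 / 4" using pi_gt_2 pi_less_4 by (intro divide_strict_left_mono) auto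
    then have C0: "\<forall>\<^sub>F n in sequentially. 1 / 4 < conductance n"
      by (rule order_tendstoD(1)[OF conductance_tendsto])
    have N0: "\<forall>\<^sub>F n in sequentially. real n \<ge> 1 / t0"
      using filterlim_real_sequentially unfolding filterlim_at_top by blast
    have "\<forall>\<^sub>F n in sequentially. norm (?tv n - d_Br M B (t n) - 0) < e"
      using eventually_dipole_height X0 T0 A0 M0 C0 N0 eventually_gt_at_top[of "2 * R"]
    proof eventually_elim
      case (elim n)
      then have n: "n \<ge> 2" and n0: "n > 0" by auto
      note pc = assms(2)[OF n]
      let ?D = "(\<Sum>x\<in>board n. \<bar>torus_density_part R (t n) (grid n x) - 1\<bar>) / real n ^ 2 / 2"
      define Y where "Y = (\<Sum>k\<in>high_freqs n R. (norm (\<phi> n k))\<^sup>2)"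
      have nt: "1 \<le> real n ^ 4 * t0"
      proof -
        have "1 \<le> real n * t0" using elim t0p by (simp add: field_simps)
        also have "\<dots> \<le> real n ^ 4 * t0" using n t0p self_le_power[of "real n" 4] by (intro mult_right_mono) auto
        finally show ?thesis .
      qed
      \<comment> \<open>The exponential term does not depend on \<open>k\<close> and is paid at most
        \<open>n^2\<close> times; the geometric one is summed outside the box.\<close>
      have "Y \<le> (\<Sum>k\<in>high_freqs n R. 4 * (exp (- (a * real n)) + (p\<^sup>2) ^ nat (\<bar>fst k\<bar> + \<bar>snd k\<bar>)))"
        unfolding Y_def
      proof (rule sum_mono)
        fix k assume "k \<in> high_freqs n R"
        then have k: "2 * \<bar>fst k\<bar> \<le> int n" "2 * \<bar>snd k\<bar> \<le> int n" using freqs_bound by auto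
        show "(norm (\<phi> n k))\<^sup>2 \<le> 4 * (exp (- (a * real n)) + (p\<^sup>2) ^ nat (\<bar>fst k\<bar> + \<bar>snd k\<bar>))"
          using tail_estimate[of n t0 k "t n" "r n"] elim n nt k tb(1) t0p r[OF n]
          by (simp add: \<phi>_def p(3) a_def)
      qed
      also have "\<dots> = 4 * (real (card (high_freqs n R)) * exp (- (a * real n)))
          + 4 * (\<Sum>k\<in>high_freqs n R. (p\<^sup>2) ^ nat (\<bar>fst k\<bar> + \<bar>snd k\<bar>))"
        by (simp add: sum.distrib flip: sum_distrib_left)
      also have "\<dots> \<le> 4 * (real n ^ 2 * exp (- (a * real n))) + 4 * (p ^ R * (2 / (1 - p))\<^sup>2)"
      proof (intro add_mono mult_left_mono mult_right_mono)
        have "card (high_freqs n R) \<le> card (freqs n \<times> freqs n)"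
          by (intro card_mono) (auto simp: freqs_def)
        also have "\<dots> = n ^ 2" by (simp add: freqs_def card_cartesian_product power2_eq_square)
        finally show "real (card (high_freqs n R)) \<le> real n ^ 2"
          by (metis of_nat_le_iff of_nat_power)
        have "high_freqs n R
            = {k \<in> freqs n \<times> freqs n. \<not> (\<bar>fst k\<bar> \<le> int R \<and> \<bar>snd k\<bar> \<le> int R)}"
          by (auto simp: band_def)
        then show "(\<Sum>k\<in>high_freqs n R. (p\<^sup>2) ^ nat (\<bar>fst k\<bar> + \<bar>snd k\<bar>)) \<le> p ^ R * (2 / (1 - p))\<^sup>2"
          using tail_sum_le[OF p(1,2), of "freqs n" R] by (simp add: freqs_def)
      qed auto
      finally have Y: "Y \<le> 4 * (real n ^ 2 * exp (- (a * real n))) + 4 * (p ^ R * (2 / (1 - p))\<^sup>2)" .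
      \<comment> \<open>Low frequencies and the two tail terms are each below
        \<open>e^2 / 4\<close>, so the square root stays below \<open>e\<close>. Halved, it leaves
        \<open>e / 2\<close> for the Riemann sum and truncation errors.\<close>
      have "x + y < w" if "y \<le> u + v" "x < w / 4" "u < w / 4" "v < w / 4" "w > 0" for u v w x y :: real
        using that by linarith
      from this[OF Y elim(2,3) R(2)] have "X n + Y < e\<^sup>2" using e by simp
      then have "sqrt (X n + Y) < e" using e by (intro real_less_lsqrt) auto
      moreover have "\<bar>?tv n - ?D\<bar> \<le> sqrt (X n + Y) / 2"
        using pmf_sum_triangle[OF n pc, of "steps n (t n)" R "t n"]
          piece_law_L1[OF n pc, of R "steps n (t n)" "t n"] elim
        by (simp add: X_def Y_def \<phi>_def r_def)
      moreover have "\<bar>d_Br M B (t n) - ?D\<bar> \<le> C * theta_lipschitz R / real n + 2 * (1 + q) / (1 - q)\<^sup>2 * q ^ Suc R"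
        unfolding C_def q_def by (rule d_Br_riemann[OF assms(1) t0p tb(1) n0])
      moreover have "\<bar>x - y\<bar> < e" if "s < e" "\<bar>x - d\<bar> \<le> s / 2" "\<bar>y - d\<bar> \<le> u + v" "u < e / 4" "v < e / 4" for x y d s u v :: real
        using that by linarith
      ultimately show ?case using elim(4) R(1) by simp
    qed
    then show "\<exists>no. \<forall>n\<ge>no. norm (?tv n - d_Br M B (t n) - 0) < e"
      by (simp add: eventually_sequentially)
  qed
qed

end
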